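(* Let $\lambda=(k,k,\ldots,k)$ be a uniform partition of $n$ other than $(1,1,\ldots,1)$, and let $G\le\mathcal{S}_n$ be $\lambda$-homogeneous. Then one of the following holds: (1) $G$ is $\lambda$-transitive; (2) $n=6$, $\lambda=(3,3)$, and either $G=\mathrm{PSL}(2,5)$ or $G=\mathrm{AGL}(1,5)$ fixing a point; (3) $n=10$, $\lambda=(5,5)$, and $G$ is $\mathrm{PSL}(2,8)$ or $\mathrm{P\Gamma L}(2,8)$, in both cases fixing a point (acting on the other $9$ points); (4) $G$ fixes a point and acts as the alternating or the symmetric group on the remaining points.
   Context: $\Omega=\{1,\ldots,n\}$. A partition of $n$ is a non-increasing sequence of positive integers with sum $n$; it is uniform if all parts are equal. An ordered partition $(A_1,A_2,\ldots)$ of $\Omega$ has type $\lambda$ if $|A_i|=\lambda_i$. $G$ is $\lambda$-transitive if for any two ordered partitions $(A_i)$, $(B_i)$ of type $\lambda$ there is $g\in G$ with $A_ig=B_i$ for all $i$; $G$ is $\lambda$-homogeneous if for any two such ordered partitions there is $g\in G$ mapping the set of parts $\{A_1,A_2,\ldots\}$ onto the set of parts $\{B_1,B_2,\ldots\}$. The named groups are in their standard actions of degree $6$, $5$, $9$ respectively. *)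

theory Defs
  imports "HOL-Algebra.Sym_Groups"
begin

definition ordered_partition_type :: "nat \<Rightarrow> nat \<Rightarrow> (nat \<Rightarrow> nat set) \<Rightarrow> bool" where
  "ordered_partition_type n k A \<longleftrightarrow>
     (\<forall>i < n div k. A i \<subseteq> {1..n} \<and> card (A i) = k) \<and>
     (\<forall>i < n div k. \<forall>j < n div k. i \<noteq> j \<longrightarrow> A i \<inter> A j = {}) \<and>
     (\<Union>i < n div k. A i) = {1..n}"

definition lambda_transitive :: "nat \<Rightarrow> nat \<Rightarrow> (nat \<Rightarrow> nat) set \<Rightarrow> bool" where
  "lambda_transitive n k G \<longleftrightarrow>
     (\<forall>A B. ordered_partition_type n k A \<longrightarrow> ordered_partition_type n k B \<longrightarrow>
        (\<exists>g \<in> G. \<forall>i < n div k. g ` A i = B i))"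

definition lambda_homogeneous :: "nat \<Rightarrow> nat \<Rightarrow> (nat \<Rightarrow> nat) set \<Rightarrow> bool" where
  "lambda_homogeneous n k G \<longleftrightarrow>
     (\<forall>A B. ordered_partition_type n k A \<longrightarrow> ordered_partition_type n k B \<longrightarrow>
        (\<exists>g \<in> G. (\<lambda>i. g ` A i) ` {..< n div k} = B ` {..< n div k}))"

text \<open>Projective line PG(1,q): field elements are 0..q-1, the point at infinity is q.
  Given field operations, the Moebius map x \<mapsto> (a x + b)/(c x + d).\<close>

definition mobius :: "(nat \<Rightarrow> nat \<Rightarrow> nat) \<Rightarrow> (nat \<Rightarrow> nat \<Rightarrow> nat) \<Rightarrow> (nat \<Rightarrow> nat) \<Rightarrow> nat
    \<Rightarrow> nat \<Rightarrow> nat \<Rightarrow> nat \<Rightarrow> nat \<Rightarrow> nat \<Rightarrow> nat" where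
  "mobius add mul iv q a b c d x =
     (if x = q then (if c = 0 then q else mul a (iv c))
      else (let den = add (mul c x) d in
            if den = 0 then q else mul (add (mul a x) b) (iv den)))"

text \<open>Relabel a map on {0..q} (the projective line) to a permutation of the points {1..q+1}
  (element e is point e+1, infinity is point q+1), identity elsewhere.\<close>

definition lift_pl :: "nat \<Rightarrow> (nat \<Rightarrow> nat) \<Rightarrow> nat \<Rightarrow> nat" where
  "lift_pl q f p = (if 1 \<le> p \<and> p \<le> q + 1 then f (p - 1) + 1 else p)"

definition f5_add :: "nat \<Rightarrow> nat \<Rightarrow> nat" where "f5_add a b = (a + b) mod 5"
definition f5_mul :: "nat \<Rightarrow> nat \<Rightarrow> nat" where "f5_mul a b = (a * b) mod 5"
definition f5_inv :: "nat \<Rightarrow> nat" where "f5_inv a = (a ^ 3) mod 5"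

definition PSL_2_5 :: "(nat \<Rightarrow> nat) set" where
  "PSL_2_5 = { lift_pl 5 (mobius f5_add f5_mul f5_inv 5 a b c d) | a b c d.
      a < 5 \<and> b < 5 \<and> c < 5 \<and> d < 5 \<and>
      (\<exists>t \<in> {1..4}. (t * t) mod 5 = (a * d + 4 * (b * c)) mod 5) }"

definition AGL_1_5_fix :: "(nat \<Rightarrow> nat) set" where
  "AGL_1_5_fix = { lift_pl 5 (mobius f5_add f5_mul f5_inv 5 a b 0 1) | a b.
      a \<in> {1..4} \<and> b < 5 }"

subsection \<open>GF(8) = GF(2)[x]/(x^3+x+1), elements encoded as bit vectors 0..7\<close>

definition f8_add :: "nat \<Rightarrow> nat \<Rightarrow> nat" where "f8_add a b = xor a b"

definition f8_mul :: "nat \<Rightarrow> nat \<Rightarrow> nat" where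
  "f8_mul a b =
     (let r = xor (xor (if bit b 0 then a else 0) (if bit b 1 then 2 * a else 0))
                  (if bit b 2 then 4 * a else 0);
          r1 = (if bit r 4 then xor r 22 else r);
          r2 = (if bit r1 3 then xor r1 11 else r1)
      in r2)"

definition f8_inv :: "nat \<Rightarrow> nat" where
  "f8_inv a = (let a2 = f8_mul a a in f8_mul a2 (f8_mul a2 a2))"

definition f8_frob :: "nat \<Rightarrow> nat" where
  "f8_frob x = (if x = 8 then 8 else f8_mul x x)"

text \<open>PSL(2,8) = PGL(2,8) on the 9 points of PG(1,8) (every nonzero element of GF(8) is a
  square), realised on points 1..9 and fixing all other points.\<close>

definition PSL_2_8 :: "(nat \<Rightarrow> nat) set" where
  "PSL_2_8 = { lift_pl 8 (mobius f8_add f8_mul f8_inv 8 a b c d) | a b c d.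
      a < 8 \<and> b < 8 \<and> c < 8 \<and> d < 8 \<and> f8_add (f8_mul a d) (f8_mul b c) \<noteq> 0 }"

definition PGammaL_2_8 :: "(nat \<Rightarrow> nat) set" where
  "PGammaL_2_8 = { lift_pl 8 (mobius f8_add f8_mul f8_inv 8 a b c d \<circ> (f8_frob ^^ j)) | a b c d j.
      a < 8 \<and> b < 8 \<and> c < 8 \<and> d < 8 \<and> f8_add (f8_mul a d) (f8_mul b c) \<noteq> 0 \<and> j < 3 }"

definition perm_conj :: "nat \<Rightarrow> (nat \<Rightarrow> nat) set \<Rightarrow> (nat \<Rightarrow> nat) set \<Rightarrow> bool" where
  "perm_conj n G H \<longleftrightarrow> (\<exists>\<sigma>. \<sigma> permutes {1..n} \<and> G = (\<lambda>h. \<sigma> \<circ> h \<circ> Hilbert_Choice.inv \<sigma>) ` H)"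

end

(*
Comparing how an invariant set meets the parts shows that G is transitive or fixes a point and is transitive on the
rest. Every prime p with k < p <= n divides the number of partitions and hence the order of G. A prime p slightly
larger than n / 2 (a form of Bertrand's postulate) gives a p-cycle, and by Jordan's theorems G contains
all 3-cycles. For the few small n without such a prime, G is enumerated with respect to labels adapted to a
p-cycle in G: either some explicit word is a 3-cycle or moves few points, or G consists of Moebius maps.
*)
theory Submission
  imports Defs Complex_Main "HOL-Algebra.Sylow" "HOL-Algebra.Multiplicative_Group" "HOL-Computational_Algebra.Primes"
begin

text \<open>Jordan's theorems need a prime p of more than half the degree, with at least three
  points outside the cycle. With a fixed point the degree is n - 1, so the requirement p + 3 \<le> n
  becomes p + 4 \<le> n. No suitable p > k exists for n = 4 and n = 6 and, when a point is fixed,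
  also for n = 8, (n, k) = (10, 5) and (14, 7). If n = 2 k and G fixes a point, then G is (k -
  1)-homogeneous on the others: the part containing the fixed point must go to the part containing
  it. Hence AGL(1,5) (2-homogeneous of degree 5) and the groups over GF(8) (4-homogeneous of degree
  9) appear. Degree 13 is not enumerated: a 6-homogeneous group without 3-cycles is refuted by
  comparing stabilizers of 5-, 6- and 8-sets. PSL(2,5) appears because its two orbits on 3-subsets
  of the projective line are exchanged by complementation, which unordered halves do not see. A
  transitive G with all 3-cycles lands in case (1) since a transposition inside a part corrects the
  parity. A small nontrivial support is as good as a 3-cycle under homogeneity: two conjugates whose
  supports share one point have a 3-cycle as commutator.\<close>

definition supp :: "('a \<Rightarrow> 'a) \<Rightarrow> 'a set" where
  "supp g = {x. g x \<noteq> x}"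

definition homog :: "nat \<Rightarrow> ('a \<Rightarrow> 'a) set \<Rightarrow> 'a set \<Rightarrow> bool" where
  "homog m G \<Omega> \<longleftrightarrow> (\<forall>A B. A \<subseteq> \<Omega> \<longrightarrow> B \<subseteq> \<Omega> \<longrightarrow> card A = m \<longrightarrow> card B = m \<longrightarrow> (\<exists>g\<in>G. g ` A = B))"

definition multitrans :: "nat \<Rightarrow> ('a \<Rightarrow> 'a) set \<Rightarrow> 'a set \<Rightarrow> bool" where
  "multitrans t G \<Omega> \<longleftrightarrow> (\<forall>xs ys. distinct xs \<longrightarrow> distinct ys \<longrightarrow> length xs = t \<longrightarrow> length ys = t \<longrightarrow>
     set xs \<subseteq> \<Omega> \<longrightarrow> set ys \<subseteq> \<Omega> \<longrightarrow> (\<exists>g\<in>G. map g xs = ys))"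

definition transitive :: "('a \<Rightarrow> 'a) set \<Rightarrow> 'a set \<Rightarrow> bool" where
  "transitive G \<Omega> \<longleftrightarrow> (\<forall>x\<in>\<Omega>. \<forall>y\<in>\<Omega>. \<exists>g\<in>G. g x = y)"

section \<open>Orbits of maps of prime order\<close>

lemma funpow_apply_add: "(f ^^ i) ((f ^^ j) x) = (f ^^ (i + j)) x"
  by (simp add: funpow_add)

text \<open>The orbit of a moved point has exactly p elements, all of them moved. Removing it leaves
  an invariant set, so strong induction on the size of X applies. No injectivity is assumed: it
  follows from f^p being the identity on X.\<close>

lemma prime_dvd_card_moved:
  assumes "prime p" "finite X" "f ` X \<subseteq> X" "\<And>x. x \<in> X \<Longrightarrow> (f ^^ p) x = x"
  shows "p dvd card {x \<in> X. f x \<noteq> x}"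
  using assms(2-4)
proof (induction "card X" arbitrary: X rule: less_induct)
  case less
  have fin: "finite X" and inv: "f ` X \<subseteq> X" and per: "\<And>x. x \<in> X \<Longrightarrow> (f ^^ p) x = x"
    using less.prems by auto
  have p1: "p > 1" using assms(1) prime_gt_1_nat by blast
  show ?case
  proof (cases "\<exists>x\<in>X. f x \<noteq> x")
    case False
    then have "{x \<in> X. f x \<noteq> x} = {}" by auto
    then show ?thesis by (metis card.empty dvd_0_right)
  next
    case True
    then obtain x where x: "x \<in> X" "f x \<noteq> x" by blast
    have itX: "(f ^^ i) y \<in> X" if "y \<in> X" for i y
      by (induction i) (use that inv in auto)
    have comm: "(f ^^ i) ((f ^^ j) y) = (f ^^ j) ((f ^^ i) y)" for i j y
      by (metis add.commute comp_apply funpow_add)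
    have mult: "(f ^^ (p * k)) y = y" if "y \<in> X" for k y
    proof (induction k)
      case (Suc k)
      have "(f ^^ (p * Suc k)) y = (f ^^ p) ((f ^^ (p * k)) y)"
        by (metis comp_apply funpow_add mult_Suc_right)
      then show ?case using Suc per that by simp
    qed simp
    \<comment> \<open>Bezout: d a = p b + 1, so f^(d a) y is y on the one hand and f y on the
      other.\<close>
    have gen: "f y = y" if h: "y \<in> X" "(f ^^ d) y = y" "0 < d" "d < p" for y d
    proof -
      have "coprime d p" using that assms(1)
        by (metis coprime_commute nat_dvd_not_less prime_imp_coprime)
      then obtain a b where ab: "d * a = p * b + 1"
        using bezout_nat[of d p] h(3) by (auto simp: coprime_iff_gcd_eq_1)
      have m: "(f ^^ (d * k)) y = y" for k
      proof (induction k)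
        case (Suc k)
        have "(f ^^ (d * Suc k)) y = (f ^^ d) ((f ^^ (d * k)) y)"
          by (metis comp_apply funpow_add mult_Suc_right)
        then show ?case using Suc that by simp
      qed simp
      have "(f ^^ (d * a)) y = f ((f ^^ (p * b)) y)" using ab by simp
      then show ?thesis using m mult that by simp
    qed
    define Q where "Q = (\<lambda>i. (f ^^ i) x) ` {..<p}"
    have inj: "inj_on (\<lambda>i. (f ^^ i) x) {..<p}"
    proof (rule linorder_inj_onI')
      fix i j assume ij: "i \<in> {..<p}" "j \<in> {..<p}" "i < j"
      show "(f ^^ i) x \<noteq> (f ^^ j) x"
      proof
        assume e: "(f ^^ i) x = (f ^^ j) x"
        have "(f ^^ (p - i)) ((f ^^ i) x) = x"
          using ij per x by (metis comp_apply funpow_add le_add_diff_inverse2 less_imp_le_nat lessThan_iff)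
        moreover have "(f ^^ (p - i)) ((f ^^ j) x) = (f ^^ (j - i)) ((f ^^ p) x)"
        proof -
          have "p - i + j = j - i + p" using ij by simp
          then show ?thesis by (metis comp_apply funpow_add)
        qed
        ultimately have "(f ^^ (j - i)) x = x" using e per x by simp
        then show False using gen[of x "j - i"] ij x less_imp_diff_less[of j p i] by auto
      qed
    qed
    have cQ: "card Q = p" unfolding Q_def using card_image[OF inj] by simp
    have QX: "Q \<subseteq> X" unfolding Q_def using itX x by auto
    have Qmoved: "f y \<noteq> y" if yQ: "y \<in> Q" for y
    proof
      assume fy: "f y = y"
      obtain i where i: "i < p" "y = (f ^^ i) x" using yQ Q_def by auto
      have fixk: "(f ^^ k) y = y" for k by (induction k) (use fy in auto)
      have "(f ^^ (p - i)) y = x"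
        using i per x by (metis comp_apply funpow_add le_add_diff_inverse2 less_imp_le_nat)
      then have "y = x" using fixk by simp
      then show False using fy x by simp
    qed
    define Y where "Y = X - Q"
    \<comment> \<open>The complement of the orbit is invariant because the orbit is closed under
      preimages: y = f^(p - 1) (f y).\<close>
    have fQ: "y \<in> Q" if h: "y \<in> X" "f y \<in> Q" for y
    proof -
      obtain i where i: "i < p" "f y = (f ^^ i) x" using h Q_def by auto
      have "y = (f ^^ (p - 1)) (f y)"
        using per[OF that(1)] p1 by (metis Suc_diff_1 comp_apply funpow_Suc_right gr_implies_not_zero neq0_conv)
      also have "\<dots> = (f ^^ (p - 1 + i)) x" by (simp only: i funpow_apply_add)
      finally have y: "y = (f ^^ (p - 1 + i)) x" .
      show ?thesis
      proof (cases "i = 0")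
        case True
        then show ?thesis unfolding Q_def using y p1 by (intro image_eqI[of _ _ "p - 1"]) auto
      next
        case False
        have "p - 1 + i = (i - 1) + p" using False p1 by simp
        then have "y = (f ^^ (i - 1)) x" using y per x by (simp add: funpow_add)
        then show ?thesis unfolding Q_def using i by (intro image_eqI[of _ _ "i - 1"]) auto
      qed
    qed
    have fY: "f ` Y \<subseteq> Y" unfolding Y_def using inv fQ by auto
    have "card Y < card X" unfolding Y_def
      using QX fin x p1 cQ by (intro psubset_card_mono) (auto simp: Q_def image_iff intro!: bexI[of _ 0])
    then have IH: "p dvd card {x \<in> Y. f x \<noteq> x}"
      using less.hyps[of Y] fY fin per unfolding Y_def by auto
    have "{x \<in> X. f x \<noteq> x} = Q \<union> {x \<in> Y. f x \<noteq> x}"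
      unfolding Y_def using QX Qmoved by auto
    moreover have "card (Q \<union> {x \<in> Y. f x \<noteq> x}) = card Q + card {x \<in> Y. f x \<noteq> x}"
      by (rule card_Un_disjoint) (use fin QX in \<open>auto simp: Y_def finite_subset\<close>)
    ultimately show ?thesis using IH cQ by (simp del: Collect_conj_eq)
  qed
qed

text \<open>The points outside the orbit of x are all moved and fewer than p in number; p divides
  their number, so there are none.\<close>

lemma prime_orbit_transitive:
  assumes "prime p" "finite X" "c ` X \<subseteq> X" "c ^^ p = id" "card X = p" "\<And>x. x \<in> X \<Longrightarrow> c x \<noteq> x" "x \<in> X" "y \<in> X"
  shows "\<exists>i. (c ^^ i) x = y"
proof -
  define Q where "Q = range (\<lambda>i. (c ^^ i) x)"
  let ?X = "X - Q"
  have "z \<in> Q" if cz: "c z \<in> Q" for z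
  proof -
    obtain i where i: "c z = (c ^^ i) x" using cz unfolding Q_def by blast
    have "z = (c ^^ p) z" using assms by simp
    also have "\<dots> = (c ^^ (p - 1)) (c z)"
      using prime_gt_0_nat[OF assms(1)] by (metis Suc_diff_1 comp_apply funpow_Suc_right)
    also have "\<dots> = (c ^^ (p - 1 + i)) x" by (simp only: i funpow_apply_add)
    finally show ?thesis unfolding Q_def by blast
  qed
  then have "p dvd card {z \<in> ?X. c z \<noteq> z}"
    using assms(1-4) by (intro prime_dvd_card_moved) auto
  moreover have "{z \<in> ?X. c z \<noteq> z} = ?X" using assms(6) by auto
  moreover have "x \<in> Q" unfolding Q_def by (metis funpow_0 rangeI)
  then have "card ?X < card X" using assms by (intro psubset_card_mono) auto
  ultimately have "card ?X = 0" using assms(5) by (metis nat_dvd_not_less neq0_conv)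
  then have "X \<subseteq> Q" using assms(2) by auto
  then show ?thesis using assms(8) Q_def by auto
qed

section \<open>Permutation groups on a finite set\<close>

locale perm_group =
  fixes G :: "('a \<Rightarrow> 'a) set" and \<Omega> :: "'a set"
  assumes fin: "finite \<Omega>"
    and perm: "g \<in> G \<Longrightarrow> g permutes \<Omega>"
    and one: "id \<in> G"
    and comp: "g \<in> G \<Longrightarrow> h \<in> G \<Longrightarrow> g \<circ> h \<in> G"
    and inv: "g \<in> G \<Longrightarrow> inv' g \<in> G"
begin

lemma finite_G: "finite G"
  by (rule finite_subset[OF _ finite_permutations[OF fin]]) (use perm in auto)

lemma inv_comp [simp]: "g \<in> G \<Longrightarrow> inv' g \<circ> g = id" "g \<in> G \<Longrightarrow> g \<circ> inv' g = id"
  by (simp_all add: permutes_inv_o[OF perm])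

lemma inv_apply: "g \<in> G \<Longrightarrow> inv' g (g x) = x" "g \<in> G \<Longrightarrow> g (inv' g x) = x"
  by (simp_all add: permutes_inverses[OF perm])

lemma inj: "g \<in> G \<Longrightarrow> inj g"
  using perm permutes_inj by blast

lemma inv_image [simp]: "g \<in> G \<Longrightarrow> inv' g ` g ` A = A" "g \<in> G \<Longrightarrow> g ` inv' g ` A = A"
  by (simp_all add: image_image inv_apply)

lemma closed: "g \<in> G \<Longrightarrow> g x \<in> \<Omega> \<longleftrightarrow> x \<in> \<Omega>"
  using perm permutes_in_image[of g \<Omega> x] by blast

lemma card_im: "g \<in> G \<Longrightarrow> card (g ` A) = card A"
  using inj by (meson card_image inj_on_subset subset_UNIV)

lemma im_subset: "g \<in> G \<Longrightarrow> A \<subseteq> \<Omega> \<Longrightarrow> g ` A \<subseteq> \<Omega>"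
  using closed by blast

lemma im_Omega: "g \<in> G \<Longrightarrow> g ` \<Omega> = \<Omega>"
  using perm permutes_image by blast

lemma pow: "g \<in> G \<Longrightarrow> g ^^ i \<in> G"
  by (induction i) (auto simp: one comp)

lemma supp_subset: "g \<in> G \<Longrightarrow> supp g \<subseteq> \<Omega>"
  unfolding supp_def using perm permutes_not_in by fastforce

lemma finite_supp: "g \<in> G \<Longrightarrow> finite (supp g)"
  by (rule finite_subset[OF supp_subset fin])

lemma mem_image: "g \<in> G \<Longrightarrow> x \<in> g ` A \<longleftrightarrow> inv' g x \<in> A"
  using inv_apply(2)[of g x] by (metis imageE imageI inv_apply(1))

lemma supp_conj:
  assumes "g \<in> G"
  shows "supp (g \<circ> h \<circ> inv' g) = g ` supp h"
proof -
  have "g (h (inv' g x)) = x \<longleftrightarrow> h (inv' g x) = inv' g x" for x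
    using inv_apply[OF assms] by metis
  then have "x \<in> supp (g \<circ> h \<circ> inv' g) \<longleftrightarrow> x \<in> g ` supp h" for x
    by (simp add: mem_image[OF assms] supp_def)
  then show ?thesis by blast
qed

text \<open>The fibres of g \<mapsto> \<open>act g x0\<close> are left cosets of the stabilizer. The
  action is a parameter because points, subsets, left cosets and partitions are all acted upon
  later.\<close>

lemma orbit_stabilizer:
  assumes act: "\<And>g h x. g \<in> G \<Longrightarrow> h \<in> G \<Longrightarrow> act (g \<circ> h) x = act g (act h x)" "act id x0 = x0"
  shows "card G = card ((\<lambda>g. act g x0) ` G) * card {g \<in> G. act g x0 = x0}"
proof -
  let ?X = "(\<lambda>g. act g x0) ` G" and ?S = "{g \<in> G. act g x0 = x0}"
  let ?F = "\<lambda>x. {g \<in> G. act g x0 = x}"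
  have "card (?F x) = card ?S" if xX: "x \<in> ?X" for x
  proof -
    obtain h where h: "h \<in> G" "act h x0 = x" using xX by auto
    have "bij_betw (\<lambda>g. h \<circ> g) ?S (?F x)"
    proof (rule bij_betw_byWitness[of _ "\<lambda>g. inv' h \<circ> g"])
      show "\<forall>g\<in>?S. inv' h \<circ> (h \<circ> g) = g" using h by (auto simp: o_assoc)
      show "\<forall>g\<in>?F x. h \<circ> (inv' h \<circ> g) = g" using h by (auto simp: o_assoc)
      show "(\<lambda>g. h \<circ> g) ` ?S \<subseteq> ?F x" using h act by (auto simp: comp)
      have "act (inv' h) x = x0" using act(1)[of "inv' h" h x0] act(2) h inv by auto
      then show "(\<lambda>g. inv' h \<circ> g) ` ?F x \<subseteq> ?S" using h act inv by (auto simp: comp)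
    qed
    then show ?thesis by (simp add: bij_betw_same_card)
  qed
  moreover have "card G = (\<Sum>x\<in>?X. card (?F x))"
  proof -
    have "G = (\<Union>x\<in>?X. ?F x)" by auto
    moreover have "card (\<Union>x\<in>?X. ?F x) = (\<Sum>x\<in>?X. card (?F x))"
      by (rule card_UN_disjoint) (use finite_G in auto)
    ultimately show ?thesis by simp
  qed
  ultimately show ?thesis by simp
qed

lemma homog_card_dvd:
  assumes "homog m G \<Omega>" "S \<subseteq> \<Omega>" "card S = m"
  shows "card G = (card \<Omega> choose m) * card {g \<in> G. g ` S = S}"
proof -
  have "(\<lambda>g. g ` S) ` G = {A. A \<subseteq> \<Omega> \<and> card A = m}"
  proof (intro subset_antisym subsetI)
    fix A assume "A \<in> (\<lambda>g. g ` S) ` G"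
    then show "A \<in> {A. A \<subseteq> \<Omega> \<and> card A = m}" using assms(2,3) by (auto simp: card_im closed)
  next
    fix A assume "A \<in> {A. A \<subseteq> \<Omega> \<and> card A = m}"
    then obtain g where "g \<in> G" "g ` S = A" using assms unfolding homog_def by blast
    then show "A \<in> (\<lambda>g. g ` S) ` G" by blast
  qed
  then have "card ((\<lambda>g. g ` S) ` G) = card \<Omega> choose m" using n_subsets[OF fin] by simp
  then show ?thesis using orbit_stabilizer[of "\<lambda>g A. g ` A" S] by (simp add: image_comp)
qed

text \<open>Sylow's theorem with exponent 1 gives a subgroup of order p, and any of its nonidentity
  elements will do. The algebraic group structure on \<open>G\<close> is built only for this
  purpose.\<close>

lemma Cauchy:
  assumes "prime p" "p dvd card G"
  shows "\<exists>g\<in>G. g \<noteq> id \<and> g ^^ p = id"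
proof -
  let ?M = "\<lparr>carrier = G, mult = (\<circ>), one = id\<rparr>"
  interpret M: group ?M
  proof (rule groupI)
    show "\<exists>y\<in>carrier ?M. y \<otimes>\<^bsub>?M\<^esub> x = \<one>\<^bsub>?M\<^esub>" if "x \<in> carrier ?M" for x
      using that by (intro bexI[of _ "inv' x"]) (simp_all add: inv)
  qed (simp_all add: comp one o_assoc)
  obtain m where m: "card G = p ^ 1 * m" using assms by (auto elim: dvdE)
  obtain H where H: "subgroup H ?M" "card H = p ^ 1"
    using sylow_thm[of p ?M 1 m] m assms finite_G M.group_axioms by (auto simp: order_def)
  have finH: "finite H" using H(2) prime_gt_0_nat[OF assms(1)] card_gt_0_iff[of H] by simp
  have "\<exists>g\<in>H. g \<noteq> id"
  proof (rule ccontr)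
    assume "\<not> ?thesis"
    then have "H \<subseteq> {id}" by auto
    then have "card H \<le> 1" using card_mono[of "{id}" H] by simp
    then show False using H(2) prime_gt_1_nat[OF assms(1)] by simp
  qed
  then obtain g where g: "g \<in> H" "g \<noteq> id" by blast
  have gG: "g \<in> G" using g subgroup.subset[OF H(1)] by auto
  interpret HG: group "?M\<lparr>carrier := H\<rparr>" using H M.subgroup_imp_group by blast
  have "g [^]\<^bsub>?M\<lparr>carrier := H\<rparr>\<^esub> card H = id"
    using HG.pow_order_eq_1[of g] g finH by (simp add: order_def)
  moreover have "g [^]\<^bsub>?M\<lparr>carrier := H\<rparr>\<^esub> n = g ^^ n" for n :: nat
    by (induction n) (auto simp: nat_pow_def funpow_Suc_right simp del: funpow.simps)
  ultimately show ?thesis using g gG H by auto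
qed

lemma prime_dvd_supp:
  assumes "prime p" "g \<in> G" "g ^^ p = id"
  shows "p dvd card (supp g)"
proof -
  have "p dvd card {x \<in> \<Omega>. g x \<noteq> x}"
    by (rule prime_dvd_card_moved) (use assms fin im_Omega in auto)
  moreover have "{x \<in> \<Omega>. g x \<noteq> x} = supp g" using supp_subset assms unfolding supp_def by auto
  ultimately show ?thesis by simp
qed

lemma prime_cycle_transitive:
  assumes "prime p" "c \<in> G" "c ^^ p = id" "card (supp c) = p" "x \<in> supp c" "y \<in> supp c"
  shows "\<exists>i. (c ^^ i) x = y"
proof (rule prime_orbit_transitive[OF assms(1) finite_supp[OF assms(2)] _ assms(3,4) _ assms(5,6)])
  show "c ` supp c \<subseteq> supp c" using inj[OF assms(2)] by (auto simp: supp_def inj_eq)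
qed (simp add: supp_def)

lemma point_stabilizer: "perm_group {g \<in> G. g a = a} (\<Omega> - {a})"
proof
  show "finite (\<Omega> - {a})" using fin by simp
  show "g permutes \<Omega> - {a}" if "g \<in> {g \<in> G. g a = a}" for g
    using that perm by (auto intro: permutes_superset)
  show "inv' g \<in> {g \<in> G. g a = a}" if "g \<in> {g \<in> G. g a = a}" for g
    using that inv inv_apply(1)[of g a] by auto
qed (use one comp in auto)

lemma fixes_point: "(\<And>g. g \<in> G \<Longrightarrow> g a = a) \<Longrightarrow> perm_group G (\<Omega> - {a})"
proof -
  assume "\<And>g. g \<in> G \<Longrightarrow> g a = a"
  then have "{g \<in> G. g a = a} = G" by auto
  then show ?thesis using point_stabilizer[of a] by simp
qed

lemma set_stabilizer: "perm_group {g \<in> G. g ` S = S} \<Omega>"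
proof
  show "inv' g \<in> {g \<in> G. g ` S = S}" if "g \<in> {g \<in> G. g ` S = S}" for g
    using that inv inv_image(1)[of g S] by auto
  show "g \<circ> h \<in> {g \<in> G. g ` S = S}" if "g \<in> {g \<in> G. g ` S = S}" "h \<in> {g \<in> G. g ` S = S}" for g h
    using that comp image_comp[of g h S] by auto
qed (use fin one perm in auto)

end

section \<open>Multiple transitivity from a long prime cycle\<close>

context perm_group begin

lemma conj_closed: "g \<in> G \<Longrightarrow> h \<in> G \<Longrightarrow> g \<circ> h \<circ> inv' g \<in> G"
  by (simp add: comp inv)

lemma conj_pow:
  assumes "g \<in> G"
  shows "(g \<circ> h \<circ> inv' g) ^^ n = g \<circ> h ^^ n \<circ> inv' g"
proof
  show "((g \<circ> h \<circ> inv' g) ^^ n) x = (g \<circ> h ^^ n \<circ> inv' g) x" for x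
    by (induction n) (simp_all add: inv_apply[OF assms])
qed

lemma conj_order: "g \<in> G \<Longrightarrow> h ^^ n = id \<Longrightarrow> (g \<circ> h \<circ> inv' g) ^^ n = id"
  by (simp add: conj_pow)

text \<open>Let D be the support of c. Every point b other than a lies in D or in a translate gD
  that avoids a. Since 2 p exceeds the degree, gD meets D, and a power of the conjugate cycle on gD
  fixes a and moves b into D. There c, which also fixes a, is transitive.\<close>

lemma transitive_point_stabilizer:
  assumes tr: "transitive G \<Omega>" and p: "prime p" and c: "c \<in> G" "c ^^ p = id" "card (supp c) = p"
    and small: "card \<Omega> < 2 * p" and a: "a \<in> \<Omega>" "a \<notin> supp c"
  shows "transitive {g \<in> G. g a = a} (\<Omega> - {a})"
proof -
  let ?D = "supp c"
  let ?K = "{g \<in> G. g a = a}"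
  interpret K: perm_group ?K "\<Omega> - {a}" by (rule point_stabilizer)
  have sep: "\<exists>g\<in>G. b \<in> g ` ?D \<and> a \<notin> g ` ?D" if b: "b \<in> \<Omega>" "b \<noteq> a" "b \<notin> ?D" for b
  proof (rule ccontr)
    assume no: "\<not> ?thesis"
    \<comment> \<open>If no translate of D separates b from a, then the translates through b are
      exactly those through a, as transitivity makes them equally many. The classes C of points
      lying in the same translates then form a system of blocks, and the class of a has at least two
      elements.\<close>
    define S where "S x = {g \<in> G. x \<in> g ` ?D}" for x
    define C where "C x = {y \<in> \<Omega>. S y = S x}" for x
    have finS: "finite (S x)" for x unfolding S_def using finite_G by auto
    have Sim: "S (h x) = (\<lambda>g. h \<circ> g) ` S x" if h: "h \<in> G" for h x
    proof (intro subset_antisym subsetI)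
      fix g assume "g \<in> S (h x)"
      then have g: "g \<in> G" "h x \<in> g ` ?D" by (auto simp: S_def)
      then obtain y where y: "y \<in> ?D" "h x = g y" by auto
      then have "x = (inv' h \<circ> g) y" using h by (metis comp_apply inv_apply(1))
      then have "inv' h \<circ> g \<in> S x" using y g h by (auto simp: S_def comp inv)
      moreover have "g = h \<circ> (inv' h \<circ> g)" using h by (simp add: o_assoc)
      ultimately show "g \<in> (\<lambda>g. h \<circ> g) ` S x" by blast
    next
      fix g assume "g \<in> (\<lambda>g. h \<circ> g) ` S x"
      then show "g \<in> S (h x)" using h by (auto simp: S_def comp)
    qed
    have injh: "inj_on (\<lambda>g. h \<circ> g) A" if "h \<in> G" for h A
    proof (rule inj_onI)
      fix g k assume "h \<circ> g = h \<circ> k"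
      then have "inv' h \<circ> (h \<circ> g) = inv' h \<circ> (h \<circ> k)" by simp
      then show "g = k" using inv_comp(1)[OF that] by (simp add: o_assoc)
    qed
    have "S b \<subseteq> S a" unfolding S_def using no by blast
    moreover from tr a b obtain h where h: "h \<in> G" "h b = a" unfolding transitive_def by blast
    then have "card (S a) = card (S b)" using Sim[OF h(1), of b] h card_image[OF injh[OF h(1)]] by simp
    ultimately have Sab: "S b = S a" using finS by (simp add: card_subset_eq)
    have CD: "C x \<subseteq> ?D" if "x \<in> ?D" for x
    proof
      fix y assume "y \<in> C x"
      moreover have "id \<in> S x" using that one by (simp add: S_def)
      ultimately have "id \<in> S y" by (simp add: C_def)
      then show "y \<in> ?D" by (simp add: S_def)
    qed
    have Cim: "C (h x) = h ` C x" if h: "h \<in> G" for h x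
    proof (intro subset_antisym subsetI)
      fix y assume "y \<in> C (h x)"
      then have y: "y \<in> \<Omega>" "S y = S (h x)" by (auto simp: C_def)
      have "S (inv' h y) = (\<lambda>g. inv' h \<circ> g) ` S y" by (rule Sim[OF inv[OF h]])
      also have "\<dots> = S (inv' h (h x))" unfolding y(2) by (rule Sim[OF inv[OF h], symmetric])
      finally have "S (inv' h y) = S x" by (simp only: inv_apply[OF h])
      then have "inv' h y \<in> C x" using y h closed[OF inv[OF h]] by (simp add: C_def)
      then show "y \<in> h ` C x" using h by (simp add: mem_image)
    next
      fix y assume "y \<in> h ` C x"
      then show "y \<in> C (h x)" using Sim[OF h] closed[OF h] by (auto simp: C_def)
    qed
    have cC: "card (C x) = card (C a)" if x: "x \<in> \<Omega>" for x
    proof -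
      obtain h where h: "h \<in> G" "h a = x" using tr a x unfolding transitive_def by blast
      then show ?thesis using Cim[OF h(1), of a] card_im by simp
    qed
    \<comment> \<open>D is a disjoint union of classes of equal size, so that size divides p and
      must be p. The class of a is disjoint from D, which would need 2 p points.\<close>
    have "card (C a) dvd card (\<Union> (C ` ?D))"
    proof (rule dvd_partition)
      show "finite (\<Union> (C ` ?D))" using fin by (auto simp: C_def intro: finite_subset)
      show "\<forall>c\<in>C ` ?D. card (C a) dvd card c" using cC supp_subset[OF c(1)] by auto
      show "\<forall>c1\<in>C ` ?D. \<forall>c2\<in>C ` ?D. c1 \<noteq> c2 \<longrightarrow> c1 \<inter> c2 = {}" by (auto simp: C_def)
    qed
    moreover have "\<Union> (C ` ?D) = ?D" using CD supp_subset[OF c(1)] by (auto simp: C_def)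
    ultimately have "card (C a) dvd p" using c by simp
    moreover have "{a, b} \<subseteq> C a" using a b Sab by (auto simp: C_def)
    then have "card {a, b} \<le> card (C a)" using fin by (intro card_mono) (auto simp: C_def)
    then have "card (C a) \<noteq> 1" using b by simp
    ultimately have ca: "card (C a) = p" using p by (auto simp: prime_nat_iff)
    have "C a \<inter> ?D = {}"
    proof (rule ccontr)
      assume "C a \<inter> ?D \<noteq> {}"
      then obtain y where y: "y \<in> C a" "y \<in> ?D" by blast
      then have "a \<in> C y" using a by (simp add: C_def)
      then show False using CD y a by blast
    qed
    moreover have "finite (C a)" using fin by (simp add: C_def)
    ultimately have "card (C a \<union> ?D) = card (C a) + card ?D"
      by (intro card_Un_disjoint finite_supp[OF c(1)])
    then have "card (C a \<union> ?D) = 2 * p" unfolding ca c(3) by linarith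
    moreover have "C a \<union> ?D \<subseteq> \<Omega>" using supp_subset[OF c(1)] unfolding C_def by blast
    ultimately show False using card_mono[OF fin, of "C a \<union> ?D"] small by simp
  qed
  have cK: "c \<in> ?K" using c a by (auto simp: supp_def)
  have reach: "\<exists>h\<in>?K. h b \<in> ?D" if b: "b \<in> \<Omega> - {a}" for b
  proof (cases "b \<in> ?D")
    case True
    then show ?thesis using K.one by force
  next
    case False
    then obtain g where g: "g \<in> G" "b \<in> g ` ?D" "a \<notin> g ` ?D" using sep b by blast
    \<comment> \<open>The conjugate cycle on gD fixes a and can carry b to a common point of gD and
      D.\<close>
    let ?c = "g \<circ> c \<circ> inv' g"
    have s: "supp ?c = g ` ?D" by (rule supp_conj[OF g(1)])
    have cG: "?c \<in> G" using g c conj_closed by blast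
    have "g ` ?D \<inter> ?D \<noteq> {}"
    proof
      assume "g ` ?D \<inter> ?D = {}"
      then have "card (g ` ?D \<union> ?D) = card (g ` ?D) + card ?D"
        by (intro card_Un_disjoint finite_imageI finite_supp[OF c(1)])
      then have "card (g ` ?D \<union> ?D) = 2 * p" unfolding card_im[OF g(1)] c(3) by linarith
      moreover have "g ` ?D \<union> ?D \<subseteq> \<Omega>" using supp_subset[OF c(1)] supp_subset[OF cG] s by simp
      ultimately show False using card_mono[OF fin, of "g ` ?D \<union> ?D"] small by simp
    qed
    then obtain d where d: "d \<in> g ` ?D" "d \<in> ?D" by blast
    have "card (supp ?c) = p" using s c g card_im by simp
    then obtain i where i: "(?c ^^ i) b = d"
      using prime_cycle_transitive[OF p cG conj_order[OF g(1) c(2)], of b d] s d g by auto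
    have "?c a = a" using g s by (auto simp: supp_def)
    then have "(?c ^^ i) a = a" by (induction i) auto
    then have "?c ^^ i \<in> ?K" using pow[OF cG] by simp
    then show ?thesis using i d by blast
  qed
  show ?thesis unfolding transitive_def
  proof (intro ballI)
    fix x y assume xy: "x \<in> \<Omega> - {a}" "y \<in> \<Omega> - {a}"
    obtain h where h: "h \<in> ?K" "h x \<in> ?D" using reach xy by blast
    obtain k where k: "k \<in> ?K" "k y \<in> ?D" using reach xy by blast
    obtain i where i: "(c ^^ i) (h x) = k y" using prime_cycle_transitive[OF p c h(2) k(2)] by blast
    have "(inv' k \<circ> (c ^^ i) \<circ> h) x = y" using i K.inv_apply(1)[OF k(1)] by simp
    moreover have "inv' k \<circ> (c ^^ i) \<circ> h \<in> ?K" by (intro K.comp K.inv K.pow cK h k)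
    ultimately show "\<exists>g\<in>?K. g x = y" by blast
  qed
qed

text \<open>Transitivity moves both first entries to a; what remains is to match the tails inside
  the stabilizer of a.\<close>

lemma multitrans_extend:
  assumes tr: "transitive G \<Omega>" and a: "a \<in> \<Omega>" and mt: "multitrans t {g \<in> G. g a = a} (\<Omega> - {a})"
  shows "multitrans (Suc t) G \<Omega>"
  unfolding multitrans_def
proof (intro allI impI)
  fix xs ys :: "'a list"
  assume d: "distinct xs" "distinct ys" and l: "length xs = Suc t" "length ys = Suc t"
    and s: "set xs \<subseteq> \<Omega>" "set ys \<subseteq> \<Omega>"
  obtain x xs' where xs: "xs = x # xs'" using l by (cases xs) auto
  obtain y ys' where ys: "ys = y # ys'" using l by (cases ys) auto
  have "x \<in> \<Omega>" "y \<in> \<Omega>" using s xs ys by auto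
  then obtain g h where g: "g \<in> G" "g x = a" and h: "h \<in> G" "h y = a"
    using tr a unfolding transitive_def by blast
  have lift: "distinct (map f zs) \<and> set (map f zs) \<subseteq> \<Omega> - {a}"
    if f: "f \<in> G" "f z = a" and z: "distinct (z # zs)" "set (z # zs) \<subseteq> \<Omega>" for f z zs
  proof -
    have "f w \<noteq> a" if "w \<in> set zs" for w
      using inj_eq[OF inj[OF f(1)], of w z] f z that by auto
    moreover have "f w \<in> \<Omega>" if "w \<in> set zs" for w using z that closed[OF f(1)] by auto
    moreover have "inj_on f (set zs)" by (rule inj_on_subset[OF inj[OF f(1)] subset_UNIV])
    ultimately show ?thesis using z by (auto simp: distinct_map)
  qed
  have "distinct (map g xs')" "set (map g xs') \<subseteq> \<Omega> - {a}"
    using lift[OF g] d s xs by blast+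
  moreover have "distinct (map h ys')" "set (map h ys') \<subseteq> \<Omega> - {a}"
    using lift[OF h] d s ys by blast+
  moreover have "length (map g xs') = t" "length (map h ys') = t" using l xs ys by simp_all
  ultimately have "\<exists>k\<in>{g \<in> G. g a = a}. map k (map g xs') = map h ys'"
    using mt unfolding multitrans_def by blast
  then obtain k where k: "k \<in> G" "k a = a" "map k (map g xs') = map h ys'" by blast
  have "map (inv' h \<circ> k \<circ> g) xs' = map (inv' h) (map k (map g xs'))" by simp
  also have "\<dots> = ys'" using k(3) h by (simp add: map_idI)
  finally have "map (inv' h \<circ> k \<circ> g) xs = ys"
    using xs ys g k h inv_apply(1)[OF h(1), of y] by simp
  then show "\<exists>g\<in>G. map g xs = ys" using g h k by (intro bexI[of _ "inv' h \<circ> k \<circ> g"]) (auto intro: comp inv)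
qed

lemma multitrans_one: "transitive G \<Omega> \<longleftrightarrow> multitrans 1 G \<Omega>"
proof
  assume t: "transitive G \<Omega>"
  show "multitrans 1 G \<Omega>" unfolding multitrans_def
  proof (intro allI impI)
    fix xs ys :: "'a list"
    assume "length xs = 1" "length ys = 1" "set xs \<subseteq> \<Omega>" "set ys \<subseteq> \<Omega>"
    then obtain x y where "xs = [x]" "ys = [y]" "x \<in> \<Omega>" "y \<in> \<Omega>"
      by (auto simp: length_Suc_conv)
    then show "\<exists>g\<in>G. map g xs = ys" using t unfolding transitive_def by auto
  qed
next
  assume t: "multitrans 1 G \<Omega>"
  show "transitive G \<Omega>" unfolding transitive_def
  proof (intro ballI)
    fix x y assume "x \<in> \<Omega>" "y \<in> \<Omega>"
    then have "\<exists>g\<in>G. map g [x] = [y]"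
      using t[unfolded multitrans_def, rule_format, of "[x]" "[y]"] by simp
    then show "\<exists>g\<in>G. g x = y" by auto
  qed
qed

text \<open>Both lists are prolonged to length t by further points, for which t \<le>
  \<open>card \<Omega>\<close> leaves room.\<close>

lemma multitrans_mono:
  assumes "multitrans t G \<Omega>" "s \<le> t" "t \<le> card \<Omega>"
  shows "multitrans s G \<Omega>"
  unfolding multitrans_def
proof (intro allI impI)
  fix xs ys :: "'a list"
  assume d: "distinct xs" "distinct ys" and l: "length xs = s" "length ys = s"
    and s: "set xs \<subseteq> \<Omega>" "set ys \<subseteq> \<Omega>"
  have ext: "\<exists>us. distinct (zs @ us) \<and> length us = t - s \<and> set us \<subseteq> \<Omega>"
    if zs: "distinct zs" "length zs = s" "set zs \<subseteq> \<Omega>" for zs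
  proof -
    have "finite (\<Omega> - set zs)" using fin by simp
    then obtain us where us: "set us = \<Omega> - set zs" "distinct us" using finite_distinct_list by blast
    have "length us = card \<Omega> - s"
      using us zs distinct_card[of us] distinct_card[of zs] card_Diff_subset[of "set zs" \<Omega>] by simp
    then show ?thesis using us zs assms set_take_subset[of "t - s" us]
      by (intro exI[of _ "take (t - s) us"]) auto
  qed
  obtain us where us: "distinct (xs @ us)" "length us = t - s" "set us \<subseteq> \<Omega>" using ext d l s by blast
  obtain vs where vs: "distinct (ys @ vs)" "length vs = t - s" "set vs \<subseteq> \<Omega>" using ext d l s by blast
  have "length (xs @ us) = t" "length (ys @ vs) = t" "set (xs @ us) \<subseteq> \<Omega>" "set (ys @ vs) \<subseteq> \<Omega>"
    using us vs l s assms by auto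
  then obtain g where "g \<in> G" "map g (xs @ us) = ys @ vs"
    using assms(1) us(1) vs(1) unfolding multitrans_def by blast
  then show "\<exists>g\<in>G. map g xs = ys" using l by auto
qed

lemma multitrans_homog:
  assumes "multitrans t G \<Omega>"
  shows "homog t G \<Omega>"
  unfolding homog_def
proof (intro allI impI)
  fix A B assume AB: "A \<subseteq> \<Omega>" "B \<subseteq> \<Omega>" "card A = t" "card B = t"
  then have f: "finite A" "finite B" using fin finite_subset by auto
  obtain xs where xs: "set xs = A" "distinct xs" using finite_distinct_list[OF f(1)] by blast
  obtain ys where ys: "set ys = B" "distinct ys" using finite_distinct_list[OF f(2)] by blast
  have "length xs = t" "length ys = t" using xs ys AB distinct_card by metis+
  then obtain g where g: "g \<in> G" "map g xs = ys" using assms xs ys AB unfolding multitrans_def by blast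
  then have "g ` A = B" using xs ys by (metis list.set_map)
  then show "\<exists>g\<in>G. g ` A = B" using g by blast
qed

lemma homog_compl:
  assumes h: "homog m G \<Omega>" "m \<le> card \<Omega>"
  shows "homog (card \<Omega> - m) G \<Omega>"
  unfolding homog_def
proof (intro allI impI)
  fix A B assume AB: "A \<subseteq> \<Omega>" "B \<subseteq> \<Omega>" "card A = card \<Omega> - m" "card B = card \<Omega> - m"
  have "card (\<Omega> - A) = m" "card (\<Omega> - B) = m"
    using AB h fin by (auto simp: card_Diff_subset finite_subset)
  then obtain g where g: "g \<in> G" "g ` (\<Omega> - A) = \<Omega> - B" using h unfolding homog_def by blast
  have "g ` (\<Omega> - A) = g ` \<Omega> - g ` A" using inj[OF g(1)] by (simp add: image_set_diff)
  then have "\<Omega> - g ` A = \<Omega> - B" using g im_Omega by simp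
  then have "g ` A = B" using AB im_subset[OF g(1)] by blast
  then show "\<exists>g\<in>G. g ` A = B" using g by blast
qed

end

text \<open>Jordan's theorem, by induction on the number r of points fixed by c. Passing to the
  stabilizer of one of them keeps c, and the bound 2 p only becomes easier to satisfy.\<close>

lemma Jordan_multitrans:
  assumes "perm_group G \<Omega>" "transitive G \<Omega>" "prime p" "c \<in> G" "c ^^ p = id" "card (supp c) = p"
    and "card \<Omega> < 2 * p" "card \<Omega> = p + r"
  shows "multitrans (Suc r) G \<Omega>"
  using assms
proof (induction r arbitrary: G \<Omega>)
  case 0
  then show ?case using perm_group.multitrans_one[OF 0(1)] by simp
next
  case (Suc r)
  interpret perm_group G \<Omega> by (rule Suc.prems(1))
  have "\<not> \<Omega> \<subseteq> supp c"
    using Suc.prems card_mono[OF finite_supp[OF Suc.prems(4)], of \<Omega>] by auto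
  then obtain a where a: "a \<in> \<Omega>" "a \<notin> supp c" by blast
  have "multitrans (Suc r) {g \<in> G. g a = a} (\<Omega> - {a})"
  proof (rule Suc.IH)
    show "transitive {g \<in> G. g a = a} (\<Omega> - {a})"
      by (rule transitive_point_stabilizer[OF Suc.prems(2-7) a])
    show "c \<in> {g \<in> G. g a = a}" using a Suc.prems by (auto simp: supp_def)
    show "card (\<Omega> - {a}) < 2 * p" "card (\<Omega> - {a}) = p + r" using a Suc.prems fin by auto
  qed (use Suc.prems point_stabilizer in simp_all)
  then show ?case by (rule multitrans_extend[OF Suc.prems(2) a(1)])
qed

lemma card_3_cycle:
  assumes "inj t" "card (supp t) = 3"
  obtains x y z where "x \<noteq> y" "y \<noteq> z" "x \<noteq> z" "supp t = {x, y, z}" "t x = y" "t y = z" "t z = x"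
proof -
  have st: "t w \<in> supp t" if "w \<in> supp t" for w
    using that assms(1) unfolding supp_def by (simp add: inj_eq)
  have mv: "t w \<noteq> w" if "w \<in> supp t" for w using that by (simp add: supp_def)
  have "supp t \<noteq> {}" using assms(2) by auto
  then obtain x where x: "x \<in> supp t" by blast
  define y where "y = t x"
  have y: "y \<in> supp t" "y \<noteq> x" unfolding y_def using st[OF x] mv[OF x] by auto
  have fS: "finite (supp t)" using assms(2) card.infinite by fastforce
  have "card (supp t - {x, y}) = 1" using assms(2) x y fS by (simp add: card_Diff_subset)
  then obtain z where z: "supp t - {x, y} = {z}" by (auto simp: card_1_singleton_iff)
  then have zin: "z \<in> supp t" "z \<noteq> x" "z \<noteq> y" and S: "supp t = {x, y, z}" using x y by auto
  have "t z \<noteq> y" using zin assms(1) unfolding y_def by (simp add: inj_eq)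
  then have tz: "t z = x" using st[OF zin(1)] mv[OF zin(1)] S by auto
  have "t y \<noteq> x" using zin y tz assms(1) by (metis inj_eq)
  then have "t y = z" using st[OF y(1)] mv[OF y(1)] S by auto
  then show ?thesis
    using that[OF not_sym[OF y(2)] not_sym[OF zin(3)] not_sym[OF zin(2)] S y_def[symmetric] _ tz] by blast
qed

section \<open>3-cycles and the alternating group\<close>

context perm_group begin

definition has_3_cycles :: bool where
  "has_3_cycles \<longleftrightarrow> (\<forall>a b c. a \<in> \<Omega> \<longrightarrow> b \<in> \<Omega> \<longrightarrow> c \<in> \<Omega> \<longrightarrow> a \<noteq> b \<longrightarrow> b \<noteq> c \<longrightarrow> a \<noteq> c \<longrightarrow>
     (\<exists>g\<in>G. g a = b \<and> g b = c \<and> g c = a \<and> supp g = {a, b, c}))"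

lemma multitrans_has_3_cycles:
  assumes mt: "multitrans 3 G \<Omega>" and t: "t \<in> G" "card (supp t) = 3"
  shows has_3_cycles
  unfolding has_3_cycles_def
proof (intro allI impI)
  fix a b c assume abc: "a \<in> \<Omega>" "b \<in> \<Omega>" "c \<in> \<Omega>" "a \<noteq> b" "b \<noteq> c" "a \<noteq> c"
  obtain x y z where xyz: "x \<noteq> y" "y \<noteq> z" "x \<noteq> z" "supp t = {x, y, z}" "t x = y" "t y = z" "t z = x"
    using card_3_cycle[OF inj[OF t(1)] t(2)] by blast
  have "{x, y, z} \<subseteq> \<Omega>" using supp_subset[OF t(1)] xyz(4) by simp
  then obtain g where g: "g \<in> G" "map g [x, y, z] = [a, b, c]"
    using mt[unfolded multitrans_def, rule_format, of "[x, y, z]" "[a, b, c]"] abc xyz by auto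
  have i: "inv' g a = x" "inv' g b = y" "inv' g c = z" using g inv_apply(1)[OF g(1)] by auto
  have "supp (g \<circ> t \<circ> inv' g) = {a, b, c}" using supp_conj[OF g(1), of t] xyz(4) g(2) by simp
  then show "\<exists>g\<in>G. g a = b \<and> g b = c \<and> g c = a \<and> supp g = {a, b, c}"
    using i xyz g by (intro bexI[of _ "g \<circ> t \<circ> inv' g"] conj_closed t) auto
qed

text \<open>Multiplying an even permutation by a suitable 3-cycle shrinks its support; the induction
  ends at the identity.\<close>

lemma evenperm_in_G:
  assumes h3: has_3_cycles and "p permutes \<Omega>" "evenperm p"
  shows "p \<in> G"
  using assms(2,3)
proof (induction "card (supp p)" arbitrary: p rule: less_induct)
  case less
  note pp = less.prems(1)
  have sp: "supp p \<subseteq> \<Omega>" unfolding supp_def using permutes_not_in[OF pp] by auto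
  have fsp: "finite (supp p)" using sp fin finite_subset by blast
  show ?case
  proof (cases "supp p = {}")
    case True
    then have "p = id" by (auto simp: supp_def)
    then show ?thesis using one by simp
  next
    case False
    then obtain x where x: "x \<in> supp p" by blast
    define y where "y = p x"
    have xy: "y \<noteq> x" using x by (simp add: supp_def y_def)
    have ysp: "y \<in> supp p" using xy permutes_inj[OF pp] by (simp add: supp_def y_def inj_eq)
    \<comment> \<open>Otherwise p would be a transposition, which is odd, so a third moved point z
      exists.\<close>
    have "\<not> supp p \<subseteq> {x, y}"
    proof
      assume s: "supp p \<subseteq> {x, y}"
      have "p permutes {x, y}"
        using s by (intro permutes_superset[OF pp]) (auto simp: supp_def)
      then have "p = transpose x y" using xy x by (auto simp: permutes_doubleton_iff supp_def)
      then show False using less.prems(2) xy by (simp add: evenperm_swap)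
    qed
    then obtain z where z: "z \<in> supp p" "z \<noteq> x" "z \<noteq> y" by blast
    \<comment> \<open>This 3-cycle sends y = p x back to x, and its support lies within that of p.
      So g \<circ> p fixes x and moves no new point.\<close>
    obtain g where g: "g \<in> G" "g y = x" "g x = z" "g z = y" "supp g = {y, x, z}"
      using h3[unfolded has_3_cycles_def, rule_format, of y x z] sp x ysp z xy by auto
    have fixg: "g w = w" if "w \<noteq> x" "w \<noteq> y" "w \<noteq> z" for w
      using g(5) that unfolding supp_def by blast
    have geq: "g = transpose x y \<circ> transpose x z"
    proof
      fix w
      show "g w = (transpose x y \<circ> transpose x z) w"
        using g fixg xy z by (cases "w = x"; cases "w = y"; cases "w = z") (auto simp: transpose_def)
    qed
    have "evenperm g" unfolding geq using xy z
      by (subst evenperm_comp) (auto simp: permutation_swap_id evenperm_swap)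
    moreover have "permutation g" "permutation p"
      using perm[OF g(1)] pp fin by (auto intro: permutes_imp_permutation)
    ultimately have ev: "evenperm (g \<circ> p)" using less.prems(2) by (simp add: evenperm_comp)
    have gp: "g \<circ> p permutes \<Omega>" using permutes_compose[OF pp perm[OF g(1)]] .
    have "supp (g \<circ> p) \<subseteq> supp p - {x}"
    proof
      fix w assume w: "w \<in> supp (g \<circ> p)"
      have "w \<noteq> x" using w g(2) by (auto simp: supp_def y_def)
      moreover have "w \<in> supp p"
      proof (rule ccontr)
        assume n: "w \<notin> supp p"
        then have "w \<noteq> x" "w \<noteq> y" "w \<noteq> z" using x ysp z by auto
        then have "g w = w" by (rule fixg)
        then show False using w n by (auto simp: supp_def)
      qed
      ultimately show "w \<in> supp p - {x}" by simp
    qed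
    then have "supp (g \<circ> p) \<subset> supp p" using x by blast
    then have "g \<circ> p \<in> G" using less.hyps[OF psubset_card_mono[OF fsp] gp ev] by blast
    then have "inv' g \<circ> (g \<circ> p) \<in> G" using comp inv g by blast
    then show ?thesis using inv_comp(1)[OF g(1)] by (simp add: o_assoc)
  qed
qed

lemma alt_or_sym:
  assumes h3: has_3_cycles
  shows "G = {p. p permutes \<Omega>} \<or> G = {p. p permutes \<Omega> \<and> evenperm p}"
proof (cases "\<forall>g\<in>G. evenperm g")
  case True
  then have "G = {p. p permutes \<Omega> \<and> evenperm p}" using perm evenperm_in_G[OF h3] by auto
  then show ?thesis ..
next
  case False
  then obtain g where g: "g \<in> G" "\<not> evenperm g" by blast
  have "p \<in> G" if p: "p permutes \<Omega>" for p
  proof (cases "evenperm p")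
    case True
    then show ?thesis using evenperm_in_G[OF h3 p] by blast
  next
    case False
    have "permutation g" "permutation p"
      using perm[OF g(1)] p fin by (auto intro: permutes_imp_permutation)
    then have "evenperm (g \<circ> p)" using g False by (simp add: evenperm_comp)
    then have "g \<circ> p \<in> G" using evenperm_in_G[OF h3 permutes_compose[OF p perm[OF g(1)]]] by blast
    then have "inv' g \<circ> (g \<circ> p) \<in> G" using comp inv g by blast
    then show ?thesis using inv_comp(1)[OF g(1)] by (simp add: o_assoc)
  qed
  then have "G = {p. p permutes \<Omega>}" using perm by auto
  then show ?thesis ..
qed

text \<open>The commutator maps x to a x, a x to b x and b x to x. Any other point of one support is
  not carried to x, the only common point, by the inverse of that factor, so the two actions cancel
  on it.\<close>

lemma commutator_3_cycle:
  assumes a: "a \<in> G" and b: "b \<in> G" and x: "supp a \<inter> supp b = {x}"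
  shows "card (supp (a \<circ> b \<circ> inv' a \<circ> inv' b)) = 3"
proof -
  let ?t = "a \<circ> b \<circ> inv' a \<circ> inv' b"
  note ia = inv_apply[OF a] and ib = inv_apply[OF b]
  have fixa: "a w = w" "inv' a w = w" if "w \<notin> supp a" for w
    using that ia[of w] by (auto simp: supp_def)
  have fixb: "b w = w" "inv' b w = w" if "w \<notin> supp b" for w
    using that ib[of w] by (auto simp: supp_def)
  have sa: "a w \<in> supp a" "inv' a w \<in> supp a" if "w \<in> supp a" for w
    using that ia inj_eq[OF inj[OF a]] unfolding supp_def by (auto, metis)
  have sb: "b w \<in> supp b" "inv' b w \<in> supp b" if "w \<in> supp b" for w
    using that ib inj_eq[OF inj[OF b]] unfolding supp_def by (auto, metis)
  have xa: "x \<in> supp a" and xb: "x \<in> supp b" using x by auto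
  have ax: "a x \<noteq> x" and bx: "b x \<noteq> x" using xa xb by (auto simp: supp_def)
  have iax: "inv' a x \<noteq> x" and ibx: "inv' b x \<noteq> x" using ax bx ia ib by metis+
  have axb: "a x \<notin> supp b" using sa(1)[OF xa] ax x by blast
  have bxa: "b x \<notin> supp a" using sb(1)[OF xb] bx x by blast
  have iaxb: "inv' a x \<notin> supp b" using sa(2)[OF xa] iax x by blast
  have ibxa: "inv' b x \<notin> supp a" using sb(2)[OF xb] ibx x by blast
  have t1: "?t x = a x" using fixa(2)[OF ibxa] ib by simp
  have t2: "?t (a x) = b x" using fixb(2)[OF axb] ia fixa(1)[OF bxa] by simp
  have t3: "?t (b x) = x" using ia ib fixb(1)[OF iaxb] by simp
  have t4: "?t w = w" if w: "w \<noteq> x" "w \<noteq> a x" "w \<noteq> b x" for w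
  proof (cases "w \<in> supp b")
    case True
    have "inv' b w \<noteq> x" using w ib by metis
    then have "inv' b w \<notin> supp a" using sb(2)[OF True] x by blast
    moreover have "w \<notin> supp a" using True w x by blast
    ultimately show ?thesis using fixa ib by simp
  next
    case nb: False
    show ?thesis
    proof (cases "w \<in> supp a")
      case True
      have "inv' a w \<noteq> x" using w ia by metis
      then have "inv' a w \<notin> supp b" using sa(2)[OF True] x by blast
      then show ?thesis using fixb nb ia by simp
    next
      case False
      then show ?thesis using fixa fixb nb by simp
    qed
  qed
  have ab: "a x \<noteq> b x" using sb(1)[OF xb] axb by auto
  have "supp ?t = {x, a x, b x}"
  proof (rule subset_antisym)
    show "supp ?t \<subseteq> {x, a x, b x}" using t4 unfolding supp_def by blast
    show "{x, a x, b x} \<subseteq> supp ?t" using t1 t2 t3 ax bx ab unfolding supp_def by auto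
  qed
  then show ?thesis using ax bx ab by auto
qed

text \<open>For 2 m - 1 \<le> \<open>card \<Omega>\<close> some m-set meets the support of g in a
  single point. Homogeneity makes it the support of a conjugate of g, and the commutator of g with
  that conjugate is a 3-cycle.\<close>

lemma small_support_3_cycle:
  assumes h: "homog m G \<Omega>" and g: "g \<in> G" "card (supp g) = m" and m: "m \<ge> 1" "2 * m \<le> card \<Omega> + 1"
  shows "\<exists>t\<in>G. card (supp t) = 3"
proof -
  have sg: "supp g \<subseteq> \<Omega>" "finite (supp g)" using supp_subset finite_supp g by blast+
  have "supp g \<noteq> {}" using g m by auto
  then obtain x where x: "x \<in> supp g" by blast
  have "card (\<Omega> - supp g) = card \<Omega> - m" using sg g by (simp add: card_Diff_subset)
  then have "m - 1 \<le> card (\<Omega> - supp g)" using m by simp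
  then obtain B where B: "B \<subseteq> \<Omega> - supp g" "card B = m - 1" "finite B"
    by (rule obtain_subset_with_card_n)
  have xB: "x \<notin> B" using B x by auto
  then have "card (insert x B) = m" using B m by simp
  moreover have "insert x B \<subseteq> \<Omega>" using B x sg by auto
  ultimately obtain h where h: "h \<in> G" "h ` supp g = insert x B" using h sg g unfolding homog_def by blast
  let ?b = "h \<circ> g \<circ> inv' h"
  have "supp ?b = insert x B" using supp_conj[OF h(1)] h by simp
  then have "supp g \<inter> supp ?b = {x}" using B x by auto
  then have "card (supp (g \<circ> ?b \<circ> inv' g \<circ> inv' ?b)) = 3"
    using commutator_3_cycle g(1) conj_closed[OF h(1) g(1)] by blast
  moreover have "g \<circ> ?b \<circ> inv' g \<circ> inv' ?b \<in> G"
    using g(1) conj_closed[OF h(1) g(1)] comp inv by blast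
  ultimately show ?thesis by blast
qed

end

lemma supp_empty_iff: "supp f = {} \<longleftrightarrow> f = id"
  by (auto simp: supp_def fun_eq_iff)

section \<open>Homogeneity on smaller sets, and 3-cycles from long prime cycles\<close>

context perm_group begin

text \<open>Counting pairs (U, x) with x \<in> U of size t + 1 meeting a fixed t-set in j points gives a two-term
  recursion for the partial sums of f, which forces all of them to vanish.\<close>

lemma zero_if_all_shadow_sums_zero:
  fixes f :: "'a set \<Rightarrow> int"
  assumes T0: "T0 \<subseteq> \<Omega>" "card T0 = t" and size: "2 * t < card \<Omega>"
    and f: "\<And>U. U \<subseteq> \<Omega> \<Longrightarrow> card U = Suc t \<Longrightarrow> (\<Sum>x\<in>U. f (U - {x})) = 0"
  shows "f T0 = 0"
proof -
  define \<T> where "\<T> j = {T. T \<subseteq> \<Omega> \<and> card T = t \<and> card (T \<inter> T0) = j}" for j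
  define \<U> where "\<U> j = {U. U \<subseteq> \<Omega> \<and> card U = Suc t \<and> card (U \<inter> T0) = j}" for j
  define s where "s j = (\<Sum>T\<in>\<T> j. f T)" for j
  have fT0: "finite T0" using T0 fin finite_subset by blast
  have finU: "finite (\<U> j)" and finT: "finite (\<T> j)" for j
    using fin unfolding \<U>_def \<T>_def by auto
  have fs: "finite T" if "T \<subseteq> \<Omega>" for T using that fin finite_subset by blast
  \<comment> \<open>Deleting x from U leaves a t-set that meets T0 in j points if x lies outside T0
    and in j - 1 points if it lies inside. Conversely a t-set T is completed by a point outside T
    \<union> T0 or by one of T0 - T.\<close>
  have split: "(\<Sum>U\<in>\<U> j. \<Sum>x\<in>U. f (U - {x})) =
      (\<Sum>T\<in>\<T> j. f T * int (card (\<Omega> - T - T0))) +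
      (if j = 0 then 0 else \<Sum>T\<in>\<T> (j - 1). f T * int (card (T0 - T)))" for j
  proof -
    let ?A = "Sigma (\<T> j) (\<lambda>T. \<Omega> - T - T0)"
    let ?B = "if j = 0 then {} else Sigma (\<T> (j - 1)) (\<lambda>T. T0 - T)"
    have "(\<Sum>U\<in>\<U> j. \<Sum>x\<in>U. f (U - {x})) = (\<Sum>(U, x)\<in>Sigma (\<U> j) (\<lambda>U. U). f (U - {x}))"
      using finU fs by (subst sum.Sigma) (auto simp: \<U>_def)
    also have "\<dots> = (\<Sum>(T, y)\<in>?A \<union> ?B. f T)"
    proof (rule sum.reindex_bij_witness[where i = "\<lambda>(T, y). (insert y T, y)" and j = "\<lambda>(U, x). (U - {x}, x)"])
      fix a assume "a \<in> Sigma (\<U> j) (\<lambda>U. U)"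
      then obtain U x where a: "a = (U, x)" "U \<subseteq> \<Omega>" "card U = Suc t" "card (U \<inter> T0) = j" "x \<in> U"
        by (auto simp: \<U>_def)
      have fU: "finite U" using a fs by blast
      show "(case case a of (U, x) \<Rightarrow> (U - {x}, x) of (T, y) \<Rightarrow> (insert y T, y)) = a"
        using a by auto
      have c: "card (U - {x}) = t" using a fU by simp
      have "(U - {x}, x) \<in> ?A \<union> ?B"
      proof (cases "x \<in> T0")
        case True
        have "(U - {x}) \<inter> T0 = U \<inter> T0 - {x}" by auto
        then have "card ((U - {x}) \<inter> T0) = j - 1" using a True fU by simp
        moreover have "x \<in> U \<inter> T0" "finite (U \<inter> T0)" using a True fU by auto
        then have "card (U \<inter> T0) \<noteq> 0" by (metis card_eq_0_iff empty_iff)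
        then have "j \<noteq> 0" using a by simp
        ultimately show ?thesis using a c True by (auto simp: \<T>_def)
      next
        case False
        then have "(U - {x}) \<inter> T0 = U \<inter> T0" by auto
        then show ?thesis using a c False by (auto simp: \<T>_def)
      qed
      then show "(case a of (U, x) \<Rightarrow> (U - {x}, x)) \<in> ?A \<union> ?B" using a by simp
      show "(case case a of (U, x) \<Rightarrow> (U - {x}, x) of (T, y) \<Rightarrow> f T) = (case a of (U, x) \<Rightarrow> f (U - {x}))"
        using a by simp
    next
      fix b assume "b \<in> ?A \<union> ?B"
      then consider T y where "b = (T, y)" "T \<in> \<T> j" "y \<in> \<Omega> - T - T0"
        | T y where "b = (T, y)" "T \<in> \<T> (j - 1)" "y \<in> T0 - T" "j \<noteq> 0"
        by (auto split: if_splits)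
      then have "\<exists>T y. b = (T, y) \<and> y \<notin> T \<and> (insert y T, y) \<in> Sigma (\<U> j) (\<lambda>U. U)"
      proof cases
        case 1
        then have "finite T" "insert y T \<inter> T0 = T \<inter> T0" using fs by (auto simp: \<T>_def)
        then have "insert y T \<in> \<U> j" using 1 by (auto simp: \<T>_def \<U>_def)
        then show ?thesis using 1 by auto
      next
        case 2
        then have "finite T" "insert y T \<inter> T0 = insert y (T \<inter> T0)" using fs by (auto simp: \<T>_def)
        then have "insert y T \<in> \<U> j" using 2 T0 by (auto simp: \<T>_def \<U>_def)
        then show ?thesis using 2 by auto
      qed
      then obtain T y where b: "b = (T, y)" "y \<notin> T" "(insert y T, y) \<in> Sigma (\<U> j) (\<lambda>U. U)"
        by blast
      show "(case case b of (T, y) \<Rightarrow> (insert y T, y) of (U, x) \<Rightarrow> (U - {x}, x)) = b"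
        using b by auto
      show "(case b of (T, y) \<Rightarrow> (insert y T, y)) \<in> Sigma (\<U> j) (\<lambda>U. U)" using b by auto
    qed
    also have "\<dots> = (\<Sum>(T, y)\<in>?A. f T) + (\<Sum>(T, y)\<in>?B. f T)"
      by (rule sum.union_disjoint) (use finT fin fT0 in auto)
    also have "(\<Sum>(T, y)\<in>?A. f T) = (\<Sum>T\<in>\<T> j. f T * int (card (\<Omega> - T - T0)))"
      using finT fin by (subst sum.Sigma[symmetric]) (auto simp: mult.commute)
    also have "(\<Sum>(T, y)\<in>?B. f T) = (if j = 0 then 0 else \<Sum>T\<in>\<T> (j - 1). f T * int (card (T0 - T)))"
      using finT fT0 by (cases "j = 0", simp) (simp add: sum.Sigma[symmetric] mult.commute)
    finally show ?thesis .
  qed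
  have zero: "(\<Sum>U\<in>\<U> j. \<Sum>x\<in>U. f (U - {x})) = 0" for j
    by (rule sum.neutral) (auto simp: \<U>_def f)
  have cA: "int (card (\<Omega> - T - T0)) = int (card \<Omega>) + int j - 2 * int t" if "T \<in> \<T> j" for T j
  proof -
    have T: "T \<subseteq> \<Omega>" "card T = t" "card (T \<inter> T0) = j" using that by (auto simp: \<T>_def)
    have u: "card (T \<union> T0) + j = 2 * t" using card_Un_Int[OF fs[OF T(1)] fT0] T T0 by simp
    have "\<Omega> - T - T0 = \<Omega> - (T \<union> T0)" by auto
    then have "card (\<Omega> - T - T0) = card \<Omega> - card (T \<union> T0)"
      using T T0 fT0 fs by (simp add: card_Diff_subset)
    moreover have "card (T \<union> T0) \<le> card \<Omega>" using T T0 fin by (simp add: card_mono)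
    ultimately show ?thesis using u by linarith
  qed
  \<comment> \<open>The coefficient of \<open>s j\<close> in the recursion is |\<Omega>| + j - 2 t,
    positive by \<open>size\<close>, so \<open>s j\<close> vanishes as soon as its predecessor does.
    For j = t the sum consists of \<open>f T0\<close> alone.\<close>
  have s0: "s j = 0" if "j \<le> t" for j
    using that
  proof (induction j)
    case 0
    have "s 0 * (int (card \<Omega>) - 2 * int t) = 0"
      using split[of 0] zero[of 0] cA[of _ 0] by (simp add: s_def sum_distrib_right)
    then show ?case using size by simp
  next
    case (Suc j)
    have cB: "int (card (T0 - T)) = int t - int j" if "T \<in> \<T> j" for T
    proof -
      have "card (T0 - T) = card T0 - card (T0 \<inter> T)" using fT0 by (simp add: card_Diff_subset_Int)
      moreover have "card (T0 \<inter> T) = j" using that by (simp add: \<T>_def Int_commute)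
      ultimately show ?thesis using T0 Suc by simp
    qed
    have "0 = (\<Sum>T\<in>\<T> (Suc j). f T * int (card (\<Omega> - T - T0))) + (\<Sum>T\<in>\<T> j. f T * int (card (T0 - T)))"
      using split[of "Suc j"] zero[of "Suc j"] by simp
    also have "(\<Sum>T\<in>\<T> (Suc j). f T * int (card (\<Omega> - T - T0))) = s (Suc j) * (int (card \<Omega>) + int (Suc j) - 2 * int t)"
      unfolding s_def sum_distrib_right by (intro sum.cong refl) (simp only: cA)
    also have "(\<Sum>T\<in>\<T> j. f T * int (card (T0 - T))) = s j * (int t - int j)"
      unfolding s_def sum_distrib_right by (intro sum.cong refl) (simp only: cB)
    finally have "s (Suc j) * (int (card \<Omega>) + int (Suc j) - 2 * int t) = 0" using Suc by simp
    then show ?case using size by simp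
  qed
  have "\<T> t = {T0}"
  proof (rule subset_antisym)
    show "{T0} \<subseteq> \<T> t" using T0 by (simp add: \<T>_def)
    show "\<T> t \<subseteq> {T0}"
    proof
      fix T assume "T \<in> \<T> t"
      then have T: "T \<subseteq> \<Omega>" "card T = t" "card (T \<inter> T0) = t" by (auto simp: \<T>_def)
      then have "T \<inter> T0 = T" "T \<inter> T0 = T0"
        using card_subset_eq[OF fs[OF T(1)], of "T \<inter> T0"] card_subset_eq[OF fT0, of "T \<inter> T0"] T0 by auto
      then show "T \<in> {T0}" by auto
    qed
  qed
  then show ?thesis using s0[of t] by (simp add: s_def)
qed

text \<open>The Livingstone-Wagner theorem. For an orbit \<O> of t-sets, every (t + 1)-set contains
  the same number c of members of \<O>, by homogeneity. An integer function with all shadow sums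
  zero is then a scaled indicator of \<O> minus a constant.\<close>

lemma homog_pred:
  assumes h: "homog (Suc t) G \<Omega>" and size: "2 * t < card \<Omega>"
  shows "homog t G \<Omega>"
  unfolding homog_def
proof (intro allI impI)
  fix A B assume AB: "A \<subseteq> \<Omega>" "B \<subseteq> \<Omega>" "card A = t" "card B = t"
  define \<O> where "\<O> = (\<lambda>g. g ` A) ` G"
  have fs: "finite T" if "T \<subseteq> \<Omega>" for T using that fin finite_subset by blast
  have Oinv: "g ` T \<in> \<O>" if T: "T \<in> \<O>" and g: "g \<in> G" for g T
  proof -
    obtain h where h: "h \<in> G" "T = h ` A" using T unfolding \<O>_def by blast
    then have "g ` T = (g \<circ> h) ` A" by (simp add: image_comp)
    then show ?thesis using comp[OF g h(1)] unfolding \<O>_def by blast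
  qed
  have Oinv': "g ` T \<in> \<O> \<longleftrightarrow> T \<in> \<O>" if "g \<in> G" for g T
    using Oinv[of T g] Oinv[of "g ` T" "inv' g"] that inv by auto
  have "Suc t \<le> card \<Omega>" using size by linarith
  then obtain U0 where U0: "U0 \<subseteq> \<Omega>" "card U0 = Suc t" "finite U0" by (rule obtain_subset_with_card_n)
  define c where "c U = card {x \<in> U. U - {x} \<in> \<O>}" for U
  have const: "c U = c U0" if U: "U \<subseteq> \<Omega>" "card U = Suc t" for U
  proof -
    obtain g where g: "g \<in> G" "g ` U0 = U" using h U U0 unfolding homog_def by blast
    have "{x \<in> U. U - {x} \<in> \<O>} = g ` {x \<in> U0. U0 - {x} \<in> \<O>}"
    proof -
      have "g ` U0 - {g x} = g ` (U0 - {x})" for x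
        using inj[OF g(1)] by (simp add: image_set_diff)
      then have "g ` U0 - {g x} \<in> \<O> \<longleftrightarrow> U0 - {x} \<in> \<O>" for x using Oinv'[OF g(1)] by simp
      then show ?thesis using g(2) by auto
    qed
    then show ?thesis unfolding c_def using card_im[OF g(1)] by simp
  qed
  \<comment> \<open>The indicator is scaled by t + 1 so that the mean over the t + 1 facets of a set
    is the integer c. Vanishing of f at A forces c = t + 1, and then vanishing at B forces B into
    the orbit.\<close>
  define f :: "'a set \<Rightarrow> int" where "f T = (if T \<in> \<O> then int (Suc t) else 0) - int (c U0)" for T
  have f0: "f T = 0" if "T \<subseteq> \<Omega>" "card T = t" for T
  proof (rule zero_if_all_shadow_sums_zero[OF that size])
    fix U assume U: "U \<subseteq> \<Omega>" "card U = Suc t"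
    have fU: "finite U" using U fs by blast
    have "(\<Sum>x\<in>U. f (U - {x})) =
        (\<Sum>x\<in>U. if U - {x} \<in> \<O> then int (Suc t) else 0) - int (Suc t) * int (c U0)"
      unfolding f_def using U by (simp add: sum_subtractf)
    also have "(\<Sum>x\<in>U. if U - {x} \<in> \<O> then int (Suc t) else 0) = int (c U) * int (Suc t)"
      unfolding c_def using fU by (simp add: sum.If_cases Int_def)
    finally show "(\<Sum>x\<in>U. f (U - {x})) = 0" using const[OF U] by simp
  qed
  have "id ` A \<in> \<O>" unfolding \<O>_def using one by (rule imageI)
  then have "A \<in> \<O>" by simp
  then have "int (Suc t) = int (c U0)" using f0[OF AB(1,3)] by (simp add: f_def)
  then have "B \<in> \<O>" using f0[OF AB(2,4)] by (auto simp: f_def split: if_splits)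
  then show "\<exists>g\<in>G. g ` A = B" unfolding \<O>_def by auto
qed

text \<open>Sylow conjugacy in degree p. The number of left cosets of the group Q generated by d is
  prime to p, so c fixes one of them, hQ; then h^(-1) c h lies in Q.\<close>

lemma prime_cycle_conj:
  assumes p: "prime p" and om: "card \<Omega> = p"
    and c: "c \<in> G" "c ^^ p = id" "c \<noteq> id" and d: "d \<in> G" "d ^^ p = id" "d \<noteq> id"
  shows "\<exists>h\<in>G. \<exists>i. inv' h \<circ> c \<circ> h = d ^^ i"
proof -
  have full: "supp e = \<Omega>" if e: "e \<in> G" "e ^^ p = id" "e \<noteq> id" for e
  proof -
    have "supp e \<noteq> {}" using e(3) by (auto simp: supp_def)
    then have "card (supp e) > 0" using finite_supp[OF e(1)] by (simp add: card_gt_0_iff)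
    then have "card \<Omega> \<le> card (supp e)"
      using prime_dvd_supp[OF p e(1,2)] om by (simp add: dvd_imp_le)
    then show ?thesis using supp_subset[OF e(1)] fin by (simp add: card_seteq)
  qed
  define Q where "Q = range (\<lambda>i. d ^^ i)"
  have QG: "Q \<subseteq> G" unfolding Q_def using pow[OF d(1)] by auto
  have Qcomp: "q \<circ> r \<in> Q" if "q \<in> Q" "r \<in> Q" for q r
    using that unfolding Q_def by (auto simp: funpow_add[symmetric])
  have idQ: "id \<in> Q" unfolding Q_def using funpow.simps(1)[of d] by (metis rangeI)
  have Qinv: "inv' q \<in> Q" if q: "q \<in> Q" for q
  proof -
    obtain i where i: "q = d ^^ i" using q unfolding Q_def by blast
    have "i * (p - 1) + i = i * p" using prime_gt_0_nat[OF p] by (cases p) auto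
    then have "(d ^^ (i * (p - 1))) \<circ> (d ^^ i) = d ^^ (i * p)" by (metis funpow_add)
    also have "\<dots> = (d ^^ p) ^^ i" by (simp add: funpow_mult mult.commute)
    also have "\<dots> = id" using d(2) by simp
    finally have "(d ^^ (i * (p - 1))) \<circ> q = id" using i by simp
    then have "(d ^^ (i * (p - 1))) \<circ> (q \<circ> inv' q) = inv' q" by (simp add: o_assoc)
    then have "d ^^ (i * (p - 1)) = inv' q" using QG q by (simp add: subset_iff)
    then show ?thesis unfolding Q_def by (metis rangeI)
  qed
  have "\<Omega> \<noteq> {}" using om prime_gt_0_nat[OF p] by auto
  then obtain x where x: "x \<in> \<Omega>" by blast
  have orb: "(\<lambda>g. g x) ` H = \<Omega>" if H: "Q \<subseteq> H" "H \<subseteq> G" for H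
  proof (intro subset_antisym subsetI)
    fix y assume "y \<in> (\<lambda>g. g x) ` H"
    then show "y \<in> \<Omega>" using H x closed by auto
  next
    fix y assume "y \<in> \<Omega>"
    then obtain i where "(d ^^ i) x = y"
      using prime_cycle_transitive[OF p d(1,2), of x y] full[OF d] om x by auto
    moreover have "d ^^ i \<in> H" using H unfolding Q_def by auto
    ultimately show "y \<in> (\<lambda>g. g x) ` H" by blast
  qed
  interpret S: perm_group "{g \<in> G. g x = x}" "\<Omega> - {x}" by (rule point_stabilizer)
  have cG: "card G = p * card {g \<in> G. g x = x}"
    using orbit_stabilizer[of "\<lambda>g y. g y" x] orb[OF QG] om by simp
  \<comment> \<open>An element of order p moves all p points, so none fixes x. Hence p divides the
    order of G exactly once and does not divide the index of Q.\<close>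
  have nd: "\<not> p dvd card {g \<in> G. g x = x}"
  proof
    assume "p dvd card {g \<in> G. g x = x}"
    then obtain g where g: "g \<in> G" "g x = x" "g \<noteq> id" "g ^^ p = id" using S.Cauchy[OF p] by blast
    then show False using full[OF g(1,4,3)] x by (auto simp: supp_def)
  qed
  have cQ: "card Q = p"
  proof -
    interpret Q: perm_group Q \<Omega>
      by unfold_locales (use fin perm QG idQ Qcomp Qinv in auto)
    have "{g \<in> Q. g x = x} = {id}"
    proof (intro subset_antisym subsetI)
      fix g assume "g \<in> {g \<in> Q. g x = x}"
      then obtain i where i: "g = d ^^ i" "(d ^^ i) x = x" unfolding Q_def by auto
      have "(d ^^ i) y = y" for y
      proof (cases "y \<in> \<Omega>")
        case True
        then obtain j where "(d ^^ j) x = y"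
          using prime_cycle_transitive[OF p d(1,2), of x y] full[OF d] om x by auto
        then show ?thesis using i funpow_apply_add[of i d j x] funpow_apply_add[of j d i x]
          by (simp add: add.commute)
      next
        case False
        then show ?thesis using permutes_not_in[OF perm[OF pow[OF d(1)]]] by blast
      qed
      then show "g \<in> {id}" using i by auto
    qed (use idQ in auto)
    then show ?thesis using Q.orbit_stabilizer[of "\<lambda>g y. g y" x] orb[OF subset_refl QG] om by simp
  qed
  define act :: "('a \<Rightarrow> 'a) \<Rightarrow> ('a \<Rightarrow> 'a) set \<Rightarrow> ('a \<Rightarrow> 'a) set" where "act g A = (\<lambda>q. g \<circ> q) ` A" for g A
  have act: "act (g \<circ> h) A = act g (act h A)" "act id A = A" for g h A
    by (auto simp: act_def image_image o_assoc)
  define X where "X = (\<lambda>g. act g Q) ` G"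
  have stabQ: "{g \<in> G. act g Q = Q} = Q"
  proof (intro subset_antisym subsetI)
    fix g assume "g \<in> {g \<in> G. act g Q = Q}"
    then have "g \<circ> id \<in> Q" using idQ unfolding act_def by blast
    then show "g \<in> Q" by simp
  next
    fix g assume g: "g \<in> Q"
    have "act g Q \<subseteq> Q" unfolding act_def using Qcomp g by auto
    moreover have "q \<in> act g Q" if "q \<in> Q" for q
    proof -
      have "q = g \<circ> (inv' g \<circ> q)" using g QG by (auto simp: o_assoc)
      then show ?thesis unfolding act_def using Qcomp[OF Qinv[OF g] that] by blast
    qed
    ultimately show "g \<in> {g \<in> G. act g Q = Q}" using g QG by auto
  qed
  have "card G = card X * p"
    using orbit_stabilizer[of act Q] act stabQ cQ by (simp add: X_def)
  then have cX: "\<not> p dvd card X" using cG nd prime_gt_0_nat[OF p] by simp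
  \<comment> \<open>If c moved every coset, p would divide their number.\<close>
  have "\<exists>A\<in>X. act c A = A"
  proof (rule ccontr)
    assume "\<not> ?thesis"
    then have "{A \<in> X. act c A \<noteq> A} = X" by auto
    moreover have "p dvd card {A \<in> X. act c A \<noteq> A}"
    proof (rule prime_dvd_card_moved[OF p])
      show "finite X" unfolding X_def using finite_G by simp
      show "act c ` X \<subseteq> X" unfolding X_def using comp[OF c(1)] by (auto simp: act(1)[symmetric])
      have "(act c ^^ i) A = act (c ^^ i) A" for i A
      proof (induction i)
        case 0
        show ?case using act(2)[of A] by (metis eq_id_iff funpow.simps(1))
      next
        case (Suc i)
        have "(act c ^^ Suc i) A = act c ((act c ^^ i) A)" by simp
        also have "\<dots> = act (c \<circ> c ^^ i) A" unfolding Suc by (rule act(1)[symmetric])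
        finally show ?case by (simp only: funpow.simps)
      qed
      then show "(act c ^^ p) A = A" for A using c(2) act(2) by simp
    qed
    ultimately show False using cX by simp
  qed
  then obtain h where h: "h \<in> G" "act c (act h Q) = act h Q" unfolding X_def by blast
  then have "c \<circ> (h \<circ> id) \<in> act h Q" using idQ unfolding act_def by blast
  then obtain q where q: "q \<in> Q" "c \<circ> h = h \<circ> q" unfolding act_def by auto
  have "inv' h \<circ> c \<circ> h = q" using q(2) h by (simp add: o_assoc[symmetric]) (simp add: o_assoc)
  then show ?thesis using h q unfolding Q_def by blast
qed

text \<open>Lift two transpositions of fixed points of c to elements normalizing the group generated by c.
  Their commutator centralizes a generator of it, so it is a power of c on the support of c and its p-th
  power is a 3-cycle.\<close>

lemma Jordan_3_cycle:
  assumes tr: "transitive G \<Omega>" and p: "prime p" and c: "c \<in> G" "c ^^ p = id" "card (supp c) = p"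
    and small: "card \<Omega> < 2 * p" and r: "p + 3 \<le> card \<Omega>"
  shows "\<exists>t\<in>G. card (supp t) = 3"
proof -
  define r where "r = card \<Omega> - p"
  have r3: "r \<ge> 3" "card \<Omega> = p + r" "r < p" using r small unfolding r_def by auto
  let ?D = "supp c"
  define \<Gamma> where "\<Gamma> = \<Omega> - ?D"
  have D\<Omega>: "?D \<subseteq> \<Omega>" and fD: "finite ?D" using supp_subset[OF c(1)] finite_supp[OF c(1)] by auto
  have cid: "c \<noteq> id" using c(3) prime_gt_0_nat[OF p] by (auto simp: supp_def)
  have c\<Gamma>: "card \<Gamma> = r" unfolding \<Gamma>_def r_def using D\<Omega> fD c by (simp add: card_Diff_subset)
  have mt: "multitrans r G \<Omega>"
    by (rule multitrans_mono[OF Jordan_multitrans[OF perm_group_axioms tr p c small r3(2)]])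
      (use r3 prime_gt_0_nat[OF p] in auto)
  have "finite \<Gamma>" using fin by (simp add: \<Gamma>_def)
  then obtain gs where gs: "set gs = \<Gamma>" "distinct gs" using finite_distinct_list by blast
  have lgs: "length gs = r" using gs c\<Gamma> distinct_card by metis
  obtain a b e rest where abe: "gs = a # b # e # rest"
    using lgs r3(1) by (metis One_nat_def Suc_le_length_iff numeral_3_eq_3)
  \<comment> \<open>An element inducing the wanted permutation of the fixed points maps D to itself
    and conjugates c to a p-cycle on D. The subgroup supported on D has degree p, so that cycle can
    be conjugated into the powers of c without disturbing the fixed points.\<close>
  have lift: "\<exists>x\<in>G. map x gs = ys \<and> (\<exists>i. x \<circ> c \<circ> inv' x = c ^^ i)"
    if ys: "distinct ys" "set ys = \<Gamma>" for ys
  proof -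
    have "length ys = r" using ys c\<Gamma> distinct_card by metis
    then obtain x where x: "x \<in> G" "map x gs = ys"
      using mt gs ys lgs unfolding multitrans_def \<Gamma>_def by blast
    have "x ` \<Gamma> = \<Gamma>" using x gs ys by (metis list.set_map)
    then have xD: "x ` ?D = ?D"
      using image_set_diff[OF inj[OF x(1)], of \<Omega> \<Gamma>] im_Omega[OF x(1)] D\<Omega> by (simp add: \<Gamma>_def double_diff)
    let ?H = "{h \<in> G. \<forall>y. y \<notin> ?D \<longrightarrow> h y = y}"
    interpret H: perm_group ?H ?D
    proof
      show "h permutes ?D" if "h \<in> ?H" for h
        by (rule permutes_superset[of h \<Omega>]) (use that perm in auto)
      show "inv' h \<in> ?H" if h: "h \<in> ?H" for h
      proof -
        have "inv' h y = y" if "y \<notin> ?D" for y using h that inv_apply(1)[of h y] by auto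
        then show ?thesis using h inv by auto
      qed
    qed (use fD one comp in auto)
    let ?d = "x \<circ> c \<circ> inv' x"
    have sd: "supp ?d = ?D" using supp_conj[OF x(1)] xD by simp
    have "?d \<in> ?H" using conj_closed[OF x(1) c(1)] sd by (auto simp: supp_def)
    moreover have "?d \<noteq> id" using sd cid by (metis supp_empty_iff)
    moreover have "c \<in> ?H" using c by (auto simp: supp_def)
    ultimately obtain h i where h: "h \<in> ?H" "inv' h \<circ> ?d \<circ> h = c ^^ i"
      using H.prime_cycle_conj[OF p c(3), of ?d c] conj_order[OF x(1) c(2)] c(2) cid by blast
    have hG: "h \<in> G" using h by simp
    let ?x = "inv' h \<circ> x"
    have "map (inv' h) ys = ys"
    proof (rule map_idI)
      fix y assume "y \<in> set ys"
      then show "inv' h y = y" using h(1) ys(2) inv_apply(1)[OF hG, of y] unfolding \<Gamma>_def by auto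
    qed
    moreover have "map ?x gs = map (inv' h) (map x gs)" by simp
    ultimately have "map ?x gs = ys" using x(2) by simp
    moreover have "?x \<circ> c \<circ> inv' ?x = c ^^ i"
    proof -
      have "inv' ?x = inv' x \<circ> h"
        using perm[OF hG] perm[OF x(1)] permutes_inv[OF perm[OF hG]]
        by (simp add: o_inv_distrib permutes_bij permutes_inv_inv)
      then show ?thesis using h(2) by (simp add: o_assoc)
    qed
    ultimately show ?thesis using comp[OF inv[OF hG] x(1)] by blast
  qed
  have dist: "a \<noteq> b" "b \<noteq> e" "a \<noteq> e" "a \<notin> set rest" "b \<notin> set rest" "e \<notin> set rest"
    using gs(2) abe by auto
  have "\<exists>x\<in>G. map x gs = b # a # e # rest \<and> (\<exists>i. x \<circ> c \<circ> inv' x = c ^^ i)"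
    by (rule lift) (use gs abe in auto)
  then obtain x where x: "x \<in> G" "map x gs = b # a # e # rest \<and> (\<exists>i. x \<circ> c \<circ> inv' x = c ^^ i)"
    by (rule bexE)
  obtain i where i: "x \<circ> c \<circ> inv' x = c ^^ i" using conjunct2[OF x(2)] by (rule exE)
  note x = x(1) conjunct1[OF x(2)] i
  have "\<exists>x\<in>G. map x gs = e # b # a # rest \<and> (\<exists>i. x \<circ> c \<circ> inv' x = c ^^ i)"
    by (rule lift) (use gs abe in auto)
  then obtain y where y: "y \<in> G" "map y gs = e # b # a # rest \<and> (\<exists>i. y \<circ> c \<circ> inv' y = c ^^ i)"
    by (rule bexE)
  obtain j where j: "y \<circ> c \<circ> inv' y = c ^^ j" using conjunct2[OF y(2)] by (rule exE)
  note y = y(1) conjunct1[OF y(2)] j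
  have xv: "x a = b" "x b = a" "x e = e" "\<And>w. w \<in> set rest \<Longrightarrow> x w = w"
    using x(2) abe map_eq_conv[of x rest id] by auto
  have yv: "y a = e" "y b = b" "y e = a" "\<And>w. w \<in> set rest \<Longrightarrow> y w = w"
    using y(2) abe map_eq_conv[of y rest id] by auto
  \<comment> \<open>Exponents multiply commutatively, so x y and y x conjugate c to the same power
    \<open>d\<close>.\<close>
  define d where "d = c ^^ (i * j)"
  have powconj: "x \<circ> c ^^ k \<circ> inv' x = c ^^ (i * k)" "y \<circ> c ^^ k \<circ> inv' y = c ^^ (j * k)" for k
    using conj_pow[OF x(1), of k c] conj_pow[OF y(1), of k c] x(3) y(3) by (simp_all add: funpow_mult mult.commute)
  define w1 where "w1 = x \<circ> y"
  define w2 where "w2 = y \<circ> x"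
  have w: "w1 \<in> G" "w2 \<in> G" unfolding w1_def w2_def using x y comp by auto
  have w1c: "w1 (c v) = d (w1 v)" for v
  proof -
    have "y (c v) = (c ^^ j) (y v)" using fun_cong[OF y(3), of "y v"] inv_apply[OF y(1)] by simp
    moreover have "x ((c ^^ j) (y v)) = (c ^^ (i * j)) (x (y v))"
      using fun_cong[OF powconj(1)[of j], of "x (y v)"] inv_apply[OF x(1)] by simp
    ultimately show ?thesis by (simp add: w1_def d_def)
  qed
  have w2c: "w2 (c v) = d (w2 v)" for v
  proof -
    have "x (c v) = (c ^^ i) (x v)" using fun_cong[OF x(3), of "x v"] inv_apply[OF x(1)] by simp
    moreover have "y ((c ^^ i) (x v)) = (c ^^ (j * i)) (y (x v))"
      using fun_cong[OF powconj(2)[of i], of "y (x v)"] inv_apply[OF y(1)] by simp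
    ultimately show ?thesis by (simp add: w2_def d_def mult.commute)
  qed
  \<comment> \<open>The quotient of two elements with the same effect on c centralizes
    \<open>d\<close>. On the fixed points of c it is the commutator of the transpositions (a b) and
    (a e), the 3-cycle a, b, e.\<close>
  define z where "z = w1 \<circ> inv' w2"
  have zG: "z \<in> G" unfolding z_def using w comp inv by auto
  have zd: "z (d v) = d (z v)" for v
  proof -
    have "inv' w2 (d v) = c (inv' w2 v)"
      using w2c[of "inv' w2 v"] inv_apply[OF w(2)] by metis
    then show ?thesis using w1c by (simp add: z_def)
  qed
  have deq: "d = w1 \<circ> c \<circ> inv' w1"
    using w1c inv_apply(2)[OF w(1)] by (auto simp: fun_eq_iff)
  have dG: "d \<in> G" unfolding d_def using pow c by blast
  have dp: "d ^^ p = id" unfolding deq by (rule conj_order[OF w(1) c(2)])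
  have z\<Gamma>: "z a = b" "z b = e" "z e = a" "\<And>v. v \<in> set rest \<Longrightarrow> z v = v"
  proof -
    have i: "inv' w2 v = u" if "w2 u = v" for u v using inv_apply(1)[OF w(2)] that by auto
    have "inv' w2 a = e" by (rule i) (simp add: w2_def xv yv)
    then show "z a = b" by (simp add: z_def w1_def xv yv)
    have "inv' w2 b = a" by (rule i) (simp add: w2_def xv yv)
    then show "z b = e" by (simp add: z_def w1_def xv yv)
    have "inv' w2 e = b" by (rule i) (simp add: w2_def xv yv)
    then show "z e = a" by (simp add: z_def w1_def xv yv)
    fix v assume v: "v \<in> set rest"
    have "inv' w2 v = v" by (rule i) (simp add: w2_def xv yv v)
    then show "z v = v" by (simp add: z_def w1_def xv yv v)
  qed
  have sdD: "supp d = ?D"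
  proof -
    have sub: "supp d \<subseteq> ?D"
    proof
      fix v assume "v \<in> supp d"
      then have "(c ^^ (i * j)) v \<noteq> v" by (simp add: d_def supp_def)
      moreover have "(c ^^ k) v = v" if "c v = v" for k by (induction k) (simp_all add: that)
      ultimately show "v \<in> ?D" by (auto simp: supp_def)
    qed
    moreover have "card (supp d) = p" unfolding deq using supp_conj[OF w(1), of c] card_im[OF w(1)] c(3) by simp
    ultimately show ?thesis using c(3) fD by (simp add: card_subset_eq)
  qed
  have zD: "z v \<in> ?D" if "v \<in> ?D" for v
    using that zd[of v] inj_eq[OF inj[OF zG]] unfolding sdD[symmetric] by (auto simp: supp_def)
  have "?D \<noteq> {}" using c(3) prime_gt_0_nat[OF p] by auto
  then obtain v0 where v0: "v0 \<in> ?D" by blast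
  obtain l where l: "(d ^^ l) v0 = z v0"
    using prime_cycle_transitive[OF p dG dp, of v0 "z v0"] sdD c(3) v0 zD by auto
  have zdk: "z ((d ^^ k) v) = (d ^^ k) (z v)" for k v by (induction k) (simp_all add: zd)
  \<comment> \<open>A map commuting with a transitive cycle is determined by one value, hence agrees
    with a power of that cycle.\<close>
  have zl: "z v = (d ^^ l) v" if vD: "v \<in> ?D" for v
  proof -
    obtain k where k: "(d ^^ k) v0 = v"
      using prime_cycle_transitive[OF p dG dp, of v0 v] sdD c(3) v0 vD by auto
    have "z v = (d ^^ k) ((d ^^ l) v0)" using zdk[of k v0] k l by simp
    also have "\<dots> = (d ^^ l) v" using funpow_apply_add[of k d l v0] funpow_apply_add[of l d k v0] k
      by (simp add: add.commute)
    finally show ?thesis .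
  qed
  have zpD: "(z ^^ p) v = v" if "v \<in> ?D" for v
  proof -
    have "(z ^^ k) v = (d ^^ (l * k)) v \<and> (z ^^ k) v \<in> ?D" for k
    proof (induction k)
      case (Suc k)
      then have "(z ^^ k) v \<in> ?D" and e: "(z ^^ k) v = (d ^^ (l * k)) v" by auto
      then have "z ((z ^^ k) v) = (d ^^ l) ((d ^^ (l * k)) v)" "z ((z ^^ k) v) \<in> ?D"
        using zl[of "(z ^^ k) v"] zD[of "(z ^^ k) v"] by auto
      then show ?case by (simp add: funpow_add)
    qed (use that in simp)
    then have "(z ^^ p) v = ((d ^^ p) ^^ l) v" by (simp add: funpow_mult mult.commute)
    then show ?thesis using dp by simp
  qed
  \<comment> \<open>Here p > 3, because p exceeds the number of fixed points, which is at least
    three. So the p-th power does not kill the 3-cycle a, b, e.\<close>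
  have p3: "p mod 3 = 1 \<or> p mod 3 = 2"
  proof -
    have "\<not> 3 dvd p" using p r3 unfolding prime_nat_iff by auto
    then have "p mod 3 \<noteq> 0" by (simp add: dvd_eq_mod_eq_0)
    then show ?thesis by linarith
  qed
  have z3: "(z ^^ 3) v = v" if "v \<in> {a, b, e}" for v
    using that z\<Gamma> by (auto simp: numeral_3_eq_3)
  have zpG: "(z ^^ p) v = (z ^^ (p mod 3)) v" if "v \<in> {a, b, e}" for v
    using funpow_mod_eq[OF z3[OF that], of p] by simp
  have mv: "(z ^^ p) v \<noteq> v" if v: "v \<in> {a, b, e}" for v
    using zpG[OF v] p3 v z\<Gamma> dist by (auto simp: numeral_2_eq_2)
  have fx: "(z ^^ p) v = v" if v: "v \<notin> {a, b, e}" for v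
  proof (cases "v \<in> ?D")
    case True
    then show ?thesis by (rule zpD)
  next
    case False
    have "z v = v"
    proof (cases "v \<in> \<Omega>")
      case True
      then have "v \<in> set rest" using False v gs abe by (auto simp: \<Gamma>_def)
      then show ?thesis by (rule z\<Gamma>(4))
    next
      case False
      then show ?thesis using permutes_not_in[OF perm[OF zG]] by blast
    qed
    then show ?thesis by (induction p) simp_all
  qed
  have "supp (z ^^ p) = {a, b, e}" unfolding supp_def using mv fx by blast
  then have "card (supp (z ^^ p)) = 3" using dist by simp
  then show ?thesis using pow[OF zG] by blast
qed

end

section \<open>Degree 13\<close>

context perm_group begin

text \<open>Lagrange's theorem: the stabilizer of the coset H under left multiplication is H
  itself.\<close>

lemma subgroup_card_dvd:
  assumes H: "perm_group H \<Omega>" "H \<subseteq> G"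
  shows "card H dvd card G"
proof -
  interpret H: perm_group H \<Omega> by (rule H(1))
  define act :: "('a \<Rightarrow> 'a) \<Rightarrow> ('a \<Rightarrow> 'a) set \<Rightarrow> ('a \<Rightarrow> 'a) set" where "act g A = (\<lambda>q. g \<circ> q) ` A" for g A
  have act: "act (g \<circ> h) A = act g (act h A)" "act id A = A" for g h A
    by (auto simp: act_def image_image o_assoc)
  have "{g \<in> G. act g H = H} = H"
  proof (intro subset_antisym subsetI)
    fix g assume "g \<in> {g \<in> G. act g H = H}"
    then have "g \<circ> id \<in> H" using H.one unfolding act_def by blast
    then show "g \<in> H" by simp
  next
    fix g assume g: "g \<in> H"
    have "act g H \<subseteq> H" unfolding act_def using H.comp g by auto
    moreover have "q \<in> act g H" if "q \<in> H" for q
    proof -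
      have "q = g \<circ> (inv' g \<circ> q)" using H.inv_comp(2)[OF g] by (simp add: o_assoc)
      then show ?thesis unfolding act_def using H.comp[OF H.inv[OF g] that] by blast
    qed
    ultimately show "g \<in> {g \<in> G. act g H = H}" using g H(2) by auto
  qed
  then show ?thesis using orbit_stabilizer[of act H] act by simp
qed

text \<open>Without a 3-cycle, the stabilizer of each 6-set S has a unique fixed point x(S), lying
  outside S, and x commutes with G. For a fixed 5-set F, the map y \<mapsto> x(F \<union> {y}) is
  then a fixed-point-free map of the remaining 8 points whose cube is the identity, but 3 does not
  divide 8.\<close>

lemma degree_13_3_cycle:
  assumes om: "card \<Omega> = 13" and h6: "homog 6 G \<Omega>"
  shows "\<exists>t\<in>G. card (supp t) = 3"
proof (rule ccontr)
  assume no3: "\<not> ?thesis"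
  have h5: "homog 5 G \<Omega>" using homog_pred[of 5] h6 om by simp
  have h4: "homog 4 G \<Omega>" using homog_pred[of 4] h5 om by simp
  have h3: "homog 3 G \<Omega>" using homog_pred[of 3] h4 om by simp
  have h2: "homog 2 G \<Omega>" using homog_pred[of 2] h3 om by (simp add: numeral_3_eq_3 numeral_2_eq_2)
  have h1: "homog 1 G \<Omega>" using homog_pred[of 1] h2 om by (simp add: numeral_2_eq_2)
  have h7: "homog 7 G \<Omega>" using homog_compl[OF h6] om by simp
  have h8: "homog 8 G \<Omega>" using homog_compl[OF h5] om by simp
  \<comment> \<open>G is homogeneous on m-sets for every m \<le> 7, and 2 * 7 \<le> 13 + 1, so a
    nontrivial support of at most 7 points would yield a 3-cycle.\<close>
  have min: "card (supp g) \<ge> 8" if g: "g \<in> G" "g \<noteq> id" for g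
  proof (rule ccontr)
    assume "\<not> ?thesis"
    moreover have "card (supp g) \<noteq> 0" using g finite_supp[OF g(1)] by (simp add: supp_empty_iff)
    ultimately have "card (supp g) \<in> {1, 2, 3, 4, 5, 6, 7}" by auto
    then have "homog (card (supp g)) G \<Omega>" using h1 h2 h3 h4 h5 h6 h7 by auto
    moreover have "card (supp g) \<ge> 1" "2 * card (supp g) \<le> card \<Omega> + 1"
      using \<open>card (supp g) \<in> _\<close> om by auto
    ultimately show False using small_support_3_cycle[OF _ g(1) refl] no3 by blast
  qed
  have bin: "(13::nat) choose 4 = 715" "(13::nat) choose 5 = 1287" "(13::nat) choose 6 = 1716" "(13::nat) choose 8 = 1287"
    by (simp_all add: numeral_eq_Suc)
  obtain D where "D \<subseteq> \<Omega>" "card D = 4" using obtain_subset_with_card_n[of 4 \<Omega>] om by auto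
  then have "card G = 715 * card {g \<in> G. g ` D = D}" using homog_card_dvd[OF h4] om bin by simp
  then have "card G = 5 * (143 * card {g \<in> G. g ` D = D})" by simp
  then have five: "5 dvd card G" by (rule dvdI)
  define K where "K S = {g \<in> G. g ` S = S}" for S
  have pK: "perm_group (K S) \<Omega>" for S unfolding K_def by (rule set_stabilizer)
  have KG: "g \<in> G" if "g \<in> K S" for g S using that by (simp add: K_def)
  have c5: "card G = 1287 * card (K S)" if "S \<subseteq> \<Omega>" "card S = 5" for S
    using homog_card_dvd[OF h5 that] om bin by (simp add: K_def)
  have c6: "card G = 1716 * card (K S)" if "S \<subseteq> \<Omega>" "card S = 6" for S
    using homog_card_dvd[OF h6 that] om bin by (simp add: K_def)
  have c8: "card G = 1287 * card (K S)" if "S \<subseteq> \<Omega>" "card S = 8" for S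
    using homog_card_dvd[OF h8 that] om bin by (simp add: K_def)
  have p5: "prime (5::nat)" and p7: "prime (7::nat)" and p3: "prime (3::nat)" by simp_all
  have five': "5 dvd x" if "5 dvd 1716 * x \<or> 5 dvd 1287 * x" for x :: nat
    using that p5 by (auto simp: prime_dvd_mult_iff)
  \<comment> \<open>The index of K S in K R would be 1716 / 1287 = 4 / 3. The same number serves for
    5- and 8-sets, which are complements of each other.\<close>
  have not_sub: False if S: "S \<subseteq> \<Omega>" "card S = 6" and R: "R \<subseteq> \<Omega>" "card R = 5 \<or> card R = 8" and sub: "K S \<subseteq> K R" for S R
  proof -
    interpret R: perm_group "K R" \<Omega> by (rule pK)
    have "card (K S) dvd card (K R)" by (rule R.subgroup_card_dvd[OF pK sub])
    then obtain j where j: "card (K R) = card (K S) * j" by (auto elim: dvdE)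
    have "1716 * card (K S) = 1287 * card (K R)" using c6[OF S] c5[OF R(1)] c8[OF R(1)] R(2) by auto
    then have "card (K S) = 0 \<or> 3 * j = 4" using j by auto
    moreover interpret S: perm_group "K S" \<Omega> by (rule pK)
    have "card (K S) \<noteq> 0" using S.finite_G S.one by auto
    ultimately have "3 * j = 4" by blast
    then show False by presburger
  qed
  \<comment> \<open>A support of size at least 8 that is a multiple of 5 has size 10, leaving 3
    fixed points. So q moves at least two points of S, and their number is a multiple of 5 below
    7.\<close>
  have elt5: "\<exists>q\<in>K S. q \<noteq> id \<and> q ^^ 5 = id \<and> card (supp q) = 10 \<and> card (S \<inter> supp q) = 5"
    if S: "S \<subseteq> \<Omega>" "card S = 5 \<or> card S = 6" for S
  proof -
    interpret S: perm_group "K S" \<Omega> by (rule pK)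
    have "5 dvd card (K S)" by (rule five') (use c5[of S] c6[of S] S five in auto)
    then obtain q where q: "q \<in> K S" "q \<noteq> id" "q ^^ 5 = id" using S.Cauchy[OF p5] by blast
    have qG: "q \<in> G" using KG q(1) .
    have "5 dvd card (supp q)" using prime_dvd_supp[OF p5 qG q(3)] .
    moreover have le: "card (supp q) \<le> 13" using card_mono[OF fin supp_subset[OF qG]] om by simp
    moreover have "8 \<le> card (supp q)" using min[OF qG q(2)] .
    ultimately have s10: "card (supp q) = 10" by presburger
    have fS: "finite S" using S fin finite_subset by blast
    have "5 dvd card {x \<in> S. q x \<noteq> x}"
      by (rule prime_dvd_card_moved[OF p5 fS]) (use q in \<open>auto simp: K_def\<close>)
    moreover have "{x \<in> S. q x \<noteq> x} = S \<inter> supp q" by (auto simp: supp_def)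
    ultimately have d5: "5 dvd card (S \<inter> supp q)" by simp
    have "card (\<Omega> - supp q) = 3" using s10 om supp_subset[OF qG] finite_supp[OF qG] by (simp add: card_Diff_subset)
    moreover have "card (S - supp q) \<le> card (\<Omega> - supp q)" using S fin by (intro card_mono) auto
    moreover have "card S = card (S \<inter> supp q) + card (S - supp q)"
      using card_Int_Diff[OF fS] by blast
    ultimately have "card (S \<inter> supp q) = 5" using S(2) d5 by (elim disjE) (presburger+)
    then show ?thesis using q s10 by blast
  qed
  have orb5: "\<exists>i. (q ^^ i) x = y" if q: "q \<in> G" "q ^^ 5 = id" "q ` X = X" "X \<subseteq> supp q" "card X = 5" and xy: "x \<in> X" "y \<in> X" for q X x y
    by (rule prime_orbit_transitive[OF p5 _ _ q(2,5) _ xy])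
      (use q finite_subset[OF q(4) finite_supp[OF q(1)]] in \<open>auto simp: supp_def\<close>)
  have qsupp: "q ` supp q = supp q" if "q \<in> G" for q
  proof -
    have "q \<circ> q \<circ> inv' q = q" using that by (simp add: o_assoc[symmetric])
    then show ?thesis using supp_conj[OF that, of q] by simp
  qed
  have imInt: "q ` (A \<inter> B) = A \<inter> B" if "q \<in> G" "q ` A = A" "q ` B = B" for q A B
    using image_Int[OF inj[OF that(1)], of A B] that by simp
  \<comment> \<open>q is transitive on five points of S; if K S fixed the sixth point z, it would
    stabilize the 5-set S - {z}.\<close>
  have transS: "\<exists>g\<in>K S. g x = y" if S: "S \<subseteq> \<Omega>" "card S = 6" and xy: "x \<in> S" "y \<in> S" for S x y
  proof -
    interpret S: perm_group "K S" \<Omega> by (rule pK)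
    obtain q where q: "q \<in> K S" "q ^^ 5 = id" "card (S \<inter> supp q) = 5" using elt5[OF S(1)] S(2) by blast
    have qG: "q \<in> G" using KG q(1) .
    let ?X = "S \<inter> supp q"
    have qX: "q ` ?X = ?X" by (rule imInt[OF qG _ qsupp[OF qG]]) (use q in \<open>simp add: K_def\<close>)
    have fS: "finite S" using S fin finite_subset by blast
    have "card (S - ?X) = 1" using S(2) q(3) fS by (simp add: card_Diff_subset)
    then obtain z where z: "S - ?X = {z}" by (auto simp: card_1_singleton_iff)
    have zS: "z \<in> S" "z \<notin> ?X" using z by auto
    have "\<exists>g\<in>K S. g z \<noteq> z"
    proof (rule ccontr)
      assume n: "\<not> ?thesis"
      have "K S \<subseteq> K (S - {z})"
      proof
        fix g assume g: "g \<in> K S"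
        then have "g z = z" using n by blast
        moreover have "g ` (S - {z}) = g ` S - {g z}" using inj[OF KG[OF g]] by (simp add: image_set_diff)
        ultimately show "g \<in> K (S - {z})" using g by (simp add: K_def)
      qed
      moreover have "card (S - {z}) = 5" using S zS fS by simp
      ultimately show False using not_sub[OF S, of "S - {z}"] S by blast
    qed
    then obtain g where g: "g \<in> K S" "g z \<noteq> z" by blast
    have "g z \<in> S" using g(1) zS unfolding K_def by blast
    then have gz: "g z \<in> ?X" using g(2) z by blast
    have toz: "\<exists>h\<in>K S. h z = w" if w: "w \<in> S" for w
    proof (cases "w = z")
      case True
      then show ?thesis using S.one by (intro bexI[of _ id]) auto
    next
      case False
      then have "w \<in> ?X" using w z by blast
      then obtain i where "(q ^^ i) (g z) = w" using orb5[OF qG q(2) qX _ q(3) gz] by auto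
      then have "(q ^^ i \<circ> g) z = w" by simp
      then show ?thesis using S.comp[OF S.pow[OF q(1)] g(1)] by blast
    qed
    obtain h h' where h: "h \<in> K S" "h z = x" "h' \<in> K S" "h' z = y" using toz xy by metis
    have "(h' \<circ> inv' h) x = y" using S.inv_apply(1)[OF h(1), of z] h by simp
    then show ?thesis using S.comp[OF h(3) S.inv[OF h(1)]] by blast
  qed
  \<comment> \<open>Outside S the element q has a 5-cycle B and two further points R. R is not
    invariant under K S, as S \<union> R is an 8-set. So the orbit of some w in R contains B and w,
    and the question is whether it contains the seventh point z.\<close>
  have uniq: "\<exists>z\<in>\<Omega> - S. (\<forall>g\<in>K S. g z = z) \<and> (\<forall>z'\<in>\<Omega>. (\<forall>g\<in>K S. g z' = z') \<longrightarrow> z' = z)"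
    if S: "S \<subseteq> \<Omega>" "card S = 6" for S
  proof -
    interpret S: perm_group "K S" \<Omega> by (rule pK)
    let ?T = "\<Omega> - S"
    have fS: "finite S" using S fin finite_subset by blast
    have cT: "card ?T = 7" using S om fS by (simp add: card_Diff_subset)
    obtain q where q: "q \<in> K S" "q ^^ 5 = id" "card (supp q) = 10" "card (S \<inter> supp q) = 5"
      using elt5[OF S(1)] S(2) by blast
    have qG: "q \<in> G" using KG q(1) .
    have KT: "g ` ?T = ?T" if "g \<in> K S" for g
      using that im_Omega[OF KG[OF that]] image_set_diff[OF inj[OF KG[OF that]], of \<Omega> S] by (simp add: K_def)
    let ?B = "?T \<inter> supp q"
    have "supp q = (S \<inter> supp q) \<union> ?B" using supp_subset[OF qG] by auto
    moreover have "card ((S \<inter> supp q) \<union> ?B) = card (S \<inter> supp q) + card ?B"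
      by (rule card_Un_disjoint) (use fin fS in auto)
    ultimately have cB: "card ?B = 5" using q by simp
    have qB: "q ` ?B = ?B" by (rule imInt[OF qG KT[OF q(1)] qsupp[OF qG]])
    let ?R = "?T - ?B"
    have cR: "card ?R = 2" using cT cB fin by (simp add: card_Diff_subset)
    have "\<exists>g\<in>K S. g ` ?R \<noteq> ?R"
    proof (rule ccontr)
      assume n: "\<not> ?thesis"
      have "K S \<subseteq> K (S \<union> ?R)"
      proof
        fix g assume g: "g \<in> K S"
        then have "g ` ?R = ?R" using n by blast
        then show "g \<in> K (S \<union> ?R)" using g by (simp add: K_def image_Un)
      qed
      moreover have "card (S \<union> ?R) = card S + card ?R" by (rule card_Un_disjoint) (use fS fin in auto)
      moreover have "S \<union> ?R \<subseteq> \<Omega>" using S by auto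
      ultimately show False using not_sub[OF S, of "S \<union> ?R"] S cR by simp
    qed
    then obtain g where g: "g \<in> K S" "g ` ?R \<noteq> ?R" by blast
    have "\<not> g ` ?R \<subseteq> ?R"
    proof
      assume "g ` ?R \<subseteq> ?R"
      then have "g ` ?R = ?R" using card_im[OF KG[OF g(1)]] fin by (intro card_subset_eq) auto
      then show False using g by blast
    qed
    then obtain w where w: "w \<in> ?R" "g w \<notin> ?R" by blast
    have "g w \<in> ?T" using KT[OF g(1)] w by blast
    then have gwB: "g w \<in> ?B" using w by blast
    have "card (?R - {w}) = 1" unfolding card_Diff_singleton[OF w(1)] cR by simp
    then obtain z where z: "?R - {w} = {z}" by (auto simp: card_1_singleton_iff)
    define Y where "Y = (\<lambda>h. h w) ` K S"
    have YB: "v \<in> Y" if vB: "v \<in> ?B" for v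
    proof -
      obtain i where "(q ^^ i) (g w) = v" using orb5[OF qG q(2) qB _ cB gwB vB] by auto
      then have "(q ^^ i \<circ> g) w = v" by simp
      then show ?thesis unfolding Y_def using S.comp[OF S.pow[OF q(1)] g(1)] by blast
    qed
    have wY: "w \<in> Y" unfolding Y_def using S.one by (intro image_eqI[of _ _ id]) auto
    have YT: "Y \<subseteq> ?T" unfolding Y_def using KT w by blast
    have Yinv: "h v \<in> Y" if vY: "v \<in> Y" and hK: "h \<in> K S" for h v
    proof -
      obtain h' where "h' \<in> K S" "v = h' w" using vY unfolding Y_def by blast
      then have "h \<circ> h' \<in> K S" "h v = (h \<circ> h') w" using S.comp[OF hK] by auto
      then show ?thesis unfolding Y_def by blast
    qed
    have Tcases: "v = z \<or> v = w \<or> v \<in> ?B" if "v \<in> ?T" for v using z that by blast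
    have zT: "z \<in> ?T" using z by blast
    \<comment> \<open>An orbit of size 7 gives an element of order 7 in K S. Its support is a
      multiple of 7 and at most 13, hence of size 7, contrary to \<open>min\<close>.\<close>
    have zY: "z \<notin> Y"
    proof
      assume "z \<in> Y"
      have "Y = ?T"
      proof (rule subset_antisym[OF YT], rule subsetI)
        fix v assume "v \<in> ?T"
        then show "v \<in> Y" using Tcases[of v] YB[of v] wY \<open>z \<in> Y\<close> by metis
      qed
      then have "card (K S) = 7 * card {h \<in> K S. h w = w}"
        using S.orbit_stabilizer[of "\<lambda>h v. h v" w] cT unfolding Y_def by simp
      then have "7 dvd card (K S)" by simp
      then obtain r where r: "r \<in> K S" "r \<noteq> id" "r ^^ 7 = id" using S.Cauchy[OF p7] by blast
      have rG: "r \<in> G" using KG r(1) .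
      obtain j where j: "card (supp r) = 7 * j" using prime_dvd_supp[OF p7 rG r(3)] by (rule dvdE)
      have "7 * j \<le> 13" using card_mono[OF fin supp_subset[OF rG]] om j by simp
      then have "j \<le> 1" by simp
      moreover have "8 \<le> 7 * j" using min[OF rG r(2)] j by simp
      ultimately show False by simp
    qed
    have zfix: "h z = z" if h: "h \<in> K S" for h
    proof (rule ccontr)
      assume hz: "h z \<noteq> z"
      have "h z \<in> ?T" using KT[OF h] zT by blast
      then have "h z \<in> Y" using hz Tcases[of "h z"] YB[of "h z"] wY by metis
      then have "inv' h (h z) \<in> Y" using Yinv S.inv[OF h] by blast
      then show False using zY S.inv_apply(1)[OF h] by simp
    qed
    have uni: "z' = z" if z': "z' \<in> \<Omega>" "\<forall>h\<in>K S. h z' = z'" for z'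
    proof (rule ccontr)
      assume ne: "z' \<noteq> z"
      show False
      proof (cases "z' \<in> S")
        case True
        have "\<exists>y\<in>S. y \<noteq> z'" using S(2) card_mono[of "{z'}" S] by (cases "S \<subseteq> {z'}") auto
        then show False using transS[OF S True] z'(2) by blast
      next
        case False
        then have "z' \<in> ?T" using z'(1) by simp
        then have "z' \<in> Y" using ne Tcases[of z'] YB[of z'] wY by metis
        then obtain h where h: "h \<in> K S" "z' = h w" unfolding Y_def by blast
        have "inv' h z' = w" using S.inv_apply(1)[OF h(1)] h by simp
        then have "z' = w" using z'(2) S.inv[OF h(1)] by auto
        then have "g w = w" using z'(2) g by auto
        then show False using gwB w by auto
      qed
    qed
    show ?thesis using zT zfix uni by blast
  qed
  define x where "x S = (SOME z. z \<in> \<Omega> - S \<and> (\<forall>g\<in>K S. g z = z) \<and> (\<forall>z'\<in>\<Omega>. (\<forall>g\<in>K S. g z' = z') \<longrightarrow> z' = z))" for S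
  have x: "x S \<in> \<Omega> - S" "\<And>g. g \<in> K S \<Longrightarrow> g (x S) = x S"
    "\<And>z'. z' \<in> \<Omega> \<Longrightarrow> (\<And>g. g \<in> K S \<Longrightarrow> g z' = z') \<Longrightarrow> z' = x S" if S: "S \<subseteq> \<Omega>" "card S = 6" for S
  proof -
    have "x S \<in> \<Omega> - S \<and> (\<forall>g\<in>K S. g (x S) = x S) \<and> (\<forall>z'\<in>\<Omega>. (\<forall>g\<in>K S. g z' = z') \<longrightarrow> z' = x S)"
      unfolding x_def by (rule someI_ex) (use uniq[OF S] in blast)
    then show "x S \<in> \<Omega> - S" "\<And>g. g \<in> K S \<Longrightarrow> g (x S) = x S"
      "\<And>z'. z' \<in> \<Omega> \<Longrightarrow> (\<And>g. g \<in> K S \<Longrightarrow> g z' = z') \<Longrightarrow> z' = x S" by blast+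
  qed
  have xim: "x (g ` S) = g (x S)" if S: "S \<subseteq> \<Omega>" "card S = 6" and g: "g \<in> G" for S g
  proof -
    have gS: "g ` S \<subseteq> \<Omega>" "card (g ` S) = 6" using S im_subset[OF g] card_im[OF g] by auto
    have "g (x S) = x (g ` S)"
    proof (rule x(3)[OF gS])
      show "g (x S) \<in> \<Omega>" using x(1)[OF S] closed[OF g] by auto
      fix h assume h: "h \<in> K (g ` S)"
      let ?h = "inv' g \<circ> h \<circ> g"
      have "?h ` S = inv' g ` (h ` (g ` S))" by (simp add: image_comp)
      also have "\<dots> = S" using h g by (simp add: K_def)
      finally have "?h \<in> K S" using comp[OF comp[OF inv[OF g] KG[OF h]] g] by (simp add: K_def)
      then have "?h (x S) = x S" by (rule x(2)[OF S])
      then have "g (inv' g (h (g (x S)))) = g (x S)" by simp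
      then show "h (g (x S)) = g (x S)" by (simp only: inv_apply(2)[OF g])
    qed
    then show ?thesis by simp
  qed
  obtain F where F: "F \<subseteq> \<Omega>" "card F = 5" using obtain_subset_with_card_n[of 5 \<Omega>] om by auto
  have fF: "finite F" using F fin finite_subset by blast
  let ?V = "\<Omega> - F"
  have cV: "card ?V = 8" using F fF om by (simp add: card_Diff_subset)
  have ins: "insert y F \<subseteq> \<Omega>" "card (insert y F) = 6" if "y \<in> ?V" for y
    using that F fF by auto
  interpret KF: perm_group "K F" \<Omega> by (rule pK)
  have transF: "\<exists>g\<in>K F. g y = y'" if y: "y \<in> ?V" and y': "y' \<in> ?V" for y y'
  proof -
    obtain g where g: "g \<in> G" "g ` insert y F = insert y' F"
      using h6[unfolded homog_def, rule_format, OF ins(1)[OF y] ins(1)[OF y'] ins(2)[OF y] ins(2)[OF y']]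
      by (rule bexE)
    have "g y \<in> g ` insert y F" by (rule imageI) simp
    then have "g y \<in> insert y' F" unfolding g(2) .
    then obtain h where h: "h \<in> K (insert y' F)" "h (g y) = y'" using transS[OF ins[OF y'], of "g y" y'] by auto
    let ?k = "h \<circ> g"
    have kG: "?k \<in> G" using comp[OF KG[OF h(1)] g(1)] .
    have "h ` insert y' F = insert y' F" using h(1) by (simp only: K_def mem_Collect_eq)
    then have "?k ` insert y F = insert y' F" using g(2) image_comp[of h g "insert y F"] by simp
    moreover have "?k ` (insert y F - {y}) = ?k ` insert y F - {?k y}"
      using image_set_diff[OF inj[OF kG], of "insert y F" "{y}"] by (simp only: image_insert image_empty)
    moreover have "insert y F - {y} = F" "insert y' F - {y'} = F" using y y' by auto
    ultimately have "?k ` F = F" using h(2) by simp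
    then show ?thesis using kG h(2) by (intro bexI[of _ ?k]) (auto simp: K_def)
  qed
  \<comment> \<open>Equivariance of x makes \<psi> commute with K F, which is transitive on the
    complement of F.\<close>
  define \<psi> where "\<psi> y = x (insert y F)" for y
  have psiV: "\<psi> y \<in> ?V" "\<psi> y \<noteq> y" if "y \<in> ?V" for y
    using x(1)[OF ins[OF that]] unfolding \<psi>_def by auto
  have psig: "\<psi> (g y) = g (\<psi> y)" if y: "y \<in> ?V" and g: "g \<in> K F" for y g
  proof -
    have "insert (g y) F = g ` insert y F" using g by (simp add: K_def)
    then show ?thesis unfolding \<psi>_def using xim[OF ins[OF y] KG[OF g]] by simp
  qed
  have "\<psi> ` ?V = ?V"
  proof (intro subset_antisym subsetI)
    fix v assume "v \<in> \<psi> ` ?V"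
    then show "v \<in> ?V" using psiV by blast
  next
    fix v assume v: "v \<in> ?V"
    then obtain g where g: "g \<in> K F" "g (\<psi> v) = v" using transF[OF psiV(1)[OF v] v] by blast
    have "g v \<in> ?V" using g(1) v closed[OF KG[OF g(1)]] KF.mem_image[OF KF.inv[OF g(1)], of v F]
    proof -
      have "g v \<notin> F"
      proof
        assume "g v \<in> F"
        then have "g v \<in> g ` F" using g(1) by (simp add: K_def)
        then show False using v inj[OF KG[OF g(1)]] by (auto simp: inj_eq)
      qed
      then show ?thesis using v closed[OF KG[OF g(1)]] by auto
    qed
    then show "v \<in> \<psi> ` ?V" using psig[OF v g(1)] g(2) by (intro image_eqI[of _ _ "g v"]) auto
  qed
  then have psi_inj: "inj_on \<psi> ?V" using fin by (intro eq_card_imp_inj_on) auto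
  \<comment> \<open>q moves all of F and fixes exactly three points. These are preserved by \<psi>,
    which commutes with q, and \<psi> acts on them without fixed points, hence as a 3-cycle.\<close>
  obtain q where q: "q \<in> K F" "q ^^ 5 = id" "card (supp q) = 10" "card (F \<inter> supp q) = 5"
    using elt5[OF F(1)] F(2) by blast
  have qG: "q \<in> G" using KG q(1) .
  let ?X = "\<Omega> - supp q"
  have cX: "card ?X = 3" using q om supp_subset[OF qG] finite_supp[OF qG] by (simp add: card_Diff_subset)
  have "F \<inter> supp q = F" using q(4) F fF by (intro card_subset_eq) auto
  then have XV: "?X \<subseteq> ?V" by auto
  have psiX: "\<psi> v \<in> ?X" if v: "v \<in> ?X" for v
  proof -
    have "q v = v" using v by (simp add: supp_def)
    moreover have vV: "v \<in> ?V" using XV v by blast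
    ultimately have "q (\<psi> v) = \<psi> v" using psig[OF vV q(1)] by simp
    then show ?thesis using psiV(1)[OF vV] by (simp add: supp_def)
  qed
  define t where "t v = (if v \<in> ?X then \<psi> v else v)" for v
  have "inj t"
  proof (rule injI)
    fix u v assume "t u = t v"
    then show "u = v" using psiX inj_onD[OF psi_inj, of u v] XV unfolding t_def by (auto split: if_splits)
  qed
  moreover have "supp t = ?X"
  proof (intro subset_antisym subsetI)
    fix v assume v: "v \<in> ?X"
    then have "\<psi> v \<noteq> v" using psiV(2) XV by blast
    then show "v \<in> supp t" using v by (simp add: supp_def t_def)
  next
    fix v assume "v \<in> supp t"
    then show "v \<in> ?X" unfolding supp_def[of t] t_def by (auto split: if_splits)
  qed
  ultimately obtain u v w where uvw: "?X = {u, v, w}" "t u = v" "t v = w" "t w = u"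
    using card_3_cycle[of t] cX by metis
  have uX: "u \<in> ?X" "v \<in> ?X" "w \<in> ?X" using uvw(1) by simp_all
  then have pu: "\<psi> u = v" "\<psi> v = w" "\<psi> w = u" using uvw(2-4) by (simp_all add: t_def)
  have uV: "u \<in> ?V" "v \<in> ?V" "w \<in> ?V" using uX XV by blast+
  \<comment> \<open>The cube of \<psi> is trivial at u; K F is transitive and commutes with \<psi>,
    so the cube is trivial everywhere.\<close>
  have psi3: "(\<psi> ^^ 3) y = y" if y: "y \<in> ?V" for y
  proof -
    obtain g where g: "g \<in> K F" "g u = y" using transF[OF uV(1) y] by blast
    have "\<psi> y = g v" "\<psi> (g v) = g w" "\<psi> (g w) = y" using psig[OF _ g(1)] uV pu g(2) by metis+
    then show ?thesis by (simp add: numeral_3_eq_3)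
  qed
  have "3 dvd card {y \<in> ?V. \<psi> y \<noteq> y}"
    by (rule prime_dvd_card_moved[OF p3]) (use fin psiV(1) psi3 in auto)
  moreover have "{y \<in> ?V. \<psi> y \<noteq> y} = ?V" using psiV(2) by blast
  ultimately show False using cV by simp
qed

end

section \<open>Permutations as lists\<close>

text \<open>A list xs stands for the map i \<mapsto> xs ! i; in a composition the second list acts
  first.\<close>

definition cmp :: "nat list \<Rightarrow> nat list \<Rightarrow> nat list" where
  "cmp xs ys = map (\<lambda>i. xs ! i) ys"

definition moved :: "nat list \<Rightarrow> nat" where
  "moved xs = length (filter (\<lambda>(i, j). i \<noteq> j) (zip xs [0..<length xs]))"

fun pw :: "nat \<Rightarrow> nat list \<Rightarrow> nat list" where
  "pw 0 xs = [0..<length xs]"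
| "pw (Suc k) xs = cmp xs (pw k xs)"

text \<open>A word is a list of indices into the generators \<open>gs\<close>, its head being the
  factor applied last. The empty word takes the degree from the first generator.\<close>

fun wp :: "nat list list \<Rightarrow> nat list \<Rightarrow> nat list" where
  "wp gs [] = [0..<length (hd gs)]"
| "wp gs (i # w) = cmp (gs ! i) (wp gs w)"

fun perms :: "'a list \<Rightarrow> 'a list list" where
  "perms [] = [[]]"
| "perms (x # xs) = concat (map (\<lambda>ys. map (\<lambda>i. take i ys @ x # drop i ys) [0..<Suc (length ys)]) (perms xs))"

lemma perms_complete:
  assumes "distinct xs" "distinct ys" "set xs = set ys"
  shows "xs \<in> set (perms ys)"
  using assms
proof (induction ys arbitrary: xs)
  case (Cons y ys)
  then obtain us vs where xs: "xs = us @ y # vs" using split_list[of y xs] by auto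
  have "insert y (set us \<union> set vs) = insert y (set ys)" using Cons.prems(3) xs by simp
  moreover have "y \<notin> set us \<union> set vs" "y \<notin> set ys" using Cons.prems xs by auto
  ultimately have "set (us @ vs) = set ys" by (metis insert_ident set_append)
  then have "us @ vs \<in> set (perms ys)" using Cons.prems xs by (intro Cons.IH) auto
  moreover have "xs \<in> set (map (\<lambda>i. take i (us @ vs) @ y # drop i (us @ vs)) [0..<Suc (length (us @ vs))])"
    unfolding set_map by (rule image_eqI[of _ _ "length us"]) (use xs in auto)
  ultimately show ?case
    unfolding perms.simps set_concat by (intro UnionI[OF imageI]) (auto simp del: upt_Suc)
qed simp

lemma nth_less: "set xs \<subseteq> {..<N} \<Longrightarrow> i < length xs \<Longrightarrow> xs ! i < N" for N :: nat
  using subsetD[OF _ nth_mem[of i xs]] by blast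

text \<open>A labelling e of the points by 0, ..., N - 1 turns G into a set of lists, selected by
  the predicate \<open>R\<close>, on which concrete words can be evaluated.\<close>

locale list_rep = perm_group G \<Omega> for G :: "('a \<Rightarrow> 'a) set" and \<Omega> :: "'a set" +
  fixes e :: "nat \<Rightarrow> 'a" and N :: nat
  assumes e_bij: "bij_betw e {..<N} \<Omega>"
begin

definition R :: "nat list \<Rightarrow> bool" where
  "R xs \<longleftrightarrow> length xs = N \<and> set xs \<subseteq> {..<N} \<and> (\<exists>g\<in>G. \<forall>i<N. g (e i) = e (xs ! i))"

lemma e_inj: "i < N \<Longrightarrow> j < N \<Longrightarrow> e i = e j \<longleftrightarrow> i = j"
  using e_bij by (auto simp: bij_betw_def inj_on_def)

lemma e_in: "i < N \<Longrightarrow> e i \<in> \<Omega>"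
  using e_bij by (auto simp: bij_betw_def)

lemma e_surj:
  assumes "x \<in> \<Omega>" obtains i where "i < N" "x = e i"
  using assms e_bij that unfolding bij_betw_def by auto

lemma card_Omega: "card \<Omega> = N"
  using bij_betw_same_card[OF e_bij] by simp

lemma R_length: "R xs \<Longrightarrow> length xs = N"
  by (simp add: R_def)

lemma R_nth: "R xs \<Longrightarrow> i < N \<Longrightarrow> xs ! i < N"
  unfolding R_def by (simp add: nth_less)

lemma R_elem:
  assumes "R xs" obtains g where "g \<in> G" "\<And>i. i < N \<Longrightarrow> g (e i) = e (xs ! i)"
  using assms that unfolding R_def by blast

lemma R_id: "R [0..<N]"
  unfolding R_def using one by (auto intro!: bexI[of _ id])

lemma R_comp:
  assumes x: "R xs" and y: "R ys"
  shows "R (cmp xs ys)"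
proof -
  obtain g where g: "g \<in> G" "\<And>i. i < N \<Longrightarrow> g (e i) = e (xs ! i)" using R_elem[OF x] by blast
  obtain h where h: "h \<in> G" "\<And>i. i < N \<Longrightarrow> h (e i) = e (ys ! i)" using R_elem[OF y] by blast
  have "(g \<circ> h) (e i) = e (cmp xs ys ! i)" if "i < N" for i
    using g(2)[OF R_nth[OF y that]] h(2)[OF that] R_length[OF y] that by (simp add: cmp_def)
  moreover have "set (cmp xs ys) \<subseteq> {..<N}"
    using R_nth[OF x] y unfolding cmp_def R_def by auto
  moreover have "length (cmp xs ys) = N" using R_length[OF y] by (simp add: cmp_def)
  ultimately show ?thesis unfolding R_def using comp[OF g(1) h(1)] by blast
qed

lemma R_pw: "R xs \<Longrightarrow> R (pw k xs)"
  by (induction k) (auto simp: R_length R_id R_comp)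

lemma R_wp:
  assumes "gs \<noteq> []" "\<And>x. x \<in> set gs \<Longrightarrow> R x" "\<forall>i\<in>set w. i < length gs"
  shows "R (wp gs w)"
  using assms(3)
proof (induction w)
  case Nil
  have "length (hd gs) = N" using assms by (simp add: R_length)
  then show ?case using R_id by simp
next
  case (Cons i w)
  then show ?case using assms(2)[of "gs ! i"] by (simp add: R_comp)
qed

lemma R_of:
  assumes g: "g \<in> G"
  obtains xs where "R xs" "\<And>i. i < N \<Longrightarrow> g (e i) = e (xs ! i)"
proof -
  let ?f = "\<lambda>i. inv_into {..<N} e (g (e i))"
  have im: "g (e i) \<in> e ` {..<N}" if "i < N" for i
    using closed[OF g, of "e i"] e_in[OF that] e_bij by (simp add: bij_betw_def)
  let ?xs = "map ?f [0..<N]"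
  have v: "g (e i) = e (?xs ! i)" if "i < N" for i
    using f_inv_into_f[OF im[OF that]] that by simp
  have "set ?xs \<subseteq> {..<N}" using inv_into_into[OF im] by auto
  moreover have "\<exists>g\<in>G. \<forall>i<N. g (e i) = e (?xs ! i)" by (rule bexI[OF _ g]) (use v in blast)
  ultimately have "R ?xs" unfolding R_def by simp
  then show ?thesis using v by (rule that)
qed

lemma R_distinct:
  assumes x: "R xs"
  shows "distinct xs"
proof -
  obtain g where g: "g \<in> G" "\<And>i. i < N \<Longrightarrow> g (e i) = e (xs ! i)" using R_elem[OF x] by blast
  have "xs ! i \<noteq> xs ! j" if ij: "i < N" "j < N" "i \<noteq> j" for i j
  proof
    assume "xs ! i = xs ! j"
    then have "g (e i) = g (e j)" using g(2) ij by simp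
    then show False using inj_eq[OF inj[OF g(1)]] e_inj ij by simp
  qed
  then show ?thesis using R_length[OF x] by (simp add: distinct_conv_nth)
qed

lemma R_set:
  assumes x: "R xs"
  shows "set xs = {..<N}"
proof (rule card_subset_eq)
  show "set xs \<subseteq> {..<N}" using x by (simp add: R_def)
  show "card (set xs) = card {..<N}" using distinct_card[OF R_distinct[OF x]] R_length[OF x] by simp
qed simp

lemma moved_supp:
  assumes x: "R xs" and g: "g \<in> G" "\<And>i. i < N \<Longrightarrow> g (e i) = e (xs ! i)"
  shows "card (supp g) = moved xs"
proof -
  have "supp g = e ` {i. i < N \<and> xs ! i \<noteq> i}"
  proof (intro subset_antisym subsetI)
    fix v assume v: "v \<in> supp g"
    then obtain i where i: "i < N" "v = e i" using supp_subset[OF g(1)] e_surj by blast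
    then have "e (xs ! i) \<noteq> e i" using v g(2) by (auto simp: supp_def)
    then show "v \<in> e ` {i. i < N \<and> xs ! i \<noteq> i}" using i by auto
  next
    fix v assume "v \<in> e ` {i. i < N \<and> xs ! i \<noteq> i}"
    then obtain i where "i < N" "v = e i" "xs ! i \<noteq> i" by auto
    then show "v \<in> supp g" using g(2) e_inj R_nth[OF x] by (simp add: supp_def)
  qed
  moreover have "inj_on e {i. i < N \<and> xs ! i \<noteq> i}" using e_inj by (auto simp: inj_on_def)
  ultimately have "card (supp g) = card {i. i < N \<and> xs ! i \<noteq> i}" by (simp add: card_image)
  also have "\<dots> = moved xs"
    unfolding moved_def length_filter_conv_card using R_length[OF x]
    by (intro arg_cong[of _ _ card]) auto
  finally show ?thesis .
qed

lemma R_moved: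
  assumes "R xs"
  shows "\<exists>g\<in>G. card (supp g) = moved xs"
proof -
  obtain g where g: "g \<in> G" "\<And>i. i < N \<Longrightarrow> g (e i) = e (xs ! i)" using R_elem[OF assms] by blast
  then show ?thesis using moved_supp[OF assms g] by blast
qed

lemma R_inverse:
  assumes x: "R xs"
  obtains ys where "R ys" "cmp ys xs = [0..<N]" "cmp xs ys = [0..<N]"
proof -
  obtain g where g: "g \<in> G" "\<And>i. i < N \<Longrightarrow> g (e i) = e (xs ! i)" using R_elem[OF x] by blast
  obtain ys where y: "R ys" "\<And>i. i < N \<Longrightarrow> inv' g (e i) = e (ys ! i)" using R_of[OF inv[OF g(1)]] by blast
  have "ys ! (xs ! i) = i" if i: "i < N" for i
  proof -
    have "e (ys ! (xs ! i)) = e i"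
      using y(2)[OF R_nth[OF x i]] g(2)[OF i] inv_apply(1)[OF g(1), of "e i"] by simp
    then show ?thesis using e_inj[OF R_nth[OF y(1) R_nth[OF x i]] i] by simp
  qed
  moreover have "xs ! (ys ! i) = i" if i: "i < N" for i
  proof -
    have "e (xs ! (ys ! i)) = e i"
      using g(2)[OF R_nth[OF y(1) i]] y(2)[OF i] inv_apply(2)[OF g(1), of "e i"] by simp
    then show ?thesis using e_inj[OF R_nth[OF x R_nth[OF y(1) i]] i] by simp
  qed
  ultimately have "cmp ys xs = [0..<N]" "cmp xs ys = [0..<N]"
    using R_length[OF x] R_length[OF y(1)] by (auto simp: cmp_def intro!: nth_equalityI)
  then show ?thesis using that y(1) by blast
qed

lemma multitrans_R:
  assumes mt: "multitrans t G \<Omega>" and ks: "distinct ks" "set ks \<subseteq> {..<N}" "length ks = t"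
    and js: "distinct js" "set js \<subseteq> {..<N}" "length js = t"
  obtains xs where "R xs" "map (\<lambda>i. xs ! i) ks = js"
proof -
  have d: "distinct (map e ls)" "set (map e ls) \<subseteq> \<Omega>" if "distinct ls" "set ls \<subseteq> {..<N}" for ls
    using that e_inj e_in by (auto simp: distinct_map inj_on_def subset_iff)
  obtain g where g: "g \<in> G" "map g (map e ks) = map e js"
    using mt d[OF ks(1,2)] d[OF js(1,2)] ks(3) js(3) unfolding multitrans_def by (metis length_map)
  obtain xs where x: "R xs" "\<And>i. i < N \<Longrightarrow> g (e i) = e (xs ! i)" using R_of[OF g(1)] by blast
  have "xs ! (ks ! k) = js ! k" if k: "k < t" for k
  proof -
    have lt: "ks ! k < N" "js ! k < N" using ks js k by (simp_all add: nth_less)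
    have "map g (map e ks) ! k = map e js ! k" using g(2) by simp
    then have "e (xs ! (ks ! k)) = e (js ! k)" using x(2)[OF lt(1)] k ks(3) js(3) by simp
    then show ?thesis using e_inj[OF R_nth[OF x(1) lt(1)] lt(2)] by simp
  qed
  then have "map (\<lambda>i. xs ! i) ks = js" using ks js by (auto intro!: nth_equalityI)
  then show ?thesis using that x(1) by blast
qed

end

lemma inv_eqI: "\<sigma> permutes S \<Longrightarrow> \<sigma> y = x \<Longrightarrow> inv' \<sigma> x = y"
  using permutes_inverses(2) by metis

text \<open>Covers a group on all n = q + 1 points as well as one on q + 1 points with one further
  fixed point, n = q + 2. Labels count from 0 and points from 1, so \<open>lift_pl\<close> shifts by
  one.\<close>

lemma perm_conj_by_lists:
  assumes rep: "list_rep G \<Omega> e (Suc q)" and \<Omega>: "\<Omega> = {1..n} \<or> (\<exists>a\<in>{1..n}. \<Omega> = {1..n} - {a})"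
    and S1: "\<And>h. h \<in> S \<Longrightarrow> \<exists>f. h = lift_pl q f \<and> list_rep.R G e (Suc q) (map f [0..<Suc q])"
    and S2: "\<And>xs. list_rep.R G e (Suc q) xs \<Longrightarrow> \<exists>f. lift_pl q f \<in> S \<and> map f [0..<Suc q] = xs"
  shows "perm_conj n G S"
proof -
  interpret list_rep G \<Omega> e "Suc q" by (rule rep)
  obtain a where a: "{1..n} - \<Omega> \<subseteq> {a}" "card \<Omega> < n \<Longrightarrow> a \<in> {1..n} - \<Omega>" "\<Omega> \<subseteq> {1..n}"
  proof -
    show ?thesis using \<Omega>
    proof
      assume "\<Omega> = {1..n}"
      then show ?thesis using that[of 0] by simp
    next
      assume "\<exists>a\<in>{1..n}. \<Omega> = {1..n} - {a}"
      then obtain a where "a \<in> {1..n}" "\<Omega> = {1..n} - {a}" by blast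
      then show ?thesis using that[of a] by auto
    qed
  qed
  have cn: "n = Suc q \<or> (n = Suc (Suc q) \<and> a \<in> {1..n} - \<Omega>)"
  proof -
    have "card ({1..n} - \<Omega>) \<le> 1" using card_mono[OF _ a(1)] by simp
    moreover have "card ({1..n} - \<Omega>) = n - Suc q" using a(3) card_Omega fin by (simp add: card_Diff_subset)
    moreover have "Suc q \<le> n" using card_mono[OF _ a(3)] card_Omega by simp
    ultimately have "n = Suc q \<or> n = Suc (Suc q)" by linarith
    then show ?thesis using a(2) card_Omega by auto
  qed
  \<comment> \<open>The relabelling sends point p to the point with label p - 1 and, if n = q + 2,
    the extra point n to the fixed point a. If n = q + 1 the second branch never occurs.\<close>
  define \<sigma> where "\<sigma> p = (if 1 \<le> p \<and> p \<le> Suc q then e (p - 1) else if p \<in> {1..n} then a else p)" for p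
  have sub: "{1..Suc q} \<subseteq> {1..n}" using cn by auto
  have b1: "bij_betw \<sigma> {1..Suc q} \<Omega>"
  proof -
    have "bij_betw (\<lambda>p. p - 1) {1..Suc q} {..<Suc q}"
      by (rule bij_betw_byWitness[of _ Suc]) auto
    then have "bij_betw (e \<circ> (\<lambda>p. p - 1)) {1..Suc q} \<Omega>" using e_bij by (rule bij_betw_trans)
    then show ?thesis by (rule bij_betw_cong[THEN iffD1, rotated]) (simp add: \<sigma>_def)
  qed
  have bij: "bij_betw \<sigma> {1..n} {1..n}"
    using cn
  proof
    assume n: "n = Suc q"
    then have "\<Omega> = {1..n}" using a(3) card_Omega by (intro card_subset_eq) auto
    then show ?thesis using b1 n by simp
  next
    assume n: "n = Suc (Suc q) \<and> a \<in> {1..n} - \<Omega>"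
    have "bij_betw \<sigma> {Suc (Suc q)} {a}" using n by (simp add: bij_betw_def \<sigma>_def)
    then have "bij_betw \<sigma> ({1..Suc q} \<union> {Suc (Suc q)}) (\<Omega> \<union> {a})"
      using n by (intro bij_betw_combine[OF b1]) auto
    moreover have "{1..Suc q} \<union> {Suc (Suc q)} = {1..n}" using n by auto
    moreover have "\<Omega> \<union> {a} = {1..n}" using n a by auto
    ultimately show ?thesis by simp
  qed
  have sp: "\<sigma> permutes {1..n}"
    by (rule bij_imp_permutes[OF bij]) (use sub in \<open>auto simp: \<sigma>_def\<close>)
  have key: "g = \<sigma> \<circ> lift_pl q f \<circ> inv' \<sigma>"
    if g: "g \<in> G" and v: "\<And>i. i < Suc q \<Longrightarrow> g (e i) = e (f i)" and fl: "\<And>i. i < Suc q \<Longrightarrow> f i < Suc q" for g f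
  proof
    fix x
    show "g x = (\<sigma> \<circ> lift_pl q f \<circ> inv' \<sigma>) x"
    proof (cases "x \<in> \<Omega>")
      case True
      then obtain i where i: "i < Suc q" "x = e i" by (rule e_surj)
      have "\<sigma> (Suc i) = x" using i by (simp add: \<sigma>_def)
      then have "inv' \<sigma> x = Suc i" by (rule inv_eqI[OF sp])
      then show ?thesis using v[OF i(1)] fl[OF i(1)] i by (simp add: lift_pl_def \<sigma>_def)
    next
      case False
      have gx: "g x = x" using False perm[OF g] by (simp add: permutes_def)
      have "inv' \<sigma> x \<notin> {1..Suc q}"
      proof
        assume "inv' \<sigma> x \<in> {1..Suc q}"
        then have "\<sigma> (inv' \<sigma> x) \<in> \<Omega>" using b1 by (auto simp: bij_betw_def)
        then show False using False permutes_inverses(1)[OF sp] by simp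
      qed
      then have "lift_pl q f (inv' \<sigma> x) = inv' \<sigma> x" by (auto simp: lift_pl_def)
      then show ?thesis using gx permutes_inverses(1)[OF sp] by simp
    qed
  qed
  have "G = (\<lambda>h. \<sigma> \<circ> h \<circ> inv' \<sigma>) ` S"
  proof (intro subset_antisym subsetI)
    fix g assume g: "g \<in> G"
    obtain xs where x: "R xs" "\<And>i. i < Suc q \<Longrightarrow> g (e i) = e (xs ! i)" using R_of[OF g] by blast
    obtain f where f: "lift_pl q f \<in> S" "map f [0..<Suc q] = xs" using S2[OF x(1)] by blast
    have "f i = xs ! i" if "i < Suc q" for i using that unfolding f(2)[symmetric] by (simp del: upt_Suc)
    then have "g = \<sigma> \<circ> lift_pl q f \<circ> inv' \<sigma>" using x R_nth[OF x(1)] by (intro key[OF g]) auto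
    then show "g \<in> (\<lambda>h. \<sigma> \<circ> h \<circ> inv' \<sigma>) ` S" using f(1) by blast
  next
    fix g assume "g \<in> (\<lambda>h. \<sigma> \<circ> h \<circ> inv' \<sigma>) ` S"
    then obtain h where h: "h \<in> S" "g = \<sigma> \<circ> h \<circ> inv' \<sigma>" by blast
    obtain f where f: "h = lift_pl q f" "R (map f [0..<Suc q])" using S1[OF h(1)] by blast
    obtain k where k: "k \<in> G" "\<And>i. i < Suc q \<Longrightarrow> k (e i) = e (map f [0..<Suc q] ! i)" using R_elem[OF f(2)] by blast
    have fi: "map f [0..<Suc q] ! i = f i" if "i < Suc q" for i using that by (simp del: upt_Suc)
    have "k = \<sigma> \<circ> lift_pl q f \<circ> inv' \<sigma>"
      using k(2) fi R_nth[OF f(2)] by (intro key[OF k(1)]) auto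
    then show "g \<in> G" using k(1) h f(1) by simp
  qed
  then show ?thesis unfolding perm_conj_def using sp by blast
qed

text \<open>The predicates below are evaluated by the simplifier. Conditionals are simplified lazily, and passing
  constants rather than abstractions to the list predicates keeps the intermediate terms small.\<close>

fun every :: "('a \<Rightarrow> bool) \<Rightarrow> 'a list \<Rightarrow> bool" where
  "every P [] = True"
| "every P (x # xs) = (if P x then every P xs else False)"

lemma every_iff: "every P xs \<longleftrightarrow> (\<forall>x\<in>set xs. P x)"
  by (induction xs) auto

fun some_3_cycle :: "nat list list \<Rightarrow> nat list list \<Rightarrow> bool" where
  "some_3_cycle gs [] = False"
| "some_3_cycle gs (w # ws) = (if moved (wp gs w) = 3 then True else some_3_cycle gs ws)"

lemma some_3_cycle_iff: "some_3_cycle gs ws \<longleftrightarrow> (\<exists>w\<in>set ws. moved (wp gs w) = 3)"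
  by (induction ws) auto

section \<open>Certificates for degree 7\<close>

text \<open>The lists of words below come from a computer search: in every relevant case one of the words is a
  3-cycle, or has a power moving at most five points.\<close>

definition cyc7 :: "nat list" where "cyc7 = [1, 2, 3, 4, 5, 6, 0]"

definition words7 :: "nat list list" where
  "words7 = [[0, 1, 1, 1, 1], [0, 0, 0, 0, 1, 1, 0, 1], [0, 0, 1, 1, 0, 0, 1, 1], [0, 0, 0, 1, 0, 0, 1], [0, 0, 1, 1, 1, 0, 1, 0, 1], [0, 0, 0, 1, 1, 1, 1, 0, 1]]"

text \<open>The candidates are the 5-cycles fixing labels 0 and 1 and sending 2 to 3; together with
  \<open>cyc7\<close> each must produce a 3-cycle. This shape is reached by a conjugation and by
  taking a power.\<close>

definition test7 :: "nat list \<Rightarrow> bool" where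
  "test7 p \<longleftrightarrow> (if pw 5 (0 # 1 # 3 # p) = [0, 1, 2, 3, 4, 5, 6]
     then if moved (0 # 1 # 3 # p) = 5 then some_3_cycle [cyc7, 0 # 1 # 3 # p] words7 else True else True)"

lemma check_degree_7: "every test7 (perms [2, 4, 5, 6])"
  by code_simp

section \<open>Certificates for degree 6: the projective line over the field with 5 elements\<close>

definition cyc5 :: "nat list" where "cyc5 = [1, 2, 3, 4, 0, 5]"

definition words6 :: "nat list list" where
  "words6 = [[1], [0, 1, 0, 1], [0, 0, 1, 1], [0, 1, 1, 1], [0, 0, 1, 1, 1, 0, 1], [0, 0, 1, 0, 1, 1, 1], [0, 0, 0, 1, 1], [0, 1, 1], [0, 0, 0, 1, 0, 1, 1], [1, 1], [0, 0, 1, 0, 1, 1], [0, 0, 1, 0, 0, 1], [0, 0, 0, 1, 1, 0, 0, 1], [0, 0, 1, 1, 0, 1], [0, 0, 0, 1, 0, 1, 0, 0, 1], [0, 0, 0, 1, 0, 0, 1, 0, 1]]"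

text \<open>The matching {0,5}, {1,2}, {3,4}, consisting of the orbits of x \<mapsto> 2 / x on the
  projective line with 5 as infinity.\<close>

definition mate :: "nat \<Rightarrow> nat" where "mate i = [5, 2, 1, 4, 3, 0] ! i"

text \<open>The list is an arbitrary permutation carrying the matching {0,5}, {1,4}, {2,3} to the
  one encoded by \<open>mate\<close>. The guard discards x, y, z whose list would repeat an
  entry.\<close>

definition test6 :: "nat \<Rightarrow> nat \<Rightarrow> nat \<Rightarrow> bool" where
  "test6 x y z \<longleftrightarrow> (if x = y \<or> mate x = y \<or> x = z \<or> mate x = z \<or> y = z \<or> mate y = z then True
     else some_3_cycle [cyc5, [x, y, z, mate z, mate y, mate x]] words6)"

definition test6a :: "nat \<Rightarrow> nat \<Rightarrow> bool" where
  "test6a x y \<longleftrightarrow> every (test6 x y) [0, 1, 2, 3, 4, 5]"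

definition test6b :: "nat \<Rightarrow> bool" where
  "test6b x \<longleftrightarrow> every (test6a x) [0, 1, 2, 3, 4, 5]"

lemma check_matchings: "every test6b [0, 1, 2, 3, 4, 5]"
  by code_simp

definition L5 :: "nat \<Rightarrow> nat \<Rightarrow> nat \<Rightarrow> nat \<Rightarrow> nat list" where
  "L5 a b c d = map (mobius f5_add f5_mul f5_inv 5 a b c d) [0, 1, 2, 3, 4, 5]"

definition words5 :: "nat list list" where
  "words5 = [[0, 0, 0, 1, 0, 1], [1], [0, 1, 0, 1], [0, 0, 1], [0, 1, 1], [0, 0, 1, 1], [1, 1]]"

definition affine5 :: "nat list \<Rightarrow> bool" where
  "affine5 xs \<longleftrightarrow> (if xs = L5 1 0 0 1 then True else if xs = L5 2 0 0 1 then True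
     else if xs = L5 3 0 0 1 then True else xs = L5 4 0 0 1)"

text \<open>Among permutations fixing 0 and 5, only the multiplications x \<mapsto> a x can coexist
  with x \<mapsto> x + 1 without producing a 3-cycle.\<close>

definition test5 :: "nat list \<Rightarrow> bool" where
  "test5 p \<longleftrightarrow> (if affine5 (0 # p @ [5]) then True else some_3_cycle [cyc5, 0 # p @ [5]] words5)"

lemma check_affine: "every test5 (perms [1, 2, 3, 4])"
  by code_simp

definition shift5 :: "nat \<Rightarrow> nat \<Rightarrow> bool" where
  "shift5 a b \<longleftrightarrow> L5 a b 0 1 = cmp (pw b cyc5) (L5 a 0 0 1)"

definition shift5a :: "nat \<Rightarrow> bool" where
  "shift5a a \<longleftrightarrow> every (shift5 a) [0, 1, 2, 3, 4]"

lemma check_shift5: "every shift5a [1, 2, 3, 4]"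
  by code_simp

lemma check_multipliers:
  "pw 2 (L5 2 0 0 1) = L5 4 0 0 1" "pw 3 (L5 2 0 0 1) = L5 3 0 0 1"
  "pw 2 (L5 3 0 0 1) = L5 4 0 0 1" "pw 3 (L5 3 0 0 1) = L5 2 0 0 1" "L5 1 0 0 1 = [0, 1, 2, 3, 4, 5]"
  by code_simp+

text \<open>These three lists are x \<mapsto> -1 / x, x \<mapsto> 1 / x and x \<mapsto> -x. Their
  determinants are 1 or -1, squares modulo 5, so all lie in PSL(2,5).\<close>

definition inv5 :: "nat list" where "inv5 = [5, 4, 2, 3, 1, 0]"
definition inv5a :: "nat list" where "inv5a = [5, 1, 3, 2, 4, 0]"
definition neg5 :: "nat list" where "neg5 = [0, 4, 3, 2, 1, 5]"

text \<open>The triples in the PSL(2,5)-orbit of (infinity, 0, 1): the translates of it and of (0, 1, 3).\<close>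

definition triple :: "nat \<Rightarrow> nat \<Rightarrow> nat \<Rightarrow> bool" where
  "triple a b c \<longleftrightarrow>
     (if a = 5 then b = cyc5 ! c \<or> c = cyc5 ! b
      else if b = 5 then a = cyc5 ! c \<or> c = cyc5 ! a
      else if c = 5 then a = cyc5 ! b \<or> b = cyc5 ! a
      else (b = cyc5 ! a \<and> c = cyc5 ! (cyc5 ! b)) \<or> (a = cyc5 ! b \<and> c = cyc5 ! (cyc5 ! a)) \<or>
        (c = cyc5 ! a \<and> b = cyc5 ! (cyc5 ! c)) \<or> (a = cyc5 ! c \<and> b = cyc5 ! (cyc5 ! a)) \<or>
        (b = cyc5 ! c \<and> a = cyc5 ! (cyc5 ! b)) \<or> (c = cyc5 ! b \<and> a = cyc5 ! (cyc5 ! c)))"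

text \<open>Five sample triples of the orbit are enough: among permutations fixing or exchanging 0
  and 5, they leave only elements of PSL(2,5).\<close>

definition preserving :: "nat list \<Rightarrow> bool" where
  "preserving xs \<longleftrightarrow> (if triple (xs ! 5) (xs ! 0) (xs ! 1) then if triple (xs ! 5) (xs ! 1) (xs ! 2) then
     if triple (xs ! 5) (xs ! 2) (xs ! 3) then if triple (xs ! 5) (xs ! 3) (xs ! 4) then
     triple (xs ! 0) (xs ! 1) (xs ! 3) else False else False else False else False)"

definition test_fix :: "nat list \<Rightarrow> bool" where
  "test_fix p \<longleftrightarrow> (if preserving (0 # p @ [5]) then 0 # p @ [5] = [0, 1, 2, 3, 4, 5] \<or> 0 # p @ [5] = neg5 else True)"

definition test_swap :: "nat list \<Rightarrow> bool" where
  "test_swap p \<longleftrightarrow> (if preserving (5 # p @ [0]) then 5 # p @ [0] = inv5 \<or> 5 # p @ [0] = inv5a else True)"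

lemma check_stabilizer: "every test_fix (perms [1, 2, 3, 4])" "every test_swap (perms [1, 2, 3, 4])"
  by code_simp+

lemma check_inv5:
  "wp [cyc5, inv5] [0, 0, 1, 0, 0, 0, 1, 0, 0, 1] = neg5"
  "wp [cyc5, inv5a] [0, 1, 0, 0, 0, 0, 1, 0] = inv5"
  "wp [cyc5, inv5a] [0, 1, 0, 0, 0, 0, 1, 0, 1] = neg5"
  "cmp inv5 inv5 = [0, 1, 2, 3, 4, 5]"
  by code_simp+

definition sgn5 :: "nat \<Rightarrow> nat list" where
  "sgn5 s = (if s = 1 then [0, 1, 2, 3, 4, 5] else neg5)"

definition lower5 :: "nat \<Rightarrow> nat \<Rightarrow> bool" where
  "lower5 s i \<longleftrightarrow> cmp (pw i cyc5) (sgn5 s) = L5 s i 0 1"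

text \<open>The Bruhat normal form: i - 1 / (s x + k) equals (s i x + i k - 1) / (s x + k), with -1
  written as 4.\<close>

definition upper5 :: "nat \<Rightarrow> nat \<Rightarrow> nat \<Rightarrow> bool" where
  "upper5 s i k \<longleftrightarrow> cmp (pw i cyc5) (cmp inv5 (cmp (pw k cyc5) (sgn5 s))) = L5 (s * i mod 5) ((i * k + 4) mod 5) s k"

definition lower5a :: "nat \<Rightarrow> bool" where "lower5a s \<longleftrightarrow> every (lower5 s) [0, 1, 2, 3, 4]"
definition upper5a :: "nat \<Rightarrow> nat \<Rightarrow> bool" where "upper5a s i \<longleftrightarrow> every (upper5 s i) [0, 1, 2, 3, 4]"
definition upper5b :: "nat \<Rightarrow> bool" where "upper5b s \<longleftrightarrow> every (upper5a s) [0, 1, 2, 3, 4]"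

lemma check_normal_form5: "every lower5a [1, 4]" "every upper5b [1, 4]"
  by code_simp+

text \<open>x \<mapsto> (a x + b) / (c x + d) in terms of the generators: a shift after a sign change if c = 0, and
  a / c + v (s x + s d / c) with v y = - 1 / y and s = c^2 / (a d - b c) otherwise.\<close>

definition member5 :: "nat \<Rightarrow> nat \<Rightarrow> nat \<Rightarrow> nat \<Rightarrow> bool" where
  "member5 a b c d \<longleftrightarrow> (let t = (a * d + 4 * (b * c)) mod 5 in
     if t = 1 \<or> t = 4 then
       if c = 0 then L5 a b c d = cmp (pw (b * f5_inv d mod 5) cyc5) (sgn5 (a * f5_inv d mod 5))
       else let s = c * c * f5_inv t mod 5 in
         L5 a b c d = cmp (pw (a * f5_inv c mod 5) cyc5) (cmp inv5 (cmp (pw (s * d * f5_inv c mod 5) cyc5) (sgn5 s)))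
     else True)"

definition member5a :: "nat \<Rightarrow> nat \<Rightarrow> nat \<Rightarrow> bool" where "member5a a b c \<longleftrightarrow> every (member5 a b c) [0, 1, 2, 3, 4]"
definition member5b :: "nat \<Rightarrow> nat \<Rightarrow> bool" where "member5b a b \<longleftrightarrow> every (member5a a b) [0, 1, 2, 3, 4]"
definition member5c :: "nat \<Rightarrow> bool" where "member5c a \<longleftrightarrow> every (member5b a) [0, 1, 2, 3, 4]"

lemma check_members5: "every member5c [0, 1, 2, 3, 4]"
  by code_simp

section \<open>Certificates for degree 9: the projective line over the field with 8 elements\<close>

definition add8 :: "nat \<Rightarrow> nat \<Rightarrow> nat" where
  "add8 a b = (if a = 0 then [0, 1, 2, 3, 4, 5, 6, 7] ! b
     else if a = 1 then [1, 0, 3, 2, 5, 4, 7, 6] ! b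
     else if a = 2 then [2, 3, 0, 1, 6, 7, 4, 5] ! b
     else if a = 3 then [3, 2, 1, 0, 7, 6, 5, 4] ! b
     else if a = 4 then [4, 5, 6, 7, 0, 1, 2, 3] ! b
     else if a = 5 then [5, 4, 7, 6, 1, 0, 3, 2] ! b
     else if a = 6 then [6, 7, 4, 5, 2, 3, 0, 1] ! b
     else [7, 6, 5, 4, 3, 2, 1, 0] ! b)"

definition mul8 :: "nat \<Rightarrow> nat \<Rightarrow> nat" where
  "mul8 a b = (if a = 0 then [0, 0, 0, 0, 0, 0, 0, 0] ! b
     else if a = 1 then [0, 1, 2, 3, 4, 5, 6, 7] ! b
     else if a = 2 then [0, 2, 4, 6, 3, 1, 7, 5] ! b
     else if a = 3 then [0, 3, 6, 5, 7, 4, 1, 2] ! b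
     else if a = 4 then [0, 4, 3, 7, 6, 2, 5, 1] ! b
     else if a = 5 then [0, 5, 1, 4, 2, 7, 3, 6] ! b
     else if a = 6 then [0, 6, 7, 1, 5, 3, 2, 4] ! b
     else [0, 7, 5, 2, 1, 6, 4, 3] ! b)"

definition inv8 :: "nat \<Rightarrow> nat" where
  "inv8 a = [0, 1, 5, 6, 7, 2, 3, 4] ! a"

text \<open>Lookup tables replace the bit operations in all later evaluations; this check ties them
  to the field operations.\<close>

definition table8 :: "nat \<Rightarrow> nat \<Rightarrow> bool" where
  "table8 a b \<longleftrightarrow> f8_add a b = add8 a b \<and> f8_mul a b = mul8 a b \<and> add8 a b < 8 \<and> mul8 a b < 8"

definition table8a :: "nat \<Rightarrow> bool" where
  "table8a a \<longleftrightarrow> every (table8 a) [0, 1, 2, 3, 4, 5, 6, 7] \<and> f8_inv a = inv8 a \<and> inv8 a < 8"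

lemma check_tables: "every table8a [0, 1, 2, 3, 4, 5, 6, 7]"
  by code_simp

lemma check_frob: "map f8_frob [0, 1, 2, 3, 4, 5, 6, 7, 8] = [0, 1, 4, 5, 6, 7, 2, 3, 8]"
  by code_simp

definition L8 :: "nat \<Rightarrow> nat \<Rightarrow> nat \<Rightarrow> nat \<Rightarrow> nat list" where
  "L8 a b c d = map (mobius add8 mul8 inv8 8 a b c d) [0, 1, 2, 3, 4, 5, 6, 7, 8]"

text \<open>Row j is multiplication by 2^j in the field, where the code 2 is the root of x^3 + x + 1
  and generates the multiplicative group. Both 0 and infinity are fixed.\<close>

definition pow9 :: "nat list list" where
  "pow9 = [[0, 1, 2, 3, 4, 5, 6, 7, 8],
    [0, 2, 4, 6, 3, 1, 7, 5, 8],
    [0, 4, 3, 7, 6, 2, 5, 1, 8],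
    [0, 3, 6, 5, 7, 4, 1, 2, 8],
    [0, 6, 7, 1, 5, 3, 2, 4, 8],
    [0, 7, 5, 2, 1, 6, 4, 3, 8],
    [0, 5, 1, 4, 2, 7, 3, 6, 8]]"

text \<open>The map x \<mapsto> 1 + 1 / x, which permutes 0, infinity and 1 cyclically.\<close>

definition g9 :: "nat list" where "g9 = [8, 0, 4, 7, 6, 3, 2, 5, 1]"
definition frob9 :: "nat list" where "frob9 = [0, 1, 4, 5, 6, 7, 2, 3, 8]"
text \<open>Inversion of the nonzero field elements with 0 and infinity both fixed, so not a Moebius
  map. Conjugation by it replaces the generator of the multiplicative group by its inverse.\<close>

definition invert9 :: "nat list" where "invert9 = [0, 1, 5, 6, 7, 2, 3, 4, 8]"

text \<open>Words in which each occurrence of g is preceded by a power of the 7-cycle; only the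
  exponents are recorded.\<close>

fun ew :: "nat list \<Rightarrow> nat list \<Rightarrow> nat list" where
  "ew g [] = [0, 1, 2, 3, 4, 5, 6, 7, 8]"
| "ew g (e # es) = cmp (pow9 ! e) (cmp g (ew g es))"

definition words9 :: "nat list list" where
  "words9 = [[0, 0, 0], [0, 1, 6], [0, 2, 5], [0, 4, 3], [1, 2, 4, 3], [3, 6, 6]]"

text \<open>The candidates with no such word extend to PSL(2,8) or P\<Gamma>L(2,8), or to the copies of these groups obtained by
  replacing the field generator by its inverse.\<close>

definition good9 :: "nat list list" where
  "good9 = [[8, 0, 4, 7, 6, 3, 2, 5, 1], [8, 0, 6, 3, 2, 5, 4, 7, 1], [8, 0, 2, 5, 4, 7, 6, 3, 1]]"

definition good9a :: "nat list list" where
  "good9a = [[8, 0, 6, 5, 2, 7, 4, 3, 1], [8, 0, 2, 7, 4, 3, 6, 5, 1], [8, 0, 4, 3, 6, 5, 2, 7, 1]]"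

text \<open>Five is the largest m with 2 m \<le> 9 + 1, the bound under which a homogeneous group of
  degree 9 turns a support into a 3-cycle.\<close>

definition small :: "nat list \<Rightarrow> bool" where
  "small xs \<longleftrightarrow> (let m = moved xs in if m = 0 then False else m \<le> 5)"

definition small_power :: "nat list \<Rightarrow> bool" where
  "small_power r \<longleftrightarrow> (if small r then True else if small (cmp r r) then True else small (cmp r (cmp r r)))"

fun some_small :: "nat list \<Rightarrow> nat list list \<Rightarrow> bool" where
  "some_small g [] = False"
| "some_small g (w # ws) = (if small_power (ew g w) then True else some_small g ws)"

lemma some_small_iff: "some_small g ws \<longleftrightarrow> (\<exists>w\<in>set ws. small_power (ew g w))"
  by (induction ws) auto

fun memb :: "nat list \<Rightarrow> nat list list \<Rightarrow> bool" where
  "memb x [] = False"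
| "memb x (y # ys) = (if x = y then True else memb x ys)"

lemma memb_iff: "memb x ys \<longleftrightarrow> x \<in> set ys"
  by (induction ys) auto

definition test9 :: "nat list \<Rightarrow> bool" where
  "test9 p \<longleftrightarrow> (if some_small (8 # 0 # p @ [1]) words9 then True
     else if memb (8 # 0 # p @ [1]) good9 then True else memb (8 # 0 # p @ [1]) good9a)"

definition insertions :: "nat \<Rightarrow> nat list \<Rightarrow> nat list list" where
  "insertions x ys = map (\<lambda>i. take i ys @ x # drop i ys) [0..<Suc (length ys)]"

text \<open>The 720 arrangements of 2, ..., 7 are generated in stages, inserting 3 and then 2 into
  the arrangements of 4, ..., 7.\<close>

definition test9a :: "nat list \<Rightarrow> bool" where "test9a p \<longleftrightarrow> every test9 (insertions 2 p)"
definition test9b :: "nat list \<Rightarrow> bool" where "test9b p \<longleftrightarrow> every test9a (insertions 3 p)"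

lemma check_degree_9: "every test9b (perms [4, 5, 6, 7])"
  by code_simp

text \<open>The two families cannot coexist: \<open>g9\<close> together with any member of
  \<open>good9a\<close> yields a nontrivial element with small support.\<close>

lemma check_separate9:
  "small (wp [pow9 ! 1, g9, good9a ! 0] [1, 2])"
  "small (wp [pow9 ! 1, g9, good9a ! 1] [1, 1, 2])"
  "small (wp [pow9 ! 1, g9, good9a ! 2] [1, 1, 2])"
  by code_simp+

lemma check_words9:
  "good9 ! 0 = g9" "good9 ! 1 = cmp g9 frob9" "good9 ! 2 = cmp g9 (cmp frob9 frob9)"
  "wp [pow9 ! 1, good9 ! 1] [0, 0, 1, 0, 1, 0, 0, 1, 0, 1, 0, 1, 0, 1] = g9"
  "wp [pow9 ! 1, good9 ! 2] [0, 1, 0, 1, 0, 1, 0, 0, 1, 0, 1, 0, 0, 1] = g9"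
  "wp [pow9 ! 1, g9] [0, 0, 1, 0, 0, 0, 1, 1, 0] = L8 1 1 0 1"
  "wp [pow9 ! 1, g9] [0, 0, 1, 0, 0, 0, 1, 1, 0, 1] = L8 0 1 1 0"
  "cmp (cmp frob9 frob9) (cmp frob9 frob9) = frob9"
  "cmp invert9 (cmp (pow9 ! 6) invert9) = pow9 ! 1"
  "memb (cmp invert9 (cmp (good9a ! 0) invert9)) good9"
  "memb (cmp invert9 (cmp (good9a ! 1) invert9)) good9"
  "memb (cmp invert9 (cmp (good9a ! 2) invert9)) good9"
  by code_simp+

text \<open>The discrete logarithm to the base 2, with the value 0 at 0 as a filler.\<close>

definition log8 :: "nat \<Rightarrow> nat" where "log8 a = [0, 0, 1, 3, 2, 6, 4, 5] ! a"

text \<open>Translation by a is translation by 1 conjugated by multiplication by a, so one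
  translation and the powers of the 7-cycle give all.\<close>

definition scale8 :: "nat \<Rightarrow> bool" where
  "scale8 a \<longleftrightarrow> L8 a 0 0 1 = pow9 ! log8 a \<and> L8 1 a 0 1 = cmp (pow9 ! log8 a) (cmp (L8 1 1 0 1) (pow9 ! log8 (inv8 a)))"

lemma check_scale8: "every scale8 [1, 2, 3, 4, 5, 6, 7]" "L8 1 0 0 1 = [0, 1, 2, 3, 4, 5, 6, 7, 8]"
  by code_simp+

text \<open>For c \<noteq> 0 the map is a / c + (t / c^2) / (x + d / c) with t the determinant:
  translation, inversion, scaling, translation. Signs disappear in characteristic 2.\<close>

definition member8 :: "nat \<Rightarrow> nat \<Rightarrow> nat \<Rightarrow> nat \<Rightarrow> bool" where
  "member8 a b c d \<longleftrightarrow> (let t = add8 (mul8 a d) (mul8 b c) in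
     if t = 0 then True
     else if c = 0 then L8 a b c d = cmp (L8 1 (mul8 b (inv8 d)) 0 1) (L8 (mul8 a (inv8 d)) 0 0 1)
     else L8 a b c d = cmp (L8 1 (mul8 a (inv8 c)) 0 1)
       (cmp (L8 (mul8 t (mul8 (inv8 c) (inv8 c))) 0 0 1) (cmp (L8 0 1 1 0) (L8 1 (mul8 d (inv8 c)) 0 1))))"

text \<open>Only bottom rows (0, 1) and (1, d) are checked; every other matrix is a scalar multiple
  of one of these.\<close>

definition member8a :: "nat \<Rightarrow> nat \<Rightarrow> bool" where
  "member8a a b \<longleftrightarrow> member8 a b 0 1 \<and> every (member8 a b 1) [0, 1, 2, 3, 4, 5, 6, 7]"
definition member8b :: "nat \<Rightarrow> bool" where "member8b a \<longleftrightarrow> every (member8a a) [0, 1, 2, 3, 4, 5, 6, 7]"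

lemma check_members8: "every member8b [0, 1, 2, 3, 4, 5, 6, 7]"
  by code_simp

text \<open>The identities that make a common factor l cancel from the coefficients of a Moebius map
  and come out of the determinant as l^2.\<close>

definition scaling8 :: "nat \<Rightarrow> nat \<Rightarrow> nat \<Rightarrow> bool" where
  "scaling8 l u v \<longleftrightarrow> mul8 (mul8 l u) v = mul8 l (mul8 u v) \<and> add8 (mul8 l u) (mul8 l v) = mul8 l (add8 u v) \<and>
     mul8 (mul8 l u) (mul8 l v) = mul8 (mul8 l l) (mul8 u v) \<and>
     mul8 (mul8 l u) (inv8 (mul8 l v)) = mul8 u (inv8 v)"
definition scaling8a :: "nat \<Rightarrow> nat \<Rightarrow> bool" where
  "scaling8a l u \<longleftrightarrow> mul8 l u \<noteq> 0 \<and> every (scaling8 l u) [0, 1, 2, 3, 4, 5, 6, 7]"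
definition scaling8b :: "nat \<Rightarrow> bool" where
  "scaling8b l \<longleftrightarrow> every (scaling8 l 0) [0, 1, 2, 3, 4, 5, 6, 7] \<and> mul8 l 0 = 0 \<and> mul8 l (inv8 l) = 1 \<and>
     mul8 (inv8 l) l = 1 \<and> inv8 l \<noteq> 0 \<and> every (scaling8a l) [1, 2, 3, 4, 5, 6, 7]"

lemma check_scaling8: "every scaling8b [1, 2, 3, 4, 5, 6, 7]"
  by code_simp

text \<open>Solving for the map taking 0, 1 and infinity to p, q and r.\<close>

definition coeffs8 :: "nat \<Rightarrow> nat \<Rightarrow> nat \<Rightarrow> nat \<times> nat \<times> nat \<times> nat" where
  "coeffs8 p q r = (if r = 8 then (add8 q p, p, 0, 1) else if p = 8 then (r, add8 q r, 1, 0)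
     else if q = 8 then (r, p, 1, 1)
     else let d = mul8 (add8 q r) (inv8 (add8 p q)) in (r, mul8 p d, 1, d))"

definition interpolates8 :: "nat \<Rightarrow> nat \<Rightarrow> nat \<Rightarrow> bool" where
  "interpolates8 p q r \<longleftrightarrow> (if p = q \<or> p = r \<or> q = r then True else
     (case coeffs8 p q r of (a, b, c, d) \<Rightarrow> a < 8 \<and> b < 8 \<and> c < 8 \<and> d < 8 \<and>
       add8 (mul8 a d) (mul8 b c) \<noteq> 0 \<and> (let L = L8 a b c d in L ! 0 = p \<and> L ! 1 = q \<and> L ! 8 = r)))"

definition interpolates8a :: "nat \<Rightarrow> nat \<Rightarrow> bool" where
  "interpolates8a p q \<longleftrightarrow> every (interpolates8 p q) [0, 1, 2, 3, 4, 5, 6, 7, 8]"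
definition interpolates8b :: "nat \<Rightarrow> bool" where
  "interpolates8b p \<longleftrightarrow> every (interpolates8a p) [0, 1, 2, 3, 4, 5, 6, 7, 8]"

lemma check_interpolation8: "every interpolates8b [0, 1, 2, 3, 4, 5, 6, 7, 8]"
  by code_simp

section \<open>Uniform partitions\<close>

lemma two_elements:
  assumes "2 \<le> card S"
  obtains x y where "x \<in> S" "y \<in> S" "x \<noteq> y"
proof -
  obtain T where T: "T \<subseteq> S" "card T = 2" by (rule obtain_subset_with_card_n[OF assms])
  then obtain x y where "T = {x, y}" "x \<noteq> y" by (meson card_2_iff)
  then show ?thesis using that[of x y] T(1) by simp
qed

lemma transpose_image_exchange:
  assumes "x \<in> S" "y \<notin> S"
  shows "transpose x y ` S = insert y (S - {x})"
proof -
  have "transpose x y ` (S - {x}) = S - {x}" using assms by (intro transpose_image_eq) simp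
  moreover have "transpose x y ` insert x (S - {x}) = insert y (transpose x y ` (S - {x}))"
    by (simp only: image_insert transpose_apply_first)
  ultimately show ?thesis using assms(1) by (simp only: insert_Diff)
qed

lemma sym_multitrans:
  assumes "finite \<Omega>"
  shows "multitrans t {p. p permutes \<Omega>} \<Omega>"
proof -
  have "\<exists>p. p permutes \<Omega> \<and> map p xs = ys"
    if "length xs = length ys" "distinct xs" "distinct ys" "set xs \<subseteq> \<Omega>" "set ys \<subseteq> \<Omega>" for xs ys
    using that
  proof (induction xs ys rule: list_induct2)
    case Nil
    show ?case by (rule exI[of _ id], rule conjI, rule permutes_id, rule list.map(1))
  next
    case (Cons x xs y ys)
    then obtain p where p: "p permutes \<Omega>" "map p xs = ys" by auto
    let ?q = "transpose (p x) y \<circ> p"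
    have px: "p x \<in> \<Omega>" using Cons.prems permutes_in_image[OF p(1), of x] by simp
    then have "transpose (p x) y permutes \<Omega>" using Cons.prems by (intro permutes_swap_id) auto
    then have q: "?q permutes \<Omega>" by (rule permutes_compose[OF p(1)])
    have "?q w = p w" if w: "w \<in> set xs" for w
    proof -
      have "p w \<noteq> p x" using w Cons.prems permutes_inj[OF p(1)] by (auto simp: inj_eq)
      moreover have "p w \<in> set ys" using w p(2) by auto
      then have "p w \<noteq> y" using Cons.prems by auto
      ultimately show ?thesis by (simp add: transpose_def)
    qed
    then have "map ?q xs = map p xs" by (intro map_cong refl)
    then have "map ?q (x # xs) = y # ys" using p(2) by (simp add: transpose_def)
    then show ?case using q by (intro exI[of _ ?q] conjI)
  qed
  then show ?thesis unfolding multitrans_def by (metis mem_Collect_eq)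
qed

lemma subgroup_perm_group:
  assumes "subgroup G (sym_group n)"
  shows "perm_group G {1..n}"
proof -
  interpret subgroup G "sym_group n" by (rule assms)
  have c: "g permutes {1..n}" if "g \<in> G" for g
    using that subset sym_group_carrier by blast
  show ?thesis
  proof
    show "id \<in> G" using one_closed by (simp add: sym_group_one)
    show "g \<circ> h \<in> G" if "g \<in> G" "h \<in> G" for g h
      using m_closed[OF that] by (simp add: sym_group_mult)
    show "inv' g \<in> G" if "g \<in> G" for g
    proof -
      have "g \<in> carrier (sym_group n)" using that subset by blast
      then have "inv\<^bsub>sym_group n\<^esub> g = inv' g" by (rule sym_group_inv_equality)
      then show ?thesis using m_inv_closed[OF that] by simp
    qed
  qed (use c in auto)
qed

lemma ordered_partition_finite:
  assumes "ordered_partition_type n k A" "i < n div k"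
  shows "finite (A i)"
proof (rule finite_subset)
  show "A i \<subseteq> {1..n}" using assms unfolding ordered_partition_type_def by blast
qed simp

definition upartitions :: "nat \<Rightarrow> nat \<Rightarrow> nat set set set" where
  "upartitions n k = {A ` {..<n div k} | A. ordered_partition_type n k A}"

lemma upartitions_parts:
  assumes "P \<in> upartitions n k"
  shows "finite P" "\<And>S. S \<in> P \<Longrightarrow> S \<subseteq> {1..n}" "\<And>S. S \<in> P \<Longrightarrow> card S = k"
    "\<And>S T. S \<in> P \<Longrightarrow> T \<in> P \<Longrightarrow> S \<noteq> T \<Longrightarrow> S \<inter> T = {}" "\<Union>P = {1..n}"
proof -
  obtain A where A: "ordered_partition_type n k A" "P = A ` {..<n div k}"
    using assms by (auto simp: upartitions_def)
  show "finite P" using A by simp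
  show "\<And>S. S \<in> P \<Longrightarrow> S \<subseteq> {1..n}" "\<And>S. S \<in> P \<Longrightarrow> card S = k"
    using A unfolding ordered_partition_type_def by auto
  show "S \<inter> T = {}" if ST: "S \<in> P" "T \<in> P" "S \<noteq> T" for S T
  proof -
    obtain i j where "i < n div k" "j < n div k" "S = A i" "T = A j" using ST(1,2) A by auto
    then show ?thesis using A ST(3) unfolding ordered_partition_type_def by metis
  qed
  show "\<Union>P = {1..n}" using A unfolding ordered_partition_type_def by simp
qed

lemma finite_upartitions: "finite (upartitions n k)"
proof (rule finite_subset)
  show "upartitions n k \<subseteq> Pow (Pow {1..n})" using upartitions_parts(2) by blast
qed simp

lemma ordered_partition_image:
  assumes A: "ordered_partition_type n k A" and s: "\<sigma> permutes {1..n}"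
  shows "ordered_partition_type n k (\<lambda>i. \<sigma> ` A i)"
proof -
  have i: "inj \<sigma>" using s permutes_inj by blast
  have im: "\<sigma> ` {1..n} = {1..n}" using s permutes_image by blast
  have "\<sigma> ` A i \<subseteq> {1..n} \<and> card (\<sigma> ` A i) = k" if "i < n div k" for i
  proof
    have "A i \<subseteq> {1..n}" using A that unfolding ordered_partition_type_def by simp
    then have "\<sigma> ` A i \<subseteq> \<sigma> ` {1..n}" by (rule image_mono)
    then show "\<sigma> ` A i \<subseteq> {1..n}" unfolding im .
    show "card (\<sigma> ` A i) = k" using A that i unfolding ordered_partition_type_def
      by (simp add: card_image inj_on_subset[OF i])
  qed
  moreover have "\<sigma> ` A i \<inter> \<sigma> ` A j = {}" if "i < n div k" "j < n div k" "i \<noteq> j" for i j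
    using A that unfolding ordered_partition_type_def by (simp add: image_Int[OF i, symmetric])
  moreover have "(\<Union>i<n div k. \<sigma> ` A i) = {1..n}"
    using A im unfolding ordered_partition_type_def by (simp add: image_UN[symmetric])
  ultimately show ?thesis unfolding ordered_partition_type_def by simp
qed

lemma ordered_partition_standard:
  assumes k: "k > 0" and d: "k dvd n"
  shows "ordered_partition_type n k (\<lambda>i. {i * k + 1..i * k + k})"
proof -
  obtain m where m: "n = m * k" using d by (metis dvdE mult.commute)
  have md: "n div k = m" using m k by simp
  have le: "i * k + k \<le> n" if "i < m" for i
  proof -
    have "(i + 1) * k \<le> m * k" using that by (intro mult_le_mono1) simp
    then show ?thesis using m by simp
  qed
  have disj: "{i * k + 1..i * k + k} \<inter> {j * k + 1..j * k + k} = {}" if "i < j" for i j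
  proof -
    have "(i + 1) * k \<le> j * k" using that by (intro mult_le_mono1) simp
    then show ?thesis by auto
  qed
  have cover: "x \<in> (\<Union>i<m. {i * k + 1..i * k + k})" if "x \<in> {1..n}" for x
  proof -
    let ?i = "(x - 1) div k"
    have "x - 1 < m * k" using that m by auto
    then have "?i < m" using k by (simp add: div_less_iff_less_mult)
    moreover have "x \<in> {?i * k + 1..?i * k + k}"
      using div_mult_mod_eq[of "x - 1" k] mod_less_divisor[OF k, of "x - 1"] that
      unfolding atLeastAtMost_iff by linarith
    ultimately show ?thesis by blast
  qed
  have "(\<Union>i<m. {i * k + 1..i * k + k}) = {1..n}"
  proof (intro subset_antisym subsetI)
    fix x assume "x \<in> (\<Union>i<m. {i * k + 1..i * k + k})"
    then show "x \<in> {1..n}" using le by fastforce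
  qed (rule cover)
  moreover have "{i * k + 1..i * k + k} \<inter> {j * k + 1..j * k + k} = {}" if "i \<noteq> j" for i j
    using disj[of i j] disj[of j i] that by (cases "i < j") auto
  ultimately show ?thesis unfolding ordered_partition_type_def md using le by fastforce
qed

lemma ordered_partition_inj:
  assumes A: "ordered_partition_type n k A" and k: "k > 0"
  shows "inj_on A {..<n div k}"
proof (rule inj_onI)
  fix i j assume ij: "i \<in> {..<n div k}" "j \<in> {..<n div k}" "A i = A j"
  show "i = j"
  proof (rule ccontr)
    assume "i \<noteq> j"
    then have "A i \<inter> A j = {}" using A ij(1,2) unfolding ordered_partition_type_def by simp
    then have "A i = {}" using ij(3) by simp
    moreover have "card (A i) = k" using A ij(1) unfolding ordered_partition_type_def by simp
    ultimately show False using k by simp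
  qed
qed

lemma ordered_partition_transfer:
  assumes A: "ordered_partition_type n k A" and B: "ordered_partition_type n k B" and k: "k > 0"
  shows "\<exists>\<sigma>. \<sigma> permutes {1..n} \<and> (\<forall>i<n div k. \<sigma> ` A i = B i)"
proof -
  let ?I = "{..<n div k}"
  have "\<exists>h. bij_betw h (A i) (B i)" if "i \<in> ?I" for i
  proof (rule finite_same_card_bij)
    show "finite (A i)" "finite (B i)"
      using ordered_partition_finite[OF A] ordered_partition_finite[OF B] that by auto
    show "card (A i) = card (B i)" using A B that unfolding ordered_partition_type_def by auto
  qed
  then obtain h where h: "\<And>i. i \<in> ?I \<Longrightarrow> bij_betw (h i) (A i) (B i)" by metis
  define idx where "idx x = (THE i. i \<in> ?I \<and> x \<in> A i)" for x
  have idx: "idx x = i" if "i \<in> ?I" "x \<in> A i" for i x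
    unfolding idx_def
  proof (rule the_equality)
    show "j = i" if "j \<in> ?I \<and> x \<in> A j" for j
      using A that \<open>i \<in> ?I\<close> \<open>x \<in> A i\<close> unfolding ordered_partition_type_def by blast
  qed (use that in auto)
  define \<sigma> where "\<sigma> x = (if x \<in> {1..n} then h (idx x) x else x)" for x
  have sub: "A i \<subseteq> {1..n}" if "i \<in> ?I" for i using A that unfolding ordered_partition_type_def by auto
  have bi: "bij_betw \<sigma> (A i) (B i)" if "i \<in> ?I" for i
  proof -
    have "\<sigma> x = h i x" if "x \<in> A i" for x
      using idx[OF \<open>i \<in> ?I\<close> that] sub[OF \<open>i \<in> ?I\<close>] that unfolding \<sigma>_def by auto
    then show ?thesis using h[OF that] bij_betw_cong[of "A i" \<sigma> "h i"] by simp
  qed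
  have "bij_betw \<sigma> (\<Union>i\<in>?I. A i) (\<Union>i\<in>?I. B i)"
    by (rule bij_betw_UNION_disjoint)
      (use B bi in \<open>auto simp: ordered_partition_type_def disjoint_family_on_def\<close>)
  then have "bij_betw \<sigma> {1..n} {1..n}" using A B unfolding ordered_partition_type_def by simp
  then have "\<sigma> permutes {1..n}" by (rule bij_imp_permutes) (auto simp: \<sigma>_def)
  moreover have "\<sigma> ` A i = B i" if "i < n div k" for i using bi[of i] that by (auto simp: bij_betw_def)
  ultimately show ?thesis by blast
qed

section \<open>Groups homogeneous on uniform partitions with at least two parts\<close>

locale lambda_group = perm_group G "{1..n}" for G :: "(nat \<Rightarrow> nat) set" and n :: nat +
  fixes k :: nat
  assumes k2: "k \<ge> 2" and dvd: "k dvd n" and m2: "n div k \<ge> 2" and hom: "lambda_homogeneous n k G"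
begin

lemma n_eq: "n = n div k * k"
  using dvd by simp

lemma n_ge: "n \<ge> 2 * k"
proof -
  have "2 * k \<le> n div k * k" using m2 by (rule mult_le_mono1)
  then show ?thesis using n_eq by simp
qed

lemma homogeneous:
  assumes A: "ordered_partition_type n k A" and B: "ordered_partition_type n k B"
  obtains g where "g \<in> G" "(\<lambda>i. g ` A i) ` {..<n div k} = B ` {..<n div k}"
  using hom[unfolded lambda_homogeneous_def, rule_format, OF A B] by (rule bexE)

text \<open>For an invariant W, the sum of |W \<inter> A i|^2 over the parts is the same for all
  uniform partitions. Exchanging single points between two parts that both meet W and its complement
  changes this sum.\<close>

lemma medium_sets_not_invariant:
  assumes W: "W \<subseteq> {1..n}" and inv: "\<And>g. g \<in> G \<Longrightarrow> g ` W = W"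
  shows "card W \<le> 1 \<or> n \<le> card W + 1"
proof (rule ccontr)
  assume "\<not> ?thesis"
  then have c: "card W \<ge> 2" "card W + 2 \<le> n" by auto
  let ?m = "n div k"
  have fW: "finite W" using W finite_subset by blast
  define f where "f A = (\<Sum>i<?m. (int (card (W \<inter> A i)))\<^sup>2)" for A :: "nat \<Rightarrow> nat set"
  have f_eq: "f A = (\<Sum>P\<in>A ` {..<?m}. (int (card (W \<inter> P)))\<^sup>2)" if "ordered_partition_type n k A" for A
    unfolding f_def using ordered_partition_inj[OF that] k2 by (simp add: sum.reindex)
  have f_const: "f A = f B" if A: "ordered_partition_type n k A" and B: "ordered_partition_type n k B" for A B
  proof -
    obtain g where g: "g \<in> G" "(\<lambda>i. g ` A i) ` {..<?m} = B ` {..<?m}"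
      by (rule homogeneous[OF A B])
    have "card (W \<inter> g ` A i) = card (W \<inter> A i)" for i
    proof -
      have "W \<inter> g ` A i = g ` (W \<inter> A i)" using inv[OF g(1)] inj[OF g(1)] by (simp add: image_Int)
      then show ?thesis using card_im[OF g(1)] by simp
    qed
    then have "f A = f (\<lambda>i. g ` A i)" unfolding f_def by simp
    also have "\<dots> = f B"
      using f_eq[OF ordered_partition_image[OF A perm[OF g(1)]]] f_eq[OF B] g(2) by simp
    finally show ?thesis .
  qed
  obtain o1 o2 where o: "o1 \<in> W" "o2 \<in> W" "o1 \<noteq> o2"
    by (rule two_elements[OF c(1)])
  have "card ({1..n} - W) \<ge> 2" using c W fW by (simp add: card_Diff_subset)
  then obtain u1 u2 where u: "u1 \<in> {1..n} - W" "u2 \<in> {1..n} - W" "u1 \<noteq> u2"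
    by (rule two_elements)
  have ne: "o1 \<noteq> u1" "o1 \<noteq> u2" "u1 \<noteq> o2" "o2 \<noteq> u2" "o1 \<in> {1..n}" "o2 \<in> {1..n}" using o u W by auto
  \<comment> \<open>A part of the standard partition is an interval of length k \<ge> 2: the first
    contains 1 and 2, the second k + 1 and k + 2. So parts 0 and 1 each receive one point of W and
    one point outside.\<close>
  have "\<exists>\<sigma>\<in>{p. p permutes {1..n}}. map \<sigma> [1, 2, k + 1, k + 2] = [o1, u1, o2, u2]"
    by (rule sym_multitrans[of "{1..n}" 4, unfolded multitrans_def, rule_format])
      (use o(3) u ne k2 n_ge in auto)
  then obtain \<sigma> where s: "\<sigma> permutes {1..n}" "\<sigma> 1 = o1" "\<sigma> 2 = u1" "\<sigma> (k + 1) = o2" "\<sigma> (k + 2) = u2"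
    by auto
  define A where "A = (\<lambda>i. \<sigma> ` {i * k + 1..i * k + k})"
  have A: "ordered_partition_type n k A" unfolding A_def
    using ordered_partition_image[OF ordered_partition_standard s(1)] dvd k2 by simp
  have A0: "o1 \<in> A 0" "u1 \<in> A 0" and A1: "o2 \<in> A 1" "u2 \<in> A 1"
    unfolding A_def using s k2 by (auto intro: rev_image_eqI[of 1] rev_image_eqI[of 2] rev_image_eqI[of "k + 1"] rev_image_eqI[of "k + 2"])
  have disj: "A i \<inter> A j = {}" if "i < ?m" "j < ?m" "i \<noteq> j" for i j
    using A that unfolding ordered_partition_type_def by blast
  have fA: "finite (A i)" if "i < ?m" for i
    using ordered_partition_finite[OF A that] .
  have m01: "0 < ?m" "1 < ?m" using m2 by auto
  have split: "f B = (int (card (W \<inter> B 0)))\<^sup>2 + ((int (card (W \<inter> B 1)))\<^sup>2 + (\<Sum>i\<in>{..<?m} - {0} - {1}. (int (card (W \<inter> B i)))\<^sup>2))" for B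
    unfolding f_def using m01 by (subst sum.remove[of _ 0], simp, simp, subst sum.remove[of _ 1]) auto
  have rest: "transpose x y ` A i = A i" if "x \<in> A 0" "y \<in> A 1" "i \<in> {..<?m} - {0} - {1}" for x y i
  proof -
    have "x \<notin> A i" "y \<notin> A i" using disj[of 0 i] disj[of 1 i] that m01 by auto
    then show ?thesis by (simp add: transpose_image_eq)
  qed
  have val: "f (\<lambda>i. transpose x y ` A i) =
      (int (card (W \<inter> transpose x y ` A 0)))\<^sup>2 + ((int (card (W \<inter> transpose x y ` A 1)))\<^sup>2 +
      (\<Sum>i\<in>{..<?m} - {0} - {1}. (int (card (W \<inter> A i)))\<^sup>2))" if "x \<in> A 0" "y \<in> A 1" for x y
    unfolding split[of "\<lambda>i. transpose x y ` A i"] using rest[OF that] by simp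
  have img: "transpose x y ` A 0 = insert y (A 0 - {x})" "transpose x y ` A 1 = insert x (A 1 - {y})"
    if "x \<in> A 0" "y \<in> A 1" for x y
    using transpose_image_exchange[of x "A 0" y] transpose_image_exchange[of y "A 1" x] that disj[OF m01]
    by (auto simp: transpose_commute)
  let ?a = "card (W \<inter> A 0)" and ?b = "card (W \<inter> A 1)"
  have tp: "ordered_partition_type n k (\<lambda>i. transpose x y ` A i)" if "x \<in> {1..n}" "y \<in> {1..n}" for x y
    using ordered_partition_image[OF A permutes_swap_id[OF that]] .
  have in1: "o1 \<in> {1..n}" "o2 \<in> {1..n}" "u1 \<in> {1..n}" "u2 \<in> {1..n}" using o u W by auto
  have b1: "?b \<ge> 1" "?a \<ge> 1"
    using o A0 A1 fW card_gt_0_iff[of "W \<inter> A 0"] card_gt_0_iff[of "W \<inter> A 1"] by force+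
  have no: "o2 \<notin> A 0" "o1 \<notin> A 1" using disj[OF m01] A0 A1 by auto
  have "W \<inter> insert o2 (A 0 - {u1}) = insert o2 (W \<inter> A 0)" using o u by auto
  then have c1: "card (W \<inter> transpose u1 o2 ` A 0) = ?a + 1"
    using img(1)[OF A0(2) A1(1)] no fW by simp
  have "W \<inter> insert u1 (A 1 - {o2}) = W \<inter> A 1 - {o2}" using o u by auto
  then have c2: "card (W \<inter> transpose u1 o2 ` A 1) = ?b - 1"
    using img(2)[OF A0(2) A1(1)] o A1 fW by simp
  have "W \<inter> insert u2 (A 0 - {o1}) = W \<inter> A 0 - {o1}" using o u by auto
  then have c3: "card (W \<inter> transpose o1 u2 ` A 0) = ?a - 1"
    using img(1)[OF A0(1) A1(2)] o A0 fW by simp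
  have "W \<inter> insert o1 (A 1 - {u2}) = insert o1 (W \<inter> A 1)" using o u by auto
  then have c4: "card (W \<inter> transpose o1 u2 ` A 1) = ?b + 1"
    using img(2)[OF A0(1) A1(2)] no fW by simp
  have e1: "f A = f (\<lambda>i. transpose u1 o2 ` A i)" by (rule f_const[OF A tp]) (use in1 in auto)
  have e2: "f A = f (\<lambda>i. transpose o1 u2 ` A i)" by (rule f_const[OF A tp]) (use in1 in auto)
  \<comment> \<open>One exchange moves a point of W into part 0, the other moves one out of it. The
    first equation says a - b = -1, the second a - b = 1.\<close>
  have "(int ?a)\<^sup>2 + (int ?b)\<^sup>2 = (int ?a + 1)\<^sup>2 + (int ?b - 1)\<^sup>2"
    using e1 split[of A] val[OF A0(2) A1(1)] c1 c2 b1 by (simp add: of_nat_diff)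
  moreover have "(int ?a)\<^sup>2 + (int ?b)\<^sup>2 = (int ?a - 1)\<^sup>2 + (int ?b + 1)\<^sup>2"
    using e2 split[of A] val[OF A0(1) A1(2)] c3 c4 b1 by (simp add: of_nat_diff)
  ultimately show False by (simp add: power2_eq_square algebra_simps)
qed

text \<open>Every orbit has size 1 or at least n - 1, and two disjoint orbits of the latter size do
  not fit since n \<ge> 4. So an intransitive G fixes some a. A second fixed point u is impossible,
  as {a, u} would be an invariant set of medium size.\<close>

lemma transitive_or_fixed_point:
  "transitive G {1..n} \<or> (\<exists>a\<in>{1..n}. (\<forall>g\<in>G. g a = a) \<and> transitive G ({1..n} - {a}))"
proof (cases "transitive G {1..n}")
  case False
  define Q where "Q x = (\<lambda>g. g x) ` G" for x
  have Qsub: "Q x \<subseteq> {1..n}" if "x \<in> {1..n}" for x using that closed unfolding Q_def by blast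
  have Qself: "x \<in> Q x" for x unfolding Q_def using one by (metis id_apply imageI)
  have Qinv: "g ` Q x = Q x" if g: "g \<in> G" for g x
  proof (intro subset_antisym subsetI)
    fix y assume "y \<in> g ` Q x"
    then obtain h where "h \<in> G" "y = g (h x)" unfolding Q_def by auto
    then show "y \<in> Q x" unfolding Q_def using comp[OF g] by (metis comp_apply imageI)
  next
    fix y assume "y \<in> Q x"
    then obtain h where h: "h \<in> G" "y = h x" unfolding Q_def by auto
    then have "inv' g y \<in> Q x" unfolding Q_def using comp[OF inv[OF g] h(1)] by (metis comp_apply imageI)
    then show "y \<in> g ` Q x" using g by (simp add: mem_image)
  qed
  have dich: "card (Q x) = 1 \<or> n \<le> card (Q x) + 1" if "x \<in> {1..n}" for x
  proof -
    have "card (Q x) \<noteq> 0" using Qself[of x] finite_G by (auto simp: Q_def)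
    then show ?thesis using medium_sets_not_invariant[OF Qsub[OF that] Qinv] by fastforce
  qed
  obtain x y where xy': "x \<in> {1..n}" "y \<in> {1..n}" "\<forall>g\<in>G. g x \<noteq> y"
    using False unfolding transitive_def by blast
  then have xy: "x \<in> {1..n}" "y \<in> {1..n}" "y \<notin> Q x" unfolding Q_def by auto
  have fixedI: "\<forall>g\<in>G. g a = a" if ca: "card (Q a) = 1" for a
  proof -
    obtain b where "Q a = {b}" using ca by (auto simp: card_1_singleton_iff)
    then have Qa: "Q a = {a}" using Qself[of a] by auto
    show ?thesis
    proof
      fix g assume "g \<in> G"
      then have "g a \<in> Q a" unfolding Q_def by blast
      then show "g a = a" using Qa by simp
    qed
  qed
  have "\<exists>a\<in>{1..n}. card (Q a) = 1"
  proof (rule ccontr)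
    assume "\<not> ?thesis"
    then have "n \<le> card (Q x) + 1" "n \<le> card (Q y) + 1" using dich xy by auto
    moreover have "Q x \<inter> Q y = {}"
    proof (rule ccontr)
      assume "Q x \<inter> Q y \<noteq> {}"
      then obtain g h where gh: "g \<in> G" "h \<in> G" "g x = h y" unfolding Q_def by auto
      then have "(inv' h \<circ> g) x = y" using inv_apply(1)[OF gh(2)] by simp
      then have "y \<in> Q x" unfolding Q_def using comp[OF inv[OF gh(2)] gh(1)] by blast
      then show False using xy by simp
    qed
    then have "card (Q x \<union> Q y) = card (Q x) + card (Q y)"
      using finite_G by (intro card_Un_disjoint) (auto simp: Q_def)
    moreover have "card (Q x \<union> Q y) \<le> card {1..n}" using Qsub xy by (intro card_mono) auto
    ultimately show False using n_ge k2 by simp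
  qed
  then obtain a where a: "a \<in> {1..n}" "card (Q a) = 1" by blast
  have "transitive G ({1..n} - {a})" unfolding transitive_def
  proof (intro ballI)
    fix u v assume u: "u \<in> {1..n} - {a}" and v: "v \<in> {1..n} - {a}"
    have an: "a \<notin> Q u"
    proof
      assume "a \<in> Q u"
      then obtain g where g: "g \<in> G" "a = g u" unfolding Q_def by auto
      then have "inv' g a = u" using inv_apply(1)[OF g(1)] by simp
      then have "u = a" using fixedI[OF a(2)] inv[OF g(1)] by auto
      then show False using u by simp
    qed
    have "card (Q u) \<noteq> 1"
    proof
      assume c: "card (Q u) = 1"
      have "g ` {a, u} = {a, u}" if "g \<in> G" for g
        using bspec[OF fixedI[OF a(2)] that] bspec[OF fixedI[OF c] that] by simp
      then have "card {a, u} \<le> 1 \<or> n \<le> card {a, u} + 1" using a u by (intro medium_sets_not_invariant) auto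
      then show False using u n_ge k2 by auto
    qed
    then have "n \<le> card (Q u) + 1" using dich u by blast
    moreover have "Q u \<subseteq> {1..n} - {a}" using Qsub[of u] u an by auto
    moreover have "card ({1..n} - {a}) = n - 1" using a by simp
    ultimately have "Q u = {1..n} - {a}" by (intro card_seteq) auto
    then have "v \<in> (\<lambda>g. g u) ` G" using v unfolding Q_def by simp
    then show "\<exists>g\<in>G. g u = v" by (auto simp: image_iff)
  qed
  then show ?thesis using a fixedI[OF a(2)] by blast
qed simp

text \<open>G is transitive on uniform partitions, so their number divides its order. The p-cycle on
  1, ..., p, which need not lie in G, fixes none of them, so p divides that number.\<close>

lemma prime_dvd_order:
  assumes p: "prime p" "k < p" "p \<le> n"
  shows "p dvd card G"
proof -
  have p2: "p \<ge> 2" using p prime_ge_2_nat by blast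
  define c :: "nat \<Rightarrow> nat" where "c x = (if 1 \<le> x \<and> x \<le> p then x mod p + 1 else x)" for x
  have cpow: "(c ^^ j) x = (x - 1 + j) mod p + 1" if "1 \<le> x" "x \<le> p" for x j
  proof (induction j)
    case (Suc j)
    let ?y = "(x - 1 + j) mod p + 1"
    have "?y \<le> p" using p2 Suc_leI[OF mod_less_divisor[of p "x - 1 + j"]] by simp
    then have "c ?y = ?y mod p + 1" by (simp add: c_def)
    then show ?case using Suc by (simp add: mod_Suc_eq)
  qed (use that p2 in \<open>simp add: mod_less\<close>)
  have cp: "c ^^ p = id"
  proof
    fix x show "(c ^^ p) x = id x"
    proof (cases "1 \<le> x \<and> x \<le> p")
      case True
      then have c: "(c ^^ p) x = (x - 1 + p) mod p + 1" using cpow by blast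
      have "(x - 1 + p) mod p = (x - 1) mod p" by (rule mod_add_self2)
      also have "\<dots> = x - 1" by (rule mod_less) (use True p2 in linarith)
      finally have e: "(x - 1 + p) mod p = x - 1" .
      show ?thesis unfolding c e using True by simp
    next
      case False
      have "(c ^^ j) x = x" for j by (induction j) (use False in \<open>auto simp: c_def\<close>)
      then show ?thesis by simp
    qed
  qed
  have inv: "c \<circ> c ^^ (p - 1) = id" "c ^^ (p - 1) \<circ> c = id"
    using cp p2 by (metis Suc_diff_1 funpow.simps(2) gr_zeroI not_numeral_le_zero, metis Suc_diff_1 funpow_Suc_right gr_zeroI not_numeral_le_zero)
  have cbij: "bij c" using inv by (intro o_bij[of "c ^^ (p - 1)"]) auto
  have cperm: "c permutes {1..n}"
  proof (rule permutes_superset)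
    show "c permutes UNIV" using cbij by (simp add: permutes_univ bij_iff)
    show "c x = x" if "x \<in> UNIV - {1..n}" for x using that p by (auto simp: c_def)
  qed
  have sc: "supp c = {1..p}"
  proof (intro subset_antisym subsetI)
    fix x assume "x \<in> {1..p}"
    then have x: "1 \<le> x" "x \<le> p" by auto
    have "c x \<noteq> x"
    proof (cases "x = p")
      case True
      then show ?thesis using p2 by (simp add: c_def)
    next
      case False
      then show ?thesis using x by (simp add: c_def)
    qed
    then show "x \<in> supp c" by (simp add: supp_def)
  qed (auto simp: supp_def c_def split: if_splits)
  let ?X = "upartitions n k"
  define act :: "(nat \<Rightarrow> nat) \<Rightarrow> nat set set \<Rightarrow> nat set set" where "act g P = (\<lambda>S. g ` S) ` P" for g P
  have act: "act (g \<circ> h) P = act g (act h P)" "act id P = P" for g h P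
    by (simp_all add: act_def image_image)
  have actX: "act g P \<in> ?X" if P: "P \<in> ?X" and g: "g permutes {1..n}" for P g
  proof -
    obtain A where A: "ordered_partition_type n k A" "P = A ` {..<n div k}" using P by (auto simp: upartitions_def)
    then have "act g P = (\<lambda>i. g ` A i) ` {..<n div k}" by (simp add: act_def image_image)
    then show ?thesis using ordered_partition_image[OF A(1) g] unfolding upartitions_def by blast
  qed
  let ?A0 = "\<lambda>i. {i * k + 1..i * k + k}"
  let ?P0 = "?A0 ` {..<n div k}"
  have oA0: "ordered_partition_type n k ?A0" using ordered_partition_standard dvd k2 by simp
  have orb: "(\<lambda>g. act g ?P0) ` G = ?X"
  proof (intro subset_antisym subsetI)
    fix P assume "P \<in> (\<lambda>g. act g ?P0) ` G"
    then obtain g where "g \<in> G" "P = act g ?P0" by auto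
    moreover have "?P0 \<in> ?X" using oA0 unfolding upartitions_def by blast
    ultimately show "P \<in> ?X" using actX perm by blast
  next
    fix P assume "P \<in> ?X"
    then obtain B where B: "ordered_partition_type n k B" "P = B ` {..<n div k}" by (auto simp: upartitions_def)
    obtain g where g: "g \<in> G" "(\<lambda>i. g ` ?A0 i) ` {..<n div k} = B ` {..<n div k}"
      by (rule homogeneous[OF oA0 B(1)])
    have "act g ?P0 = (\<lambda>i. g ` ?A0 i) ` {..<n div k}" unfolding act_def by (rule image_image)
    then have "act g ?P0 = P" using g B by simp
    then show "P \<in> (\<lambda>g. act g ?P0) ` G" using g by blast
  qed
  have cG: "card G = card ?X * card {g \<in> G. act g ?P0 = ?P0}"
    using orbit_stabilizer[of act ?P0, OF act(1) act(2)] orb by simp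
  \<comment> \<open>The moved parts of a fixed partition number a multiple of p and lie inside the
    support, of size p; as k \<ge> 2, there are none. Then the part containing 1 contains 1, ..., p,
    more than its k elements.\<close>
  have nofix: "act c P \<noteq> P" if P: "P \<in> ?X" for P
  proof
    assume fixP: "act c P = P"
    note PP = upartitions_parts[OF P]
    have cS: "c ` S \<in> P" if "S \<in> P" for S using fixP that unfolding act_def by blast
    have cpowS: "((\<lambda>S. c ` S) ^^ j) S = (c ^^ j) ` S" for j and S :: "nat set"
      by (induction j) (simp_all add: image_comp)
    let ?M = "{S \<in> P. c ` S \<noteq> S}"
    have "p dvd card ?M"
    proof (rule prime_dvd_card_moved[OF p(1) PP(1)])
      show "(\<lambda>S. c ` S) ` P \<subseteq> P" using cS by blast
      show "((\<lambda>S. c ` S) ^^ p) S = S" for S using cpowS[of p S] cp by simp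
    qed
    moreover have "card ?M * k \<le> p"
    proof -
      have Msub: "\<Union>?M \<subseteq> supp c"
      proof
        fix x assume "x \<in> \<Union>?M"
        then obtain S where S: "S \<in> P" "c ` S \<noteq> S" "x \<in> S" by blast
        then have "S \<inter> c ` S = {}" using PP(4) cS by metis
        then have "c x \<noteq> x" using S by (metis IntI empty_iff imageI)
        then show "x \<in> supp c" by (simp add: supp_def)
      qed
      have "card (\<Union>?M) = (\<Sum>S\<in>?M. card S)"
        by (rule card_Union_disjoint) (use PP in \<open>auto simp: pairwise_def disjnt_def intro: finite_subset\<close>)
      also have "\<dots> = (\<Sum>S\<in>?M. k)" by (rule sum.cong) (use PP in auto)
      finally have "card (\<Union>?M) = card ?M * k" by simp
      then show ?thesis using card_mono[OF _ Msub] sc by simp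
    qed
    ultimately have "card ?M = 0"
    proof -
      assume d: "p dvd card ?M" and l: "card ?M * k \<le> p"
      show "card ?M = 0"
      proof (rule ccontr)
        assume nz: "card ?M \<noteq> 0"
        then have "p \<le> card ?M" using d by (simp add: dvd_imp_le)
        then have "p * 2 \<le> card ?M * k" using k2 by (intro mult_le_mono)
        then show False using l p2 by simp
      qed
    qed
    then have allfix: "c ` S = S" if "S \<in> P" for S using that PP(1) by auto
    have "1 \<in> \<Union>P" using PP(5) p p2 by simp
    then obtain S where S: "S \<in> P" "1 \<in> S" by blast
    have pS: "(c ^^ j) 1 \<in> S" for j by (induction j) (use S allfix in auto)
    have "{1..p} \<subseteq> S"
    proof
      fix x assume x: "x \<in> {1..p}"
      have "(x - 1) mod p = x - 1" by (rule mod_less) (use x p2 in auto)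
      then have "(c ^^ (x - 1)) 1 = x" using cpow[of 1 "x - 1"] p2 x by simp
      then show "x \<in> S" using pS[of "x - 1"] by simp
    qed
    then have "p \<le> card S" using card_mono[of S "{1..p}"] PP(2)[OF S(1)] finite_subset by fastforce
    then show False using PP(3)[OF S(1)] p by simp
  qed
  have "p dvd card {P \<in> ?X. act c P \<noteq> P}"
  proof (rule prime_dvd_card_moved[OF p(1) finite_upartitions])
    show "act c ` ?X \<subseteq> ?X" using actX cperm by blast
    have "(act c ^^ j) P = act (c ^^ j) P" for j P
    proof (induction j)
      case 0
      show ?case using act(2)[of P] by (metis eq_id_iff funpow.simps(1))
    next
      case (Suc j)
      have "(act c ^^ Suc j) P = act c ((act c ^^ j) P)" by simp
      also have "\<dots> = act (c \<circ> c ^^ j) P" unfolding Suc by (rule act(1)[symmetric])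
      finally show ?case by (simp only: funpow.simps)
    qed
    then show "(act c ^^ p) P = P" for P using cp act(2) by simp
  qed
  moreover have "{P \<in> ?X. act c P \<noteq> P} = ?X" using nofix by blast
  ultimately show ?thesis using cG by simp
qed

end

section \<open>A form of Bertrand's postulate\<close>

lemma div_Suc_dvd: "Suc n div q = n div q + (if q dvd Suc n then 1 else 0)" if "q > 0" for n q :: nat
  using that by (auto simp: div_Suc dvd_eq_mod_eq_0)

text \<open>Legendre's formula. From n to n + 1, the term for i grows by one exactly when p^i
  divides n + 1, and the number of such i is the multiplicity of p in n + 1.\<close>

lemma legendre_fact:
  fixes p :: nat
  assumes p: "prime p" and N: "n < p ^ N"
  shows "multiplicity p (fact n) = (\<Sum>i = 1..N. n div p ^ i)"
  using N
proof (induction n)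
  case 0
  then show ?case by simp
next
  case (Suc n)
  have p1: "p > 1" using p prime_gt_1_nat by blast
  let ?v = "multiplicity p (Suc n)"
  have dv: "p ^ i dvd Suc n \<longleftrightarrow> i \<le> ?v" for i
    using p1 by (intro power_dvd_iff_le_multiplicity) auto
  have "p ^ ?v \<le> Suc n" by (intro dvd_imp_le multiplicity_dvd) simp
  also have "\<dots> < p ^ N" by (rule Suc.prems)
  finally have vN: "?v \<le> N" using p1 power_less_imp_less_exp[of p ?v N] by simp
  have "(\<Sum>i = 1..N. Suc n div p ^ i) = (\<Sum>i = 1..N. n div p ^ i + (if p ^ i dvd Suc n then 1 else 0))"
    using p1 by (intro sum.cong refl div_Suc_dvd) simp
  also have "\<dots> = (\<Sum>i = 1..N. n div p ^ i) + card {i \<in> {1..N}. i \<le> ?v}"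
    by (simp add: sum.distrib dv sum.If_cases Int_def)
  also have "{i \<in> {1..N}. i \<le> ?v} = {1..?v}" using vN by auto
  also have "(\<Sum>i = 1..N. n div p ^ i) = multiplicity p (fact n)" using Suc by simp
  also have "multiplicity p (fact n) + card {1..?v} = multiplicity p (fact (Suc n))"
    using p by (simp add: prime_elem_multiplicity_mult_distrib del: mult_Suc)
  finally show ?case by simp
qed

lemma multiplicity_central_binomial:
  fixes p :: nat
  assumes p: "prime p" and N: "2 * n < p ^ N"
  shows "multiplicity p ((2 * n) choose n) = (\<Sum>i = 1..N. (2 * n) div p ^ i - 2 * (n div p ^ i))"
proof -
  have "fact n * fact n * ((2 * n) choose n) = fact (2 * n)"
    using binomial_fact_lemma[of n "2 * n"] by (simp add: mult_2)
  then have "multiplicity p (fact n * fact n * ((2 * n) choose n)) = multiplicity p (fact (2 * n))"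
    by simp
  moreover have "multiplicity p (fact n * fact n * ((2 * n) choose n)) =
      2 * multiplicity p (fact n) + multiplicity p ((2 * n) choose n)"
    using p by (simp add: prime_elem_multiplicity_mult_distrib)
  ultimately have "multiplicity p ((2 * n) choose n) = (\<Sum>i = 1..N. (2 * n) div p ^ i) - 2 * (\<Sum>i = 1..N. n div p ^ i)"
    using legendre_fact[OF p, of n N] legendre_fact[OF p N] N by simp
  also have "\<dots> = (\<Sum>i = 1..N. (2 * n) div p ^ i - 2 * (n div p ^ i))"
  proof -
    have "2 * (n div q) \<le> (2 * n) div q" for q :: nat
      by (metis div_mult1_eq le_add1 mult.commute mult_2)
    then show ?thesis by (subst sum_subtractf_nat) (auto simp: sum_distrib_left)
  qed
  finally show ?thesis .
qed

text \<open>Each term of the multiplicity formula is at most 1 and vanishes once p^i > 2 n, so the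
  multiplicity is at most the number of i with p^i \<le> 2 n.\<close>

lemma central_binomial_prime_power_le:
  fixes p :: nat
  assumes p: "prime p" and n: "n > 0"
  shows "p ^ multiplicity p ((2 * n) choose n) \<le> 2 * n"
proof -
  have p1: "p > 1" using p prime_gt_1_nat by blast
  let ?N = "2 * n" and ?v = "multiplicity p ((2 * n) choose n)"
  have "2 * n < 2 ^ (2 * n)" by (rule less_exp)
  also have "\<dots> \<le> p ^ ?N" using p1 by (intro power_mono) auto
  finally have N: "2 * n < p ^ ?N" .
  have le1: "(2 * n) div q - 2 * (n div q) \<le> 1" for q :: nat
  proof (cases "q = 0")
    case False
    have "2 * n = q * (2 * (n div q)) + 2 * (n mod q)" by (metis distrib_left_numeral mult.left_commute mult_div_mod_eq)
    moreover have "2 * (n mod q) < 2 * q" using False by simp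
    ultimately have "2 * n < q * (2 * (n div q) + 2)" by (simp add: algebra_simps)
    then have "(2 * n) div q < 2 * (n div q) + 2" using False by (simp add: div_less_iff_less_mult mult.commute)
    then show ?thesis by simp
  qed simp
  have "?v = (\<Sum>i = 1..?N. (2 * n) div p ^ i - 2 * (n div p ^ i))"
    by (rule multiplicity_central_binomial[OF p N])
  also have "\<dots> = (\<Sum>i \<in> {i \<in> {1..?N}. p ^ i \<le> 2 * n}. (2 * n) div p ^ i - 2 * (n div p ^ i))"
  proof (rule sum.mono_neutral_right)
    show "\<forall>i\<in>{1..?N} - {i \<in> {1..?N}. p ^ i \<le> 2 * n}. (2 * n) div p ^ i - 2 * (n div p ^ i) = 0"
    proof
      fix i assume "i \<in> {1..?N} - {i \<in> {1..?N}. p ^ i \<le> 2 * n}"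
      then have "2 * n < p ^ i" by auto
      then have "(2 * n) div p ^ i = 0" by simp
      then show "(2 * n) div p ^ i - 2 * (n div p ^ i) = 0" by simp
    qed
  qed auto
  also have "\<dots> \<le> (\<Sum>i \<in> {i \<in> {1..?N}. p ^ i \<le> 2 * n}. 1)" by (intro sum_mono le1)
  finally have v: "?v \<le> card {i \<in> {1..?N}. p ^ i \<le> 2 * n}" by simp
  show ?thesis
  proof (rule ccontr)
    assume c: "\<not> ?thesis"
    have "{i \<in> {1..?N}. p ^ i \<le> 2 * n} \<subseteq> {1..<?v}"
    proof
      fix i assume i: "i \<in> {i \<in> {1..?N}. p ^ i \<le> 2 * n}"
      then have "p ^ i < p ^ ?v" using c by simp
      then have "i < ?v" using p1 power_less_imp_less_exp by blast
      then show "i \<in> {1..<?v}" using i by simp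
    qed
    then have "card {i \<in> {1..?N}. p ^ i \<le> 2 * n} \<le> card {1..<?v}" by (intro card_mono) auto
    then have "?v \<le> ?v - 1" using v by simp
    then have "?v = 0" by linarith
    then show False using c n by simp
  qed
qed

text \<open>The two floors are 2 and 1 and cancel, while p > 2 puts p^2 above 2 n.\<close>

lemma central_binomial_middle_prime:
  fixes p :: nat
  assumes p: "prime p" "p > 2" and n: "2 * n < 3 * p" "p \<le> n"
  shows "\<not> p dvd ((2 * n) choose n)"
proof -
  have "3 * p \<le> p * p" using p by (intro mult_le_mono1) simp
  with n(1) have "2 * n < p * p" by (rule less_le_trans)
  then have N: "2 * n < p ^ 2" by (simp add: power2_eq_square)
  have "(2 * n) div p = 2"
    by (rule div_nat_eqI) (use n in auto)
  moreover have "n div p = 1"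
    by (rule div_nat_eqI) (use n in auto)
  moreover have "(2 * n) div p ^ 2 = 0" using N by simp
  ultimately have "multiplicity p ((2 * n) choose n) = 0"
    using multiplicity_central_binomial[OF p(1) N] by (simp add: numeral_2_eq_2)
  then show ?thesis using p by (simp add: multiplicity_eq_zero_iff)
qed

lemma prod_primes_dvd:
  fixes X :: nat
  assumes "finite S" "\<And>p. p \<in> S \<Longrightarrow> prime p" "\<And>p. p \<in> S \<Longrightarrow> p dvd X"
  shows "\<Prod>S dvd X"
  using assms
proof (induction S)
  case (insert p S)
  have "coprime p (\<Prod>S)" using insert by (intro prod_coprime_right) (auto intro: primes_coprime)
  then show ?case using insert by (simp add: divides_mult)
qed simp

text \<open>For odd n = 2 m + 1, the primes above m + 1 divide the binomial coefficient of n over m.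
  It occurs twice in the row of sum 2^n and is therefore at most 4^m.\<close>

lemma primorial_le: "\<Prod>{p::nat. prime p \<and> p \<le> n} \<le> 4 ^ n"
proof (induction n rule: less_induct)
  case (less n)
  have fin: "finite {p::nat. prime p \<and> p \<le> k}" for k by (rule finite_subset[of _ "{..k}"]) auto
  show ?case
  proof (cases "n \<le> 2")
    case True
    then consider "n = 0" | "n = 1" | "n = 2" by linarith
    then show ?thesis
    proof cases
      case 3
      have "prime p \<and> p \<le> n \<longleftrightarrow> p = 2" for p :: nat
        using prime_ge_2_nat[of p] two_is_prime_nat 3 by (cases "p = 2") auto
      then have "{p::nat. prime p \<and> p \<le> n} = {2}" by simp
      then show ?thesis using 3 by simp
    next
      case 1
      have "\<not> (prime p \<and> p \<le> n)" for p :: nat using prime_gt_0_nat[of p] 1 by linarith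
      then have "{p::nat. prime p \<and> p \<le> n} = {}" by blast
      then show ?thesis by (simp only: prod.empty one_le_power)
    next
      case 2
      have "\<not> (prime p \<and> p \<le> n)" for p :: nat using prime_gt_1_nat[of p] 2 by linarith
      then have "{p::nat. prime p \<and> p \<le> n} = {}" by blast
      then show ?thesis by (simp only: prod.empty) simp
    qed
  next
    case False
    show ?thesis
    proof (cases "even n")
      case True
      have "\<not> prime n" using True False prime_odd_nat by fastforce
      then have "{p::nat. prime p \<and> p \<le> n} = {p. prime p \<and> p \<le> n - 1}"
        by (auto simp: le_eq_less_or_eq)
      then have "\<Prod>{p::nat. prime p \<and> p \<le> n} \<le> 4 ^ (n - 1)" using less[of "n - 1"] False by simp
      also have "\<dots> \<le> 4 ^ n" by (intro power_increasing) auto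
      finally show ?thesis .
    next
      case odd: False
      then obtain m where m: "n = 2 * m + 1" by (auto elim: oddE)
      have m1: "m \<ge> 1" using False m by simp
      let ?S = "{p::nat. prime p \<and> m + 1 < p \<and> p \<le> n}"
      let ?C = "(2 * m + 1) choose m"
      have finS: "finite ?S" by (rule finite_subset[OF _ fin[of n]]) auto
      have split: "{p::nat. prime p \<and> p \<le> n} = {p. prime p \<and> p \<le> m + 1} \<union> ?S" using m by auto
      have "\<Prod>{p::nat. prime p \<and> p \<le> n} = \<Prod>{p. prime p \<and> p \<le> m + 1} * \<Prod>?S"
        unfolding split by (rule prod.union_disjoint) (use fin finS in auto)
      also have "\<Prod>{p::nat. prime p \<and> p \<le> m + 1} \<le> 4 ^ (m + 1)" using less[of "m + 1"] m m1 by simp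
      also have "\<Prod>?S \<le> 4 ^ m"
      proof -
        have "p dvd ?C" if p: "p \<in> ?S" for p
        proof -
          have "fact m * fact (m + 1) * ?C = fact (2 * m + 1)"
            using binomial_fact_lemma[of m "2 * m + 1"] by simp
          moreover have "p dvd fact (2 * m + 1)" using p m prime_dvd_fact_iff[of p "2 * m + 1"] by blast
          ultimately have "p dvd fact m * fact (m + 1) * ?C" by simp
          then show ?thesis using p by (auto simp: prime_dvd_mult_iff prime_dvd_fact_iff simp del: fact_Suc)
        qed
        then have "\<Prod>?S dvd ?C" by (intro prod_primes_dvd finS) auto
        then have "\<Prod>?S \<le> ?C" by (rule dvd_imp_le) (simp add: zero_less_binomial)
        also have "2 * ?C \<le> 2 * 4 ^ m"
        proof -
          have "?C + ((2 * m + 1) choose (m + 1)) \<le> (\<Sum>k\<le>2 * m + 1. (2 * m + 1) choose k)"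
          proof -
            have "(\<Sum>k\<in>{m, m + 1}. (2 * m + 1) choose k) \<le> (\<Sum>k\<le>2 * m + 1. (2 * m + 1) choose k)"
              by (rule sum_mono2) auto
            then show ?thesis by simp
          qed
          also have "\<dots> = 2 ^ (2 * m + 1)" by (rule choose_row_sum)
          also have "(2 * m + 1) choose (m + 1) = ?C" using binomial_symmetric[of "m + 1" "2 * m + 1"] by simp
          finally show ?thesis by (simp add: power_mult)
        qed
        then have "?C \<le> 4 ^ m" by simp
        finally show ?thesis .
      qed
      finally have "\<Prod>{p::nat. prime p \<and> p \<le> n} \<le> 4 ^ (m + 1) * 4 ^ m" by (simp add: mult_le_mono)
      also have "(4::nat) ^ (m + 1) * 4 ^ m = 4 ^ n" unfolding m power_add[symmetric] by (simp add: mult_2)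
      finally show ?thesis .
    qed
  qed
qed

lemma bertrand_numeric: "i \<ge> 7 \<Longrightarrow> (i + 1) * (12 * 2 ^ i + 30) < (4::nat) ^ i"
proof (induction i rule: dec_induct)
  case (step i)
  have "(Suc i + 1) * (12 * 2 ^ Suc i + 30) \<le> (2 * (i + 1)) * (2 * (12 * 2 ^ i + 30))"
    by (intro mult_le_mono) auto
  also have "\<dots> = 4 * ((i + 1) * (12 * 2 ^ i + 30))" by simp
  also have "\<dots> < 4 * 4 ^ i" using step.IH by simp
  finally show ?case by simp
qed simp

text \<open>Erdos's proof with a margin of four. The prime factors of the central binomial
  coefficient are split at t and at n: those below t contribute at most 2 n each, those up to n a
  primorial of 2 n / 3, and those above n a bounded factor.\<close>

lemma prime_between_large:
  fixes n :: nat
  assumes n: "n \<ge> 8192"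
  shows "\<exists>p. prime p \<and> n < p \<and> p + 4 \<le> 2 * n"
proof (rule ccontr)
  assume no: "\<not> ?thesis"
  let ?C = "(2 * n) choose n"
  let ?PF = "prime_factors ?C"
  have C0: "?C > 0" by (simp add: zero_less_binomial)
  obtain i where i: "4 ^ i \<le> 2 * n" "2 * n < 4 ^ (i + 1)"
    using ex_power_ivl1[of 4 "2 * n"] n by auto
  \<comment> \<open>A power of two with t^2 > 2 n \<ge> t^2 / 4 stands in for the square root of 2
    n. The bound 8192 = 4^7 / 2 on n is what makes i \<ge> 7.\<close>
  define t :: nat where "t = 2 ^ (i + 1)"
  have "(4::nat) ^ 7 < 4 ^ (i + 1)" using n i(2) by simp
  then have "7 < i + 1" using power_less_imp_less_exp[of "4::nat" 7 "i + 1"] by simp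
  then have i7: "i \<ge> 7" by simp
  have tt: "t * t = 4 ^ (i + 1)" unfolding t_def by (simp add: power_mult_distrib[symmetric])
  have t2: "t > 2" unfolding t_def using i7 power_increasing[of 2 "i + 1" "2::nat"] by simp
  have pw: "p ^ multiplicity p ?C \<le> 2 * n" if "p \<in> ?PF" for p
    using that n by (intro central_binomial_prime_power_le) auto
  have mu1: "multiplicity p ?C \<ge> 1" if "p \<in> ?PF" for p
    using that C0 by (simp add: prime_factors_multiplicity)
  have ple: "p \<le> 2 * n" if "p \<in> ?PF" for p
  proof -
    have "p ^ 1 \<le> p ^ multiplicity p ?C"
      using mu1[OF that] that prime_ge_1_nat[of p] by (intro power_increasing) auto
    then show ?thesis using pw[OF that] by simp
  qed
  have big: "p ^ multiplicity p ?C = p" if p: "p \<in> ?PF" "t \<le> p" for p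
  proof -
    have "multiplicity p ?C < 2"
    proof (rule ccontr)
      assume "\<not> ?thesis"
      then have "p ^ 2 \<le> p ^ multiplicity p ?C"
        using p t2 by (intro power_increasing) auto
      then have "p * p \<le> 2 * n" using pw[OF p(1)] by (simp add: power2_eq_square)
      moreover have "t * t \<le> p * p" using p by (intro mult_le_mono) auto
      ultimately show False using tt i by simp
    qed
    then have "multiplicity p ?C = 1" using mu1[OF p(1)] by linarith
    then show ?thesis by simp
  qed
  define A where "A = {p \<in> ?PF. p < t}"
  define B where "B = {p \<in> ?PF. t \<le> p \<and> p \<le> n}"
  define D where "D = {p \<in> ?PF. t \<le> p \<and> n < p}"
  have fin: "finite A" "finite B" "finite D" unfolding A_def B_def D_def by auto
  have "?C = (\<Prod>p\<in>?PF. p ^ multiplicity p ?C)" by (rule prime_factorization_nat[OF C0])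
  also have "?PF = A \<union> (B \<union> D)" unfolding A_def B_def D_def by auto
  also have "(\<Prod>p\<in>A \<union> (B \<union> D). p ^ multiplicity p ?C) =
      (\<Prod>p\<in>A. p ^ multiplicity p ?C) * (\<Prod>p\<in>B \<union> D. p ^ multiplicity p ?C)"
    by (rule prod.union_disjoint) (use fin in \<open>auto simp: A_def B_def D_def\<close>)
  also have "(\<Prod>p\<in>B \<union> D. p ^ multiplicity p ?C) =
      (\<Prod>p\<in>B. p ^ multiplicity p ?C) * (\<Prod>p\<in>D. p ^ multiplicity p ?C)"
    by (rule prod.union_disjoint) (use fin in \<open>auto simp: A_def B_def D_def\<close>)
  also have "(\<Prod>p\<in>B. p ^ multiplicity p ?C) = \<Prod>B" by (rule prod.cong) (auto simp: B_def intro: big)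
  also have "(\<Prod>p\<in>D. p ^ multiplicity p ?C) = \<Prod>D" by (rule prod.cong) (auto simp: D_def intro: big)
  finally have Ceq: "?C = (\<Prod>p\<in>A. p ^ multiplicity p ?C) * (\<Prod>B * \<Prod>D)" .
  have "(\<Prod>p\<in>A. p ^ multiplicity p ?C) \<le> (\<Prod>p\<in>A. 2 * n)"
    by (rule prod_mono) (auto simp: A_def intro: pw)
  also have "\<dots> = (2 * n) ^ card A" by simp
  also have "\<dots> \<le> (2 * n) ^ t"
  proof (rule power_increasing)
    have "A \<subseteq> {..<t}" by (auto simp: A_def)
    then have "card A \<le> card {..<t}" by (intro card_mono) auto
    then show "card A \<le> t" by simp
  qed (use n in simp)
  finally have pA: "(\<Prod>p\<in>A. p ^ multiplicity p ?C) \<le> (2 * n) ^ t" .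
  have pB: "\<Prod>B \<le> 4 ^ (2 * n div 3)"
  proof -
    have fS: "finite {p::nat. prime p \<and> p \<le> 2 * n div 3}" by (rule finite_subset[of _ "{..2 * n div 3}"]) auto
    have "B \<subseteq> {p. prime p \<and> p \<le> 2 * n div 3}"
    proof
      fix p assume p: "p \<in> B"
      then have "prime p" "p > 2" "p \<le> n" "p dvd ?C" using t2 by (auto simp: B_def)
      then have "\<not> 2 * n < 3 * p" using central_binomial_middle_prime by blast
      then show "p \<in> {p. prime p \<and> p \<le> 2 * n div 3}" using \<open>prime p\<close> by auto
    qed
    then have "\<Prod>B dvd \<Prod>{p::nat. prime p \<and> p \<le> 2 * n div 3}" by (rule prod_dvd_prod_subset[OF fS])
    then have "\<Prod>B \<le> \<Prod>{p::nat. prime p \<and> p \<le> 2 * n div 3}"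
      by (rule dvd_imp_le) (auto intro: prod_pos prime_gt_0_nat)
    also have "\<dots> \<le> 4 ^ (2 * n div 3)" by (rule primorial_le)
    finally show ?thesis .
  qed
  have pD: "\<Prod>D \<le> (2 * n) ^ 4"
  proof -
    have "\<Prod>D \<le> (\<Prod>p\<in>D. 2 * n)" by (rule prod_mono) (auto simp: D_def intro: ple)
    also have "\<dots> = (2 * n) ^ card D" by simp
    also have "\<dots> \<le> (2 * n) ^ 4"
    proof (rule power_increasing)
      \<comment> \<open>By assumption a prime above n exceeds 2 n - 4, which leaves four candidates
        and the factor (2 n)^4.\<close>
      have "D \<subseteq> {2 * n - 3..2 * n}"
      proof
        fix p assume p: "p \<in> D"
        then have "prime p" "n < p" by (auto simp: D_def)
        then have "\<not> p + 4 \<le> 2 * n" using no by blast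
        moreover have "p \<le> 2 * n" using p ple by (auto simp: D_def)
        ultimately show "p \<in> {2 * n - 3..2 * n}" by auto
      qed
      then have "card D \<le> card {2 * n - 3..2 * n}" by (intro card_mono) auto
      then show "card D \<le> 4" using n by simp
    qed (use n in simp)
    finally show ?thesis .
  qed
  have "real (4 ^ n) \<le> real (2 * n * ?C)"
    using central_binomial_lower_bound[of n] n by (simp add: field_simps)
  then have "4 ^ n \<le> 2 * n * ?C" by (simp only: of_nat_le_iff)
  also have "?C \<le> (2 * n) ^ t * (4 ^ (2 * n div 3) * (2 * n) ^ 4)"
    by (subst Ceq) (intro mult_le_mono pA pB pD)
  also have "2 * n * ((2 * n) ^ t * (4 ^ (2 * n div 3) * (2 * n) ^ 4)) = (2 * n) ^ (t + 5) * 4 ^ (2 * n div 3)"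
    by (simp only: power_add power_Suc numeral_eq_Suc pred_numeral_simps mult_ac)
  finally have "4 ^ n \<le> (2 * n) ^ (t + 5) * 4 ^ (2 * n div 3)" by simp
  \<comment> \<open>Cubing removes the division by 3 from the exponent; the exponent t + 5 combines
    t small primes, four large ones and the factor 2 n of the lower bound.\<close>
  then have "(4 ^ n) ^ 3 \<le> ((2 * n) ^ (t + 5) * 4 ^ (2 * n div 3)) ^ 3" by (rule power_mono) simp
  also have "\<dots> = (2 * n) ^ (3 * (t + 5)) * 4 ^ (3 * (2 * n div 3))"
  proof -
    have "(a ^ b * c ^ d) ^ 3 = a ^ (3 * b) * c ^ (3 * d)" for a b c d :: nat
    proof -
      have "x ^ (3 * y) = (x ^ y) ^ 3" for x y :: nat by (metis power_mult mult.commute)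
      then show ?thesis by (simp only: power_mult_distrib)
    qed
    then show ?thesis .
  qed
  also have "\<dots> \<le> (2 * n) ^ (3 * (t + 5)) * 4 ^ (2 * n)"
    by (rule mult_le_mono2, rule power_increasing) simp_all
  also have "(4 ^ n) ^ 3 = (4::nat) ^ n * 4 ^ (2 * n)"
  proof -
    have "n * 3 = n + 2 * n" by simp
    then show ?thesis by (simp only: power_mult[symmetric] power_add[symmetric])
  qed
  finally have "4 ^ n * 4 ^ (2 * n) \<le> (2 * n) ^ (3 * t + 15) * 4 ^ (2 * n)"
    by (simp only: distrib_left) simp
  then have "4 ^ n \<le> (2 * n) ^ (3 * t + 15)" by simp
  also have "\<dots> \<le> (4 ^ (i + 1)) ^ (3 * t + 15)" by (rule power_mono) (use i in auto)
  finally have "(4::nat) ^ n \<le> 4 ^ ((i + 1) * (3 * t + 15))" by (simp only: power_mult)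
  then have "n \<le> (i + 1) * (3 * t + 15)" using power_le_imp_le_exp[of "4::nat" n "(i + 1) * (3 * t + 15)"] by simp
  then have "2 * n \<le> (i + 1) * (12 * 2 ^ i + 30)" by (simp add: t_def algebra_simps)
  then show False using bertrand_numeric[OF i7] i(1) by linarith
qed

lemma prime_by_trial_division:
  fixes p s :: nat
  assumes "1 < p" "p < s * s" "\<forall>d\<in>set [2..<s]. \<not> d dvd p"
  shows "prime p"
proof (rule ccontr)
  assume "\<not> prime p"
  then obtain d e where de: "p = d * e" "d \<noteq> 1" "d \<noteq> p"
    using assms(1) unfolding prime_nat_iff by (auto elim: dvdE)
  have "d \<noteq> 0" "e \<noteq> 0" using de(1) assms(1) by (metis mult_0 not_one_less_zero, metis mult_0_right not_one_less_zero)
  moreover have "e \<noteq> 1" using de by auto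
  ultimately have de2: "d \<ge> 2" "e \<ge> 2" using de(2) by auto
  have "d < s \<or> e < s"
  proof (rule ccontr)
    assume "\<not> ?thesis"
    then have "s * s \<le> d * e" by (intro mult_le_mono) auto
    then show False using de assms(2) by simp
  qed
  then have "d \<in> set [2..<s] \<or> e \<in> set [2..<s]" using de2 by auto
  moreover have "d dvd p" "e dvd p" using de(1) by simp_all
  ultimately show False using assms(3) by blast
qed

text \<open>Below 8192 a ladder of primes suffices: each rung q satisfies q + 4 \<le> 2 m for the
  previous rung m, starting from 8.\<close>

lemma prime_between:
  fixes n :: nat
  assumes n: "n \<ge> 8"
  shows "\<exists>p. prime p \<and> n < p \<and> p + 4 \<le> 2 * n"
proof (cases "n \<ge> 8192")
  case True
  then show ?thesis by (rule prime_between_large)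
next
  case False
  show ?thesis
  proof (rule ccontr)
    assume no: "\<not> ?thesis"
    \<comment> \<open>If no prime works for n and m \<le> n, then q cannot exceed n, so the lower
      bound on n climbs from m to q.\<close>
    have step: "q \<le> n" if "prime q" "m \<le> n" "q + 4 \<le> 2 * m" for q m :: nat
    proof (rule ccontr)
      assume "\<not> q \<le> n"
      then have "prime q \<and> n < q \<and> q + 4 \<le> 2 * n" using that by linarith
      then show False using no by blast
    qed
    have p: "prime (11::nat)" "prime (13::nat)" "prime (17::nat)" "prime (23::nat)" "prime (41::nat)" "prime (73::nat)"
        "prime (139::nat)" "prime (263::nat)"
      by simp_all
    have q1: "prime (521::nat)" by (rule prime_by_trial_division[of _ 23]) simp_all
    have q2: "prime (1031::nat)" by (rule prime_by_trial_division[of _ 33]) simp_all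
    have q3: "prime (2053::nat)" by (rule prime_by_trial_division[of _ 46]) simp_all
    have q4: "prime (4099::nat)" by (rule prime_by_trial_division[of _ 65]) simp_all
    have q5: "prime (8191::nat)" by (rule prime_by_trial_division[of _ 91]) simp_all
    have q6: "prime (8209::nat)" by (rule prime_by_trial_division[of _ 91]) simp_all
    from n have "11 \<le> n" by (rule step[OF p(1)]) simp
    then have "13 \<le> n" by (rule step[OF p(2)]) simp
    then have "17 \<le> n" by (rule step[OF p(3)]) simp
    then have "23 \<le> n" by (rule step[OF p(4)]) simp
    then have "41 \<le> n" by (rule step[OF p(5)]) simp
    then have "73 \<le> n" by (rule step[OF p(6)]) simp
    then have "139 \<le> n" by (rule step[OF p(7)]) simp
    then have "263 \<le> n" by (rule step[OF p(8)]) simp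
    then have "521 \<le> n" by (rule step[OF q1]) simp
    then have "1031 \<le> n" by (rule step[OF q2]) simp
    then have "2053 \<le> n" by (rule step[OF q3]) simp
    then have "4099 \<le> n" by (rule step[OF q4]) simp
    then have "8191 \<le> n" by (rule step[OF q5]) simp
    then have "8209 \<le> n" by (rule step[OF q6]) simp
    then show False using False by simp
  qed
qed

section \<open>Cycles from primes dividing the order, and degrees 3, 5, 6 and 7\<close>

context perm_group begin

text \<open>The support of an element of order p is a nonzero multiple of p below 2 p.\<close>

lemma Cauchy_cycle:
  assumes p: "prime p" "p dvd card G" "card \<Omega> < 2 * p"
  obtains c where "c \<in> G" "c ^^ p = id" "card (supp c) = p"
proof -
  obtain c where c: "c \<in> G" "c \<noteq> id" "c ^^ p = id" using Cauchy[OF p(1,2)] by blast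
  obtain j where j: "card (supp c) = p * j" using prime_dvd_supp[OF p(1) c(1,3)] by (rule dvdE)
  have "card (supp c) < p * 2" using card_mono[OF fin supp_subset[OF c(1)]] p(3) by simp
  then have "j < 2" using j by simp
  moreover have "j \<noteq> 0" using j c finite_supp[OF c(1)] by (auto simp: supp_empty_iff)
  ultimately have "j = 1" by simp
  then show ?thesis using that[OF c(1,3)] j by simp
qed

lemma Jordan_has_3_cycles:
  assumes tr: "transitive G \<Omega>" and p: "prime p" "p dvd card G" "card \<Omega> < 2 * p" "p + 3 \<le> card \<Omega>"
  shows has_3_cycles
proof -
  obtain c where c: "c \<in> G" "c ^^ p = id" "card (supp c) = p" by (rule Cauchy_cycle[OF p(1-3)])
  obtain t where t: "t \<in> G" "card (supp t) = 3" using Jordan_3_cycle[OF tr p(1) c p(3,4)] by blast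
  have "multitrans (Suc (card \<Omega> - p)) G \<Omega>"
    by (rule Jordan_multitrans[OF perm_group_axioms tr p(1) c p(3)]) (use p(4) in simp)
  then have "multitrans 3 G \<Omega>" by (rule multitrans_mono) (use p(4) prime_gt_0_nat[OF p(1)] in auto)
  then show ?thesis using multitrans_has_3_cycles t by blast
qed

text \<open>3-transitivity fails for the alternating group of degree 3, so the two 3-cycles c and
  c^2 are matched with the required ones directly.\<close>

lemma card_3_has_3_cycles:
  assumes om: "card \<Omega> = 3" and c: "c \<in> G" "card (supp c) = 3"
  shows has_3_cycles
proof -
  obtain u v w where uvw: "u \<noteq> v" "v \<noteq> w" "u \<noteq> w" "supp c = {u, v, w}" "c u = v" "c v = w" "c w = u"
    by (rule card_3_cycle[OF inj[OF c(1)] c(2)])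
  have \<Omega>: "\<Omega> = {u, v, w}" using card_subset_eq[OF fin supp_subset[OF c(1)]] om c(2) uvw(4) by simp
  have sc: "supp (c \<circ> c) = {u, v, w}"
  proof (rule subset_antisym)
    show "supp (c \<circ> c) \<subseteq> {u, v, w}" using supp_subset[OF comp[OF c(1) c(1)]] \<Omega> by simp
    show "{u, v, w} \<subseteq> supp (c \<circ> c)" using uvw by (auto simp: supp_def)
  qed
  show ?thesis unfolding has_3_cycles_def
  proof (intro allI impI)
    fix x y z assume xyz: "x \<in> \<Omega>" "y \<in> \<Omega>" "z \<in> \<Omega>" "x \<noteq> y" "y \<noteq> z" "x \<noteq> z"
    have "(c x = y \<and> c y = z \<and> c z = x) \<or> ((c \<circ> c) x = y \<and> (c \<circ> c) y = z \<and> (c \<circ> c) z = x)"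
      using xyz uvw(1-3,5-7) unfolding \<Omega> by auto
    moreover have "{x, y, z} = {u, v, w}" using xyz unfolding \<Omega> by auto
    ultimately show "\<exists>g\<in>G. g x = y \<and> g y = z \<and> g z = x \<and> supp g = {x, y, z}"
      using c(1) comp[OF c(1) c(1)] uvw(4) sc by metis
  qed
qed

lemma cube_of_3_cycle:
  assumes t: "t \<in> G" "card (supp t) = 3"
  shows "t ^^ 3 = id"
proof
  fix x
  obtain u v w where "u \<noteq> v" "v \<noteq> w" "u \<noteq> w" and uvw: "supp t = {u, v, w}" "t u = v" "t v = w" "t w = u"
    by (rule card_3_cycle[OF inj[OF t(1)] t(2)])
  show "(t ^^ 3) x = id x"
  proof (cases "x \<in> supp t")
    case True
    then have "x = u \<or> x = v \<or> x = w" unfolding uvw(1) by blast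
    then show ?thesis by (elim disjE) (simp_all add: numeral_3_eq_3 uvw(2-4))
  next
    case False
    then have "t x = x" unfolding supp_def by blast
    then show ?thesis by (simp add: numeral_3_eq_3)
  qed
qed

text \<open>The 3-cycle itself serves as the long prime cycle, since 5 < 2 * 3.\<close>

lemma degree_5_multitrans:
  assumes om: "card \<Omega> = 5" and tr: "transitive G \<Omega>" and t: "t \<in> G" "card (supp t) = 3"
  shows "multitrans 3 G \<Omega>"
proof -
  have p3: "prime (3::nat)" by simp
  have "multitrans (Suc 2) G \<Omega>"
    by (rule Jordan_multitrans[OF perm_group_axioms tr p3 t(1) cube_of_3_cycle[OF t] t(2)]) (use om in auto)
  then show ?thesis by (simp add: numeral_3_eq_3)
qed

text \<open>In degree 6 the prime 3 is no longer more than half the degree, so the argument is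
  applied to the stabilizer of a point fixed by t, which is transitive by 2-transitivity.\<close>

lemma degree_6_has_3_cycles:
  assumes om: "card \<Omega> = 6" and mt: "multitrans 2 G \<Omega>" and t: "t \<in> G" "card (supp t) = 3"
  shows has_3_cycles
proof -
  have "\<not> \<Omega> \<subseteq> supp t" using card_mono[OF finite_supp[OF t(1)], of \<Omega>] om t(2) by auto
  then obtain a where a: "a \<in> \<Omega>" "a \<notin> supp t" by blast
  let ?K = "{g \<in> G. g a = a}"
  interpret K: perm_group ?K "\<Omega> - {a}" by (rule point_stabilizer)
  have "transitive ?K (\<Omega> - {a})" unfolding transitive_def
  proof (intro ballI)
    fix x y assume xy: "x \<in> \<Omega> - {a}" "y \<in> \<Omega> - {a}"
    have "\<exists>g\<in>G. map g [a, x] = [a, y]"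
      by (rule mt[unfolded multitrans_def, rule_format]) (use xy a in auto)
    then show "\<exists>g\<in>?K. g x = y" by auto
  qed
  moreover have "t \<in> ?K" using t a by (simp add: supp_def)
  ultimately have "multitrans 3 ?K (\<Omega> - {a})"
    using K.degree_5_multitrans om a fin t(2) by simp
  moreover have "transitive G \<Omega>" unfolding multitrans_one
    by (rule multitrans_mono[OF mt]) (use om in auto)
  ultimately have "multitrans (Suc 3) G \<Omega>" using multitrans_extend a(1) by blast
  then have "multitrans 3 G \<Omega>" by (rule multitrans_mono) (use om in auto)
  then show ?thesis using multitrans_has_3_cycles t by blast
qed

text \<open>Labels the support by exponents, so that c becomes x \<mapsto> x + 1 modulo p.\<close>

lemma cycle_enumeration:
  assumes p: "prime p" and c: "c \<in> G" "c ^^ p = id" "card (supp c) = p" and x: "x \<in> supp c"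
  shows "bij_betw (\<lambda>i. (c ^^ i) x) {..<p} (supp c)"
proof -
  have "(\<lambda>i. (c ^^ i) x) ` {..<p} = supp c"
  proof (intro subset_antisym subsetI)
    fix y assume y: "y \<in> (\<lambda>i. (c ^^ i) x) ` {..<p}"
    have "(c ^^ i) x \<in> supp c" for i
      by (induction i) (use x inj_eq[OF inj[OF c(1)]] in \<open>auto simp: supp_def\<close>)
    then show "y \<in> supp c" using y by auto
  next
    fix y assume "y \<in> supp c"
    then obtain i where i: "(c ^^ i) x = y" using prime_cycle_transitive[OF p c x] by blast
    have "(c ^^ (i mod p)) x = (c ^^ i) x" by (rule funpow_mod_eq) (simp add: c(2))
    then show "y \<in> (\<lambda>i. (c ^^ i) x) ` {..<p}"
      using i prime_gt_0_nat[OF p] by (intro image_eqI[of _ _ "i mod p"]) auto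
  qed
  then show ?thesis using c(3) by (auto simp: bij_betw_def intro!: eq_card_imp_inj_on)
qed

end

context list_rep begin

lemma pw_elem:
  assumes x: "R xs" and h: "\<And>i. i < N \<Longrightarrow> h (e i) = e (xs ! i)" and i: "i < N"
  shows "(h ^^ k) (e i) = e (pw k xs ! i)"
proof (induction k)
  case 0
  then show ?case using i R_length[OF x] by simp
next
  case (Suc k)
  have "pw k xs ! i < N" using R_nth[OF R_pw[OF x] i] .
  then show ?case using Suc h R_length[OF R_pw[OF x]] i by (simp add: cmp_def)
qed

lemma R_some_3_cycle:
  assumes "some_3_cycle gs ws" "gs \<noteq> []" "\<And>x. x \<in> set gs \<Longrightarrow> R x" "\<forall>w\<in>set ws. \<forall>i\<in>set w. i < length gs"
  shows "\<exists>t\<in>G. card (supp t) = 3"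
proof -
  obtain w where w: "w \<in> set ws" "moved (wp gs w) = 3" using assms(1) by (auto simp: some_3_cycle_iff)
  have "R (wp gs w)" using R_wp[OF assms(2,3)] assms(4) w(1) by blast
  then show ?thesis using R_moved w(2) by metis
qed

end

text \<open>The 7-cycle d provides the labels. By 2-transitivity a conjugate of c fixes labels 0 and
  1, and some power of it sends 2 to 3. This leaves 24 lists, all treated by
  \<open>check_degree_7\<close>.\<close>

lemma (in perm_group) degree_7_3_cycle:
  assumes om: "card \<Omega> = 7" and mt: "multitrans 3 G \<Omega>"
    and d: "d \<in> G" "d ^^ 7 = id" "card (supp d) = 7" and c: "c \<in> G" "c ^^ 5 = id" "card (supp c) = 5"
  shows "\<exists>t\<in>G. card (supp t) = 3"
proof -
  have p5: "prime (5::nat)" and p7: "prime (7::nat)" by simp_all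
  have sd: "supp d = \<Omega>" using card_subset_eq[OF fin supp_subset[OF d(1)]] om d(3) by simp
  have "\<Omega> \<noteq> {}" using om by auto
  then obtain x0 where x0: "x0 \<in> supp d" using sd by blast
  define e where "e i = (d ^^ i) x0" for i
  interpret list_rep G \<Omega> e 7
    by unfold_locales (use cycle_enumeration[OF p7 d x0] sd in \<open>simp add: e_def[abs_def]\<close>)
  have Rd: "R cyc7"
    unfolding R_def
  proof (intro conjI bexI[OF _ d(1)] allI impI)
    fix i :: nat assume "i < 7"
    then have "i \<in> {0, 1, 2, 3, 4, 5, 6}" by auto
    moreover have "d ((d ^^ 6) x0) = x0" using fun_cong[OF d(2), of x0] by (simp add: numeral_eq_Suc)
    ultimately show "d (e i) = e (cyc7 ! i)" by (auto simp: e_def cyc7_def numeral_eq_Suc)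
  qed (auto simp: cyc7_def)
  have "card (\<Omega> - supp c) = 2" using om c(3) supp_subset[OF c(1)] finite_supp[OF c(1)] by (simp add: card_Diff_subset)
  then obtain b1 b2 where b: "\<Omega> - supp c = {b1, b2}" "b1 \<noteq> b2" by (meson card_2_iff)
  have mt2: "multitrans 2 G \<Omega>" by (rule multitrans_mono[OF mt]) (use om in auto)
  have en: "e 0 \<noteq> e 1" "e 2 \<noteq> e 0" "e 2 \<noteq> e 1" "e 3 \<noteq> e 0" "e 3 \<noteq> e 1" "e 3 \<noteq> e 2" using e_inj by auto
  have "\<exists>g\<in>G. map g [b1, b2] = [e 0, e 1]"
    by (rule mt2[unfolded multitrans_def, rule_format]) (use b en e_in in auto)
  then obtain g where g: "g \<in> G" "g b1 = e 0" "g b2 = e 1" by auto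
  let ?c = "g \<circ> c \<circ> inv' g"
  have cG: "?c \<in> G" using conj_closed[OF g(1) c(1)] .
  have c5: "?c ^^ 5 = id" by (rule conj_order[OF g(1) c(2)])
  have sc: "supp ?c = \<Omega> - {e 0, e 1}"
  proof -
    have "supp c = \<Omega> - {b1, b2}" using b supp_subset[OF c(1)] by auto
    then have "g ` supp c = \<Omega> - {e 0, e 1}"
      using image_set_diff[OF inj[OF g(1)], of \<Omega> "{b1, b2}"] im_Omega[OF g(1)] g by simp
    then show ?thesis using supp_conj[OF g(1), of c] by simp
  qed
  have csc: "card (supp ?c) = 5" using supp_conj[OF g(1), of c] card_im[OF g(1)] c(3) by simp
  obtain i where i: "(?c ^^ i) (e 2) = e 3"
    using prime_cycle_transitive[OF p5 cG c5 csc, of "e 2" "e 3"] sc e_in en by auto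
  define h where "h = ?c ^^ i"
  have hG: "h \<in> G" unfolding h_def by (rule pow[OF cG])
  have h5: "h ^^ 5 = id"
  proof -
    have "h ^^ 5 = (?c ^^ 5) ^^ i" unfolding h_def by (simp only: funpow_mult mult.commute)
    then show ?thesis unfolding c5 by simp
  qed
  have hfix: "h y = y" if "y \<notin> supp ?c" for y
  proof -
    have "?c y = y" using that unfolding supp_def by blast
    then have "(?c ^^ j) y = y" for j by (induction j) simp_all
    then show ?thesis by (simp add: h_def)
  qed
  have h2: "h (e 2) = e 3" using i by (simp add: h_def)
  have sh: "card (supp h) = 5"
  proof -
    obtain j where j: "card (supp h) = 5 * j" using prime_dvd_supp[OF p5 hG h5] by (rule dvdE)
    have "e 2 \<in> supp h" using h2 en(6) by (simp add: supp_def)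
    then have "supp h \<noteq> {}" by blast
    then have "j \<noteq> 0" using j finite_supp[OF hG] by auto
    moreover have "5 * j \<le> 7" using card_mono[OF fin supp_subset[OF hG]] j om by simp
    ultimately show ?thesis using j by simp
  qed
  obtain xs where xs: "R xs" "\<And>i. i < 7 \<Longrightarrow> h (e i) = e (xs ! i)" using R_of[OF hG] by blast
  have v: "xs ! 0 = 0" "xs ! 1 = 1" "xs ! 2 = 3"
  proof -
    have "e (xs ! 0) = e 0" "e (xs ! 1) = e 1" "e (xs ! 2) = e 3"
      using xs(2)[of 0] xs(2)[of 1] xs(2)[of 2] hfix[of "e 0"] hfix[of "e 1"] h2 sc by simp_all
    then show "xs ! 0 = 0" "xs ! 1 = 1" "xs ! 2 = 3"
      using e_inj R_nth[OF xs(1)] by simp_all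
  qed
  have "length xs = 7" using R_length[OF xs(1)] .
  then obtain p where p: "xs = 0 # 1 # 3 # p" "length p = 4"
    using v by (auto simp: numeral_eq_Suc length_Suc_conv)
  have "set p = {2, 4, 5, 6}"
  proof -
    have "set p = set xs - {0, 1, 3}" using R_distinct[OF xs(1)] p(1) by auto
    also have "\<dots> = {2, 4, 5, 6}" unfolding R_set[OF xs(1)] by auto
    finally show ?thesis .
  qed
  then have pin: "p \<in> set (perms [2, 4, 5, 6])"
    using R_distinct[OF xs(1)] p by (intro perms_complete) auto
  have "test7 p" using check_degree_7 pin unfolding every_iff by blast
  moreover have "pw 5 xs = [0, 1, 2, 3, 4, 5, 6]"
  proof -
    have "pw 5 xs ! i = i" if "i < 7" for i
      using pw_elem[OF xs that, of 5] h5 e_inj[OF R_nth[OF R_pw[OF xs(1)] that] that, of 5] by simp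
    then have "pw 5 xs = [0..<7]" using R_length[OF R_pw[OF xs(1)]] by (intro nth_equalityI) auto
    then show ?thesis by (simp add: upt_rec)
  qed
  moreover have "moved xs = 5" using moved_supp[OF xs(1) hG xs(2)] sh by simp
  ultimately have "some_3_cycle [cyc7, xs] words7" using p by (simp add: test7_def)
  then show ?thesis by (rule R_some_3_cycle) (use Rd xs(1) in \<open>auto simp: words7_def\<close>)
qed

section \<open>Consequences of 3-cycles, and groups with a fixed point\<close>

context lambda_group begin

text \<open>A transposition of two points in the same part fixes every part, so a permutation
  matching two ordered partitions can be taken even.\<close>

lemma lambda_transitive_if_3_cycles:
  assumes h3: has_3_cycles
  shows "lambda_transitive n k G"
  unfolding lambda_transitive_def
proof (intro allI impI)
  fix A B assume A: "ordered_partition_type n k A" and B: "ordered_partition_type n k B"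
  obtain \<sigma> where s: "\<sigma> permutes {1..n}" "\<And>i. i < n div k \<Longrightarrow> \<sigma> ` A i = B i"
    using ordered_partition_transfer[OF A B] k2 by auto
  have m0: "0 < n div k" using m2 by simp
  have "card (A 0) = k" using A m0 unfolding ordered_partition_type_def by blast
  then obtain x y where xy: "x \<in> A 0" "y \<in> A 0" "x \<noteq> y" using k2 two_elements[of "A 0"] by metis
  have in1: "x \<in> {1..n}" "y \<in> {1..n}" using A m0 xy unfolding ordered_partition_type_def by blast+
  let ?s = "\<sigma> \<circ> transpose x y"
  have ts: "transpose x y permutes {1..n}" by (rule permutes_swap_id[OF in1])
  have s': "?s permutes {1..n}" by (rule permutes_compose[OF ts s(1)])
  have "transpose x y ` A i = A i" if i: "i < n div k" for i
  proof (cases "i = 0")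
    case True
    then show ?thesis using xy by (simp add: transpose_image_eq)
  next
    case False
    then have "A 0 \<inter> A i = {}" using A i m0 unfolding ordered_partition_type_def by metis
    then have "x \<notin> A i" "y \<notin> A i" using xy by auto
    then show ?thesis by (simp add: transpose_image_eq)
  qed
  then have im: "?s ` A i = B i" if "i < n div k" for i
    using s(2)[OF that] that by (metis image_comp)
  have "permutation \<sigma>" "permutation (transpose x y)"
    using s(1) ts by (auto intro: permutes_imp_permutation)
  then have "evenperm \<sigma> \<or> evenperm ?s" using xy(3) by (auto simp: evenperm_comp evenperm_swap)
  then have "\<sigma> \<in> G \<or> ?s \<in> G" using evenperm_in_G[OF h3] s(1) s' by blast
  then show "\<exists>g\<in>G. \<forall>i<n div k. g ` A i = B i" using s(2) im by blast
qed

lemma halves_homogeneous: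
  assumes n: "n = 2 * k" and S: "S \<subseteq> {1..n}" "card S = k" and T: "T \<subseteq> {1..n}" "card T = k"
  shows "\<exists>g\<in>G. g ` S = T \<or> g ` S = {1..n} - T"
proof -
  have m: "n div k = 2" using n k2 by simp
  define P where "P S i = (if i = 0 then S else {1..n} - S)" for S and i :: nat
  have P: "ordered_partition_type n k (P S)" if S: "S \<subseteq> {1..n}" "card S = k" for S
  proof -
    have c: "card ({1..n} - S) = k" using S n by (simp add: card_Diff_subset finite_subset)
    have "{..<2::nat} = {0, 1}" by auto
    then show ?thesis unfolding ordered_partition_type_def m using S c by (auto simp: P_def less_2_cases_iff)
  qed
  obtain g where g: "g \<in> G" "(\<lambda>i. g ` P S i) ` {..<n div k} = P T ` {..<n div k}"
    by (rule homogeneous[OF P[OF S] P[OF T]])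
  have "g ` P S 0 \<in> P T ` {..<2}" using g(2) m by (metis imageI lessThan_iff pos2)
  then have "g ` S = T \<or> g ` S = {1..n} - T" by (auto simp: P_def split: if_splits)
  then show ?thesis using g(1) by blast
qed

lemma lambda_transitive_if_homog:
  assumes n: "n = 2 * k" and h: "homog k G {1..n}"
  shows "lambda_transitive n k G"
  unfolding lambda_transitive_def
proof (intro allI impI)
  fix A B assume A: "ordered_partition_type n k A" and B: "ordered_partition_type n k B"
  have m: "n div k = 2" using n k2 by simp
  have AB: "A 0 \<subseteq> {1..n}" "card (A 0) = k" "B 0 \<subseteq> {1..n}" "card (B 0) = k"
    using A B unfolding ordered_partition_type_def m by auto
  have compl: "C 1 = {1..n} - C 0" if C: "ordered_partition_type n k C" for C
  proof -
    have "{..<2::nat} = {0, 1}" by auto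
    then have "C 0 \<union> C 1 = {1..n}" using C unfolding ordered_partition_type_def m by simp
    moreover have "C 0 \<inter> C 1 = {}" using C unfolding ordered_partition_type_def m by simp
    ultimately show ?thesis by blast
  qed
  obtain g where g: "g \<in> G" "g ` A 0 = B 0" using h AB unfolding homog_def by blast
  have "g ` A 1 = B 1"
    unfolding compl[OF A] compl[OF B] image_set_diff[OF inj[OF g(1)]] im_Omega[OF g(1)] g(2) ..
  then have "\<forall>i<n div k. g ` A i = B i" using g(2) unfolding m by (simp add: less_2_cases_iff)
  then show "\<exists>g\<in>G. \<forall>i<n div k. g ` A i = B i" using g(1) by blast
qed

definition fixes_and_alt_or_sym :: bool where
  "fixes_and_alt_or_sym \<longleftrightarrow> (\<exists>a \<in> {1..n}. (\<forall>g \<in> G. g a = a) \<and>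
     (G = {p. p permutes ({1..n} - {a})} \<or> G = {p. p permutes ({1..n} - {a}) \<and> evenperm p}))"

end

locale lambda_group_fix = lambda_group +
  fixes a :: nat
  assumes a: "a \<in> {1..n}" and fixed: "\<And>g. g \<in> G \<Longrightarrow> g a = a" and transP: "transitive G ({1..n} - {a})"
begin

sublocale P: perm_group G "{1..n} - {a}"
  by (rule fixes_point) (rule fixed)

lemma cardP: "card ({1..n} - {a}) = n - 1"
  using a by simp

lemma conclude: "P.has_3_cycles \<Longrightarrow> fixes_and_alt_or_sym"
  unfolding fixes_and_alt_or_sym_def using a fixed P.alt_or_sym by blast

text \<open>Adding a to both sets gives halves. The image of the first cannot be the complement of
  the second, because a is fixed and lies in both halves.\<close>

lemma fix_homog:
  assumes n: "n = 2 * k"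
  shows "homog (k - 1) G ({1..n} - {a})"
  unfolding homog_def
proof (intro allI impI)
  fix A B assume A: "A \<subseteq> {1..n} - {a}" and B: "B \<subseteq> {1..n} - {a}" and c: "card A = k - 1" "card B = k - 1"
  have f: "finite A" "finite B" using A B by (auto intro: finite_subset)
  have "insert a A \<subseteq> {1..n}" "insert a B \<subseteq> {1..n}" using A B a by auto
  moreover have "card (insert a A) = k" "card (insert a B) = k" using A B c f k2 by (auto simp: card_insert_if)
  ultimately obtain g where g: "g \<in> G" "g ` insert a A = insert a B \<or> g ` insert a A = {1..n} - insert a B"
    using halves_homogeneous[OF n, of "insert a A" "insert a B"] by blast
  have ga: "g a = a" by (rule fixed[OF g(1)])
  then have "g ` insert a A = insert a B" using g(2) by auto
  then have "insert a (g ` A) = insert a B" using ga by simp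
  moreover have "a \<notin> g ` A" using A inj_eq[OF inj[OF g(1)], of _ a] ga by auto
  moreover have "a \<notin> B" using B by auto
  ultimately have "g ` A = B" by (simp add: insert_ident)
  then show "\<exists>g\<in>G. g ` A = B" using g(1) by blast
qed

text \<open>Jordan's theorem in degree n - 1: the hypotheses on p are those for n shifted by the
  fixed point.\<close>

lemma fixed_large:
  assumes p: "prime p" "k < p" "n \<le> 2 * p" "p + 4 \<le> n"
  shows fixes_and_alt_or_sym
proof -
  have "p dvd card G" by (rule prime_dvd_order) (use p in auto)
  then show ?thesis
    by (intro conclude P.Jordan_has_3_cycles[OF transP p(1)]) (use p n_ge k2 cardP in auto)
qed

lemma fixed_degree_3:
  assumes n: "n = 4" and k: "k = 2"
  shows fixes_and_alt_or_sym
proof -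
  have d: "3 dvd card G" by (rule prime_dvd_order) (use n k in auto)
  obtain c where c: "c \<in> G" "c ^^ 3 = id" "card (supp c) = 3"
    by (rule P.Cauchy_cycle[OF _ d]) (use cardP n in auto)
  show ?thesis by (rule conclude, rule P.card_3_has_3_cycles[OF _ c(1,3)]) (use cardP n in simp)
qed

text \<open>The prime 5 leaves only two fixed points, enough for 3-transitivity but not for a
  3-cycle; the 7-cycle and the certificate supply the latter.\<close>

lemma fixed_degree_7:
  assumes n: "n = 8" and k: "k < 5"
  shows fixes_and_alt_or_sym
proof -
  have c7: "card ({1..n} - {a}) = 7" using cardP n by simp
  have d: "5 dvd card G" "7 dvd card G" by (rule prime_dvd_order; use n k in simp)+
  obtain c where c: "c \<in> G" "c ^^ 5 = id" "card (supp c) = 5"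
    by (rule P.Cauchy_cycle[OF _ d(1)]) (use c7 in auto)
  obtain s where s: "s \<in> G" "s ^^ 7 = id" "card (supp s) = 7"
    by (rule P.Cauchy_cycle[OF _ d(2)]) (use c7 in auto)
  have "multitrans (Suc 2) G ({1..n} - {a})"
    by (rule Jordan_multitrans[OF P.perm_group_axioms transP _ c]) (use c7 in auto)
  then have mt: "multitrans 3 G ({1..n} - {a})" by (simp add: numeral_3_eq_3)
  obtain t where "t \<in> G" "card (supp t) = 3" using P.degree_7_3_cycle[OF c7 mt s c] by blast
  then show ?thesis using conclude P.multitrans_has_3_cycles[OF mt] by blast
qed

text \<open>The only prime between 7 and 13 is 11, which gives 3-transitivity; the 3-cycle has to
  come from 6-homogeneity.\<close>

lemma fixed_degree_13:
  assumes n: "n = 14" and k: "k = 7"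
  shows fixes_and_alt_or_sym
proof -
  have c13: "card ({1..n} - {a}) = 13" using cardP n by simp
  have d: "11 dvd card G" by (rule prime_dvd_order) (use n k in auto)
  obtain c where c: "c \<in> G" "c ^^ 11 = id" "card (supp c) = 11"
    by (rule P.Cauchy_cycle[OF _ d]) (use c13 in auto)
  have "multitrans (Suc 2) G ({1..n} - {a})"
    by (rule Jordan_multitrans[OF P.perm_group_axioms transP _ c]) (use c13 in auto)
  then have mt: "multitrans 3 G ({1..n} - {a})" by (simp add: numeral_3_eq_3)
  have "homog 6 G ({1..n} - {a})" using fix_homog n k by simp
  then obtain t where "t \<in> G" "card (supp t) = 3" using P.degree_13_3_cycle[OF c13] by blast
  then show ?thesis using conclude P.multitrans_has_3_cycles[OF mt] by blast
qed

end

section \<open>Degree 6: perfect matchings and affine maps\<close>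

lemma cmp_assoc: "set z \<subseteq> {..<length y} \<Longrightarrow> cmp (cmp x y) z = cmp x (cmp y z)"
  by (auto simp: cmp_def)

lemma cmp_upt: "set x \<subseteq> {..<m} \<Longrightarrow> cmp [0..<m] x = x"
  by (auto simp: cmp_def intro!: map_idI)

lemma cmp_nth: "i < length y \<Longrightarrow> cmp x y ! i = x ! (y ! i)"
  by (simp add: cmp_def)

lemma upt_6: "[0..<6] = [0, 1, 2, 3, 4, 5 :: nat]" and upt_Suc_5: "[0..<Suc 5] = [0, 1, 2, 3, 4, 5 :: nat]"
  by (simp_all add: upt_rec)

lemma less_5_cases: "i < 5 \<Longrightarrow> i = 0 \<or> i = 1 \<or> i = 2 \<or> i = 3 \<or> i = (4::nat)"
  by auto

lemma pw_cyc5: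
  assumes "i < 5"
  shows "length (pw i cyc5) = 6" "pw i cyc5 ! 5 = 5" "pw i cyc5 ! 0 = i" "pw (5 - i) cyc5 ! i = 0"
    "pw (5 - i) cyc5 ! 5 = 5" "cmp (pw i cyc5) (pw (5 - i) cyc5) = [0..<6]" "length (pw (5 - i) cyc5) = 6"
  using less_5_cases[OF assms] by (elim disjE; simp add: numeral_eq_Suc cyc5_def cmp_def)+

text \<open>The labels are the projective line over the field with 5 elements, 5 being infinity, and
  G contains x \<mapsto> x + 1.\<close>

locale list_rep_5_cycle = list_rep G \<Omega> e 6 for G :: "('a \<Rightarrow> 'a) set" and \<Omega> :: "'a set" and e +
  assumes R_cyc5: "R cyc5"
begin

lemma R_cmp_cancel:
  assumes i: "i < 5" and x: "R x"
  shows "cmp (pw i cyc5) (cmp (pw (5 - i) cyc5) x) = x"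
proof -
  have s: "set x \<subseteq> {..<6}" using R_set[OF x] by simp
  have "cmp (pw i cyc5) (cmp (pw (5 - i) cyc5) x) = cmp (cmp (pw i cyc5) (pw (5 - i) cyc5)) x"
    by (rule cmp_assoc[symmetric]) (use s pw_cyc5[OF i] in simp)
  then show ?thesis using pw_cyc5[OF i] cmp_upt[OF s] by simp
qed

lemma R_unshift:
  assumes i: "i < 5" and x: "R x"
  shows "R (cmp (pw (5 - i) cyc5) x)"
    "x ! j = i \<Longrightarrow> j < 6 \<Longrightarrow> cmp (pw (5 - i) cyc5) x ! j = 0"
    "x ! j = 5 \<Longrightarrow> j < 6 \<Longrightarrow> cmp (pw (5 - i) cyc5) x ! j = 5"
  using R_comp[OF R_pw[OF R_cyc5] x] pw_cyc5[OF i] R_length[OF x] by (auto simp: cmp_nth)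

lemma R_middle:
  assumes x: "R x" and uv: "x ! 0 = u" "x ! 5 = v" "{u, v} = {0, 5}"
  obtains p where "p \<in> set (perms [1, 2, 3, 4])" "x = u # p @ [v]"
proof -
  have "length x = 6" by (rule R_length[OF x])
  then obtain x0 x1 x2 x3 x4 x5 where l: "x = [x0, x1, x2, x3, x4, x5]"
    by (auto simp: numeral_eq_Suc length_Suc_conv)
  let ?p = "[x1, x2, x3, x4]"
  have xp: "x = u # ?p @ [v]" using l uv by simp
  have d: "distinct x" by (rule R_distinct[OF x])
  then have "set ?p = set x - {u, v}" unfolding xp by auto
  also have "\<dots> = {1, 2, 3, 4}" unfolding R_set[OF x] uv(3) by auto
  finally have "?p \<in> set (perms [1, 2, 3, 4])" using d l by (intro perms_complete) auto
  then show ?thesis using that xp by blast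
qed

lemma matching_3_cycle:
  assumes x: "R xs" and m: "xs ! 5 = mate (xs ! 0)" "xs ! 4 = mate (xs ! 1)" "xs ! 3 = mate (xs ! 2)"
  shows "\<exists>t\<in>G. card (supp t) = 3"
proof -
  have "length xs = 6" by (rule R_length[OF x])
  then obtain x0 x1 x2 x3 x4 x5 where l: "xs = [x0, x1, x2, x3, x4, x5]"
    by (auto simp: numeral_eq_Suc length_Suc_conv)
  have xs: "xs = [x0, x1, x2, mate x2, mate x1, mate x0]" using l m by (simp add: numeral_eq_Suc)
  have ne: "\<not> (x0 = x1 \<or> mate x0 = x1 \<or> x0 = x2 \<or> mate x0 = x2 \<or> x1 = x2 \<or> mate x1 = x2)"
    using R_distinct[OF x] unfolding xs by auto
  have "x0 < 6" "x1 < 6" "x2 < 6" using R_set[OF x] unfolding l by auto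
  then have in6: "x0 \<in> set [0, 1, 2, 3, 4, 5]" "x1 \<in> set [0, 1, 2, 3, 4, 5]" "x2 \<in> set [0, 1, 2, 3, 4, 5]"
    by auto
  have "test6b x0" using check_matchings in6(1) unfolding every_iff by blast
  then have "test6a x0 x1" using in6(2) unfolding test6b_def every_iff by blast
  then have "test6 x0 x1 x2" using in6(3) unfolding test6a_def every_iff by blast
  then have "some_3_cycle [cyc5, xs] words6" using ne unfolding test6_def xs by (simp only: if_False)
  then show ?thesis by (rule R_some_3_cycle) (use x R_cyc5 in \<open>auto simp: words6_def\<close>)
qed

lemma mate_cases:
  "u < 6 \<Longrightarrow> v < 6 \<Longrightarrow> {e u, e v} = {e 5, e 0} \<or> {e u, e v} = {e 1, e 2} \<or> {e u, e v} = {e 3, e 4} \<Longrightarrow> v = mate u"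
  by (auto simp: doubleton_eq_iff e_inj mate_def)

text \<open>Shifting back by b = xs ! 0 makes 0 fixed as well, and the certificate then leaves only
  a multiplication.\<close>

lemma affine_form:
  assumes no3: "\<not> (\<exists>t\<in>G. card (supp t) = 3)" and x: "R xs" and x5: "xs ! 5 = 5"
  shows "\<exists>a\<in>{1, 2, 3, 4}. xs = L5 a (xs ! 0) 0 1 \<and> R (L5 a 0 0 1) \<and> xs ! 0 < 5"
proof -
  define b where "b = xs ! 0"
  have "distinct xs" "length xs = 6" using R_distinct[OF x] R_length[OF x] by auto
  then have "b \<noteq> 5" using x5 nth_eq_iff_index_eq[of xs 0 5] by (simp add: b_def)
  then have b: "b < 5" using R_nth[OF x, of 0] by (simp add: b_def)
  let ?s = "cmp (pw (5 - b) cyc5) xs"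
  have Rs: "R ?s" and s0: "?s ! 0 = 0" and s5: "?s ! 5 = 5"
    using R_unshift[OF b x] x5 by (simp_all add: b_def)
  obtain p where p: "p \<in> set (perms [1, 2, 3, 4])" "?s = 0 # p @ [5]"
    by (rule R_middle[OF Rs s0 s5 refl])
  have "test5 p" using check_affine p(1) unfolding every_iff by blast
  moreover have "\<not> some_3_cycle [cyc5, ?s] words5"
  proof
    assume "some_3_cycle [cyc5, ?s] words5"
    then have "\<exists>t\<in>G. card (supp t) = 3"
      by (rule R_some_3_cycle) (use Rs R_cyc5 in \<open>auto simp: words5_def\<close>)
    then show False using no3 by blast
  qed
  ultimately have "affine5 ?s" unfolding test5_def p(2) by (simp split: if_splits)
  then obtain a where a: "a \<in> {1, 2, 3, 4}" "?s = L5 a 0 0 1" unfolding affine5_def by (auto split: if_splits)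
  have "every (shift5 a) [0, 1, 2, 3, 4]"
    using check_shift5 a(1) unfolding every_iff shift5a_def by (metis list.simps(15) list.set(1))
  moreover have "b \<in> set [0, 1, 2, 3, 4]" using b by auto
  ultimately have "shift5 a b" unfolding every_iff by blast
  then have "xs = L5 a b 0 1" using R_cmp_cancel[OF b x] unfolding shift5_def a(2) by simp
  then show ?thesis using a Rs b unfolding b_def by metis
qed

lemma L5_shift: "a \<in> {1, 2, 3, 4} \<Longrightarrow> b < 5 \<Longrightarrow> L5 a b 0 1 = cmp (pw b cyc5) (L5 a 0 0 1)"
proof -
  assume a: "a \<in> {1, 2, 3, 4}" and b: "b < 5"
  have "a \<in> set [1, 2, 3, 4]" "b \<in> set [0, 1, 2, 3, 4]" using a b by auto
  then show ?thesis using check_shift5 unfolding every_iff shift5a_def shift5_def by blast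
qed

text \<open>An affine map carrying {0, 1} to {0, 2} has multiplier 2 or 3, and both generate the
  multiplicative group modulo 5.\<close>

lemma AGL_if_affine:
  assumes no3: "\<not> (\<exists>t\<in>G. card (supp t) = 3)" and fix5: "\<And>xs. R xs \<Longrightarrow> xs ! 5 = 5"
    and z: "R zs" "{zs ! 0, zs ! 1} = {0, 2}"
  shows "\<And>a b. a \<in> {1, 2, 3, 4} \<Longrightarrow> b < 5 \<Longrightarrow> R (L5 a b 0 1)"
proof -
  obtain m where m: "m \<in> {1, 2, 3, 4}" "zs = L5 m (zs ! 0) 0 1" "R (L5 m 0 0 1)" "zs ! 0 < 5"
    using affine_form[OF no3 z(1) fix5[OF z(1)]] by blast
  have z1: "zs ! 1 = (m + zs ! 0) mod 5"
    by (subst m(2)) (use m(1,4) in \<open>auto simp: L5_def mobius_def f5_add_def f5_mul_def f5_inv_def\<close>)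
  have "(zs ! 0 = 0 \<and> zs ! 1 = 2) \<or> (zs ! 0 = 2 \<and> zs ! 1 = 0)" using z(2) unfolding doubleton_eq_iff .
  moreover have "m = 1 \<or> m = 2 \<or> m = 3 \<or> m = 4" using m(1) by simp
  ultimately have "m = 2 \<or> m = 3" using z1 by (elim disjE conjE; simp)
  then have "R (L5 2 0 0 1) \<and> R (L5 3 0 0 1) \<and> R (L5 4 0 0 1)"
    using R_pw[OF m(3), of 2] R_pw[OF m(3), of 3] m(3) check_multipliers by (elim disjE) auto
  moreover have "R (L5 1 0 0 1)" using R_id unfolding check_multipliers(5) upt_6 .
  ultimately have "R (L5 a 0 0 1)" if "a \<in> {1, 2, 3, 4}" for a using that by auto
  then show "R (L5 a b 0 1)" if "a \<in> {1, 2, 3, 4}" "b < 5" for a b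
    using R_comp[OF R_pw[OF R_cyc5]] L5_shift[OF that] that by simp
qed

end

text \<open>The five moved points are labelled along the cycle, and the single fixed point becomes
  5.\<close>

lemma (in perm_group) five_cycle_rep:
  assumes om: "card \<Omega> = 6" and d: "5 dvd card G"
  obtains e where "list_rep_5_cycle G \<Omega> e"
proof -
  have p5: "prime (5::nat)" by simp
  obtain c where c: "c \<in> G" "c ^^ 5 = id" "card (supp c) = 5"
    by (rule Cauchy_cycle[OF p5 d]) (use om in auto)
  have "supp c \<noteq> {}" using c(3) by auto
  then obtain x0 where x0: "x0 \<in> supp c" by blast
  have "card (\<Omega> - supp c) = 1" using om c(3) supp_subset[OF c(1)] finite_supp[OF c(1)] by (simp add: card_Diff_subset)
  then obtain f where f: "\<Omega> - supp c = {f}" by (auto simp: card_1_singleton_iff)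
  define e where "e i = (if i < 5 then (c ^^ i) x0 else f)" for i :: nat
  have bij: "bij_betw e {..<6} \<Omega>"
  proof -
    have "bij_betw e {..<5} (supp c)"
      using cycle_enumeration[OF p5 c x0] by (rule bij_betw_cong[THEN iffD1, rotated]) (simp add: e_def)
    moreover have "bij_betw e {5} {f}" by (simp add: bij_betw_def e_def)
    ultimately have "bij_betw e ({..<5} \<union> {5}) (supp c \<union> {f})"
      by (rule bij_betw_combine) (use f in auto)
    moreover have "{..<5} \<union> {5} = {..<6::nat}" by auto
    moreover have "supp c \<union> {f} = \<Omega>" using f supp_subset[OF c(1)] by blast
    ultimately show ?thesis by simp
  qed
  interpret list_rep G \<Omega> e 6 by unfold_locales (rule bij)
  have "R cyc5" unfolding R_def
  proof (intro conjI bexI[OF _ c(1)] allI impI)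
    fix i :: nat assume "i < 6"
    then have i: "i \<in> {0, 1, 2, 3, 4, 5}" by auto
    have "c ((c ^^ 4) x0) = x0" using fun_cong[OF c(2), of x0] by (simp add: numeral_eq_Suc)
    moreover have "f \<notin> supp c" using f by blast
    then have "c f = f" unfolding supp_def by blast
    ultimately show "c (e i) = e (cyc5 ! i)" using i by (auto simp: e_def cyc5_def numeral_eq_Suc)
  qed (auto simp: cyc5_def)
  then have "list_rep_5_cycle G \<Omega> e" by unfold_locales
  then show ?thesis by (rule that)
qed

context lambda_group begin

lemma degree_6_pairs_3_cycle:
  assumes n: "n = 6" and k: "k = 2"
  shows "\<exists>t\<in>G. card (supp t) = 3"
proof -
  have d: "5 dvd card G" by (rule prime_dvd_order) (use n k in auto)
  obtain e where e: "list_rep_5_cycle G {1..n} e" by (rule five_cycle_rep[OF _ d]) (use n in simp)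
  interpret L: list_rep_5_cycle G "{1..n}" e by (rule e)
  have m: "n div k = 3" using n k by simp
  have l3: "{..<3} = {0, 1, 2 :: nat}" by auto
  have im: "{1..n} = {e 5, e 0, e 1, e 4, e 2, e 3}"
  proof -
    have "{..<6} = {5, 0, 1, 4, 2, 3 :: nat}" by auto
    then show ?thesis using L.e_bij unfolding bij_betw_def by simp
  qed
  have part: "ordered_partition_type n k (\<lambda>i. if i = 0 then {e 5, e 0} else if i = 1 then {e a, e b} else {e c, e d})"
    if "[a, b, c, d] \<in> {[1, 4, 2, 3], [1, 2, 3, 4]}" for a b c d
  proof -
    have abcd: "{e a, e b, e c, e d} = {e 1, e 4, e 2, e 3}" "a < 6" "b < 6" "c < 6" "d < 6" "distinct [a, b, c, d, 5, 0]"
      using that by auto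
    have ne: "e i \<noteq> e j" if "i < 6" "j < 6" "i \<noteq> j" for i j using L.e_inj that by simp
    have ne': "e a \<noteq> e b" "e a \<noteq> e c" "e a \<noteq> e d" "e b \<noteq> e c" "e b \<noteq> e d" "e c \<noteq> e d" "e 5 \<noteq> e 0"
      "e 5 \<noteq> e a" "e 5 \<noteq> e b" "e 5 \<noteq> e c" "e 5 \<noteq> e d" "e 0 \<noteq> e a" "e 0 \<noteq> e b" "e 0 \<noteq> e c" "e 0 \<noteq> e d"
      using abcd(2-6) by (intro ne; simp)+
    have im': "{1..n} = {e 5, e 0, e a, e b, e c, e d}" using im abcd(1) by simp
    have all3: "(\<forall>i<3. Q i) \<longleftrightarrow> Q 0 \<and> Q 1 \<and> Q (2::nat)" for Q by (auto simp: less_Suc_eq numeral_eq_Suc)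
    show ?thesis unfolding ordered_partition_type_def m unfolding k all3 l3 im'
      using ne' ne'[symmetric] by (simp add: insert_commute)
  qed
  \<comment> \<open>The two matchings lie in different orbits of PGL(2,5): the second is given by
    the involution x \<mapsto> 2 / x, but an involution c / x with 1 \<mapsto> 4 would fix 2. So g
    is outside the group that the 5-cycle alone cannot exclude.\<close>
  obtain g where g: "g \<in> G" "(\<lambda>i. g ` (if i = 0 then {e 5, e 0} else if i = 1 then {e 1, e 4} else {e 2, e 3})) ` {..<n div k}
      = (\<lambda>i. if i = 0 then {e 5, e 0} else if i = 1 then {e 1, e 2} else {e 3, e 4}) ` {..<n div k}"
    by (rule homogeneous[OF part[of 1 4 2 3, OF insertI1] part[of 1 2 3 4, OF insertI2[OF singletonI]]])
  obtain xs where xs: "L.R xs" "\<And>i. i < 6 \<Longrightarrow> g (e i) = e (xs ! i)" using L.R_of[OF g(1)] by blast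
  have "{{g (e 5), g (e 0)}, {g (e 1), g (e 4)}, {g (e 2), g (e 3)}} = {{e 5, e 0}, {e 1, e 2}, {e 3, e 4}}"
    using g(2) unfolding m l3 by (simp, blast)
  then have "{{e (xs ! 5), e (xs ! 0)}, {e (xs ! 1), e (xs ! 4)}, {e (xs ! 2), e (xs ! 3)}}
      \<subseteq> {{e 5, e 0}, {e 1, e 2}, {e 3, e 4}}"
    using xs(2) by simp
  then have "xs ! 5 = mate (xs ! 0)" "xs ! 4 = mate (xs ! 1)" "xs ! 3 = mate (xs ! 2)"
    using L.mate_cases[OF L.R_nth[OF xs(1)] L.R_nth[OF xs(1)], of 0 5]
      L.mate_cases[OF L.R_nth[OF xs(1)] L.R_nth[OF xs(1)], of 1 4]
      L.mate_cases[OF L.R_nth[OF xs(1)] L.R_nth[OF xs(1)], of 2 3] insert_commute[of "e (xs ! 0)"] by simp_all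
  then show ?thesis by (rule L.matching_3_cycle[OF xs(1)])
qed

end

context lambda_group_fix begin

lemma fixed_degree_5_pairs:
  assumes n: "n = 6" and k: "k = 2"
  shows fixes_and_alt_or_sym
proof -
  obtain t where t: "t \<in> G" "card (supp t) = 3" using degree_6_pairs_3_cycle[OF n k] by blast
  have "multitrans 3 G ({1..n} - {a})" by (rule P.degree_5_multitrans[OF _ transP t]) (use cardP n in simp)
  then show ?thesis using conclude P.multitrans_has_3_cycles t by blast
qed

lemma fixed_degree_5_halves:
  assumes n: "n = 6" and k: "k = 3"
  shows "fixes_and_alt_or_sym \<or> perm_conj 6 G AGL_1_5_fix"
proof (cases "\<exists>t\<in>G. card (supp t) = 3")
  case True
  then obtain t where t: "t \<in> G" "card (supp t) = 3" by blast
  have "multitrans 3 G ({1..n} - {a})" by (rule P.degree_5_multitrans[OF _ transP t]) (use cardP n in simp)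
  then show ?thesis using conclude P.multitrans_has_3_cycles t by blast
next
  case no3: False
  have d: "5 dvd card G" by (rule prime_dvd_order) (use n k in auto)
  obtain e where e: "list_rep_5_cycle G {1..n} e" by (rule five_cycle_rep[OF _ d]) (use n in simp)
  interpret L: list_rep_5_cycle G "{1..n}" e by (rule e)
  obtain j where j: "j < 6" "a = e j" using L.e_surj[OF a] by blast
  have fixj: "xs ! j = j" if x: "L.R xs" for xs
  proof -
    obtain g where g: "g \<in> G" "\<And>i. i < 6 \<Longrightarrow> g (e i) = e (xs ! i)" using L.R_elem[OF x] by blast
    then have "e j = e (xs ! j)" using fixed[OF g(1)] j by metis
    then show ?thesis using L.e_inj[OF j(1) L.R_nth[OF x j(1)]] by simp
  qed
  \<comment> \<open>The fixed point a is also fixed by the 5-cycle, whose only fixed label is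
    5.\<close>
  have "j = 5"
  proof -
    have "j \<in> {0, 1, 2, 3, 4, 5}" using j by auto
    then show ?thesis using fixj[OF L.R_cyc5] by (auto simp: cyc5_def)
  qed
  then have fix5: "xs ! 5 = 5" if "L.R xs" for xs using fixj that by simp
  have ae: "a = e 5" using j \<open>j = 5\<close> by simp
  have h: "homog 2 G ({1..n} - {a})" using fix_homog n k by simp
  have "\<exists>g\<in>G. g ` {e 0, e 1} = {e 0, e 2}"
    by (rule h[unfolded homog_def, rule_format]) (use ae in \<open>auto simp: L.e_inj L.e_in[simplified]\<close>)
  then obtain g where g: "g \<in> G" "{g (e 0), g (e 1)} = {e 0, e 2}" by auto
  obtain zs where zs: "L.R zs" "\<And>i. i < 6 \<Longrightarrow> g (e i) = e (zs ! i)" using L.R_of[OF g(1)] by blast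
  have z02: "{zs ! 0, zs ! 1} = {0, 2}"
    using g(2) zs(2)[of 0] zs(2)[of 1] L.R_nth[OF zs(1)] by (auto simp: doubleton_eq_iff L.e_inj)
  have all: "L.R (L5 u b 0 1)" if "u \<in> {1, 2, 3, 4}" "b < 5" for u b
    by (rule L.AGL_if_affine[OF no3 fix5 zs(1) z02 that])
  have "perm_conj n G AGL_1_5_fix"
  proof (rule perm_conj_by_lists)
    show "list_rep G {1..n} e (Suc 5)" using L.list_rep_axioms by simp
    show "\<exists>f. h = lift_pl 5 f \<and> list_rep.R G e (Suc 5) (map f [0..<Suc 5])" if hA: "h \<in> AGL_1_5_fix" for h
    proof -
      obtain u b where ub: "h = lift_pl 5 (mobius f5_add f5_mul f5_inv 5 u b 0 1)" "u \<in> {1..4}" "b < 5"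
        using hA unfolding AGL_1_5_fix_def by blast
      have "u \<in> {1, 2, 3, 4}" using ub(2) by auto
      then have "L.R (L5 u b 0 1)" using all ub(3) by blast
      then show ?thesis using ub(1) unfolding upt_Suc_5 L5_def by auto
    qed
    show "\<exists>f. lift_pl 5 f \<in> AGL_1_5_fix \<and> map f [0..<Suc 5] = xs" if "list_rep.R G e (Suc 5) xs" for xs
    proof -
      have x: "L.R xs" using that by simp
      obtain u where u: "u \<in> {1, 2, 3, 4}" "xs = L5 u (xs ! 0) 0 1" "xs ! 0 < 5"
        using L.affine_form[OF no3 x fix5[OF x]] by blast
      have "u \<in> {1..4}" using u(1) by auto
      then have "lift_pl 5 (mobius f5_add f5_mul f5_inv 5 u (xs ! 0) 0 1) \<in> AGL_1_5_fix"
        using u(3) unfolding AGL_1_5_fix_def by blast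
      moreover have "map (mobius f5_add f5_mul f5_inv 5 u (xs ! 0) 0 1) [0..<Suc 5] = xs"
        using u(2) unfolding upt_Suc_5 L5_def by simp
      ultimately show ?thesis by blast
    qed
  qed simp
  then show ?thesis using n by simp
qed

end

section \<open>Degree 6: the group PSL(2,5)\<close>

context list_rep_5_cycle begin

lemma R_sgn5:
  assumes "R inv5 \<and> R neg5" shows "R (sgn5 s)"
  using assms R_id unfolding sgn5_def upt_6 by simp

text \<open>An element is reduced by shifts and by x \<mapsto> -1 / x until it fixes both infinity
  and 0. There the invariant triples leave only x and -x, and undoing the reduction gives the normal
  form.\<close>

lemma PSL_form:
  assumes pres: "\<And>xs. R xs \<Longrightarrow> preserving xs" and gens: "R inv5" "R neg5" and x: "R xs"
  shows "\<exists>s\<in>{1, 4}. \<exists>i<5. xs = L5 s i 0 1 \<or> (\<exists>k<5. xs = L5 (s * i mod 5) ((i * k + 4) mod 5) s k)"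
proof -
  have base: "\<exists>s\<in>{1, 4}. \<exists>k<5. y = cmp (pw k cyc5) (sgn5 s)" if y: "R y" "y ! 5 = 5" for y
  proof -
    define k where "k = y ! 0"
    have "distinct y" "length y = 6" using R_distinct[OF y(1)] R_length[OF y(1)] by auto
    then have "k \<noteq> 5" using y(2) nth_eq_iff_index_eq[of y 0 5] by (simp add: k_def)
    then have k: "k < 5" using R_nth[OF y(1), of 0] by (simp add: k_def)
    let ?s = "cmp (pw (5 - k) cyc5) y"
    have Rs: "R ?s" and s0: "?s ! 0 = 0" and s5: "?s ! 5 = 5"
      using R_unshift[OF k y(1)] y(2) by (simp_all add: k_def)
    obtain p where p: "p \<in> set (perms [1, 2, 3, 4])" "?s = 0 # p @ [5]"
      by (rule R_middle[OF Rs s0 s5 refl])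
    have "test_fix p" using check_stabilizer(1) p(1) unfolding every_iff by blast
    then have "?s = [0, 1, 2, 3, 4, 5] \<or> ?s = neg5"
      using pres[OF Rs] unfolding test_fix_def p(2) by (simp only: if_True)
    then have "?s = sgn5 1 \<or> ?s = sgn5 4" by (simp add: sgn5_def)
    then obtain s where s: "s \<in> {1, 4}" "?s = sgn5 s" by blast
    have "y = cmp (pw k cyc5) (sgn5 s)" using R_cmp_cancel[OF k y(1)] unfolding s(2) by simp
    then show ?thesis using s(1) k by blast
  qed
  show ?thesis
  proof (cases "xs ! 5 = 5")
    case True
    then obtain s k where sk: "s \<in> {1, 4}" "k < 5" "xs = cmp (pw k cyc5) (sgn5 s)" using base[OF x] by blast
    have "s \<in> set [1, 4]" "k \<in> set [0, 1, 2, 3, 4]" using sk by auto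
    then have "lower5 s k" using check_normal_form5(1) unfolding every_iff lower5a_def by blast
    then have "xs = L5 s k 0 1" using sk(3) unfolding lower5_def by simp
    then show ?thesis using sk by blast
  next
    case False
    define i where "i = xs ! 5"
    have i: "i < 5" using False R_nth[OF x, of 5] by (simp add: i_def)
    let ?y = "cmp (pw (5 - i) cyc5) xs"
    have Ry: "R ?y" and y5: "?y ! 5 = 0" using R_unshift[OF i x] by (simp_all add: i_def)
    let ?z = "cmp inv5 ?y"
    have Rz: "R ?z" by (rule R_comp[OF gens(1) Ry])
    have z5: "?z ! 5 = 5" using y5 R_length[OF Ry] by (simp add: cmp_nth inv5_def)
    obtain s k where sk: "s \<in> {1, 4}" "k < 5" "?z = cmp (pw k cyc5) (sgn5 s)" using base[OF Rz z5] by blast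
    have "cmp inv5 ?z = cmp (cmp inv5 inv5) ?y"
      by (rule cmp_assoc[symmetric]) (use R_set[OF Ry] in \<open>simp add: inv5_def\<close>)
    also have "\<dots> = ?y" unfolding check_inv5(4) upt_6[symmetric]
      by (rule cmp_upt) (use R_set[OF Ry] in simp)
    finally have "xs = cmp (pw i cyc5) (cmp inv5 (cmp (pw k cyc5) (sgn5 s)))"
      using R_cmp_cancel[OF i x] unfolding sk(3) by simp
    moreover have "s \<in> set [1, 4]" "i \<in> set [0, 1, 2, 3, 4]" "k \<in> set [0, 1, 2, 3, 4]" using sk i by auto
    then have "upper5 s i k" using check_normal_form5(2) unfolding every_iff upper5a_def upper5b_def by blast
    ultimately have "xs = L5 (s * i mod 5) ((i * k + 4) mod 5) s k" unfolding upper5_def by simp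
    then show ?thesis using sk i by blast
  qed
qed

lemma PSL_members:
  assumes gens: "R inv5" "R neg5" and lt: "a < 5" "b < 5" "c < 5" "d < 5"
    and t: "(a * d + 4 * (b * c)) mod 5 = 1 \<or> (a * d + 4 * (b * c)) mod 5 = 4"
  shows "R (L5 a b c d)"
proof -
  have "a \<in> set [0, 1, 2, 3, 4]" "b \<in> set [0, 1, 2, 3, 4]" "c \<in> set [0, 1, 2, 3, 4]" "d \<in> set [0, 1, 2, 3, 4]"
    using lt by auto
  then have "member5 a b c d"
    using check_members5 unfolding every_iff member5a_def member5b_def member5c_def by blast
  moreover have "R (sgn5 s)" for s using R_sgn5 gens by blast
  ultimately show ?thesis
    using t R_comp R_pw[OF R_cyc5] gens(1) unfolding member5_def Let_def by (simp split: if_splits)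
qed

text \<open>2-transitivity provides an element exchanging 0 and infinity, which must be 1 / x or -1
  / x. In either case explicit words with x + 1 give both required generators.\<close>

lemma PSL_if_preserving:
  assumes pres: "\<And>xs. R xs \<Longrightarrow> preserving xs" and mt: "multitrans 2 G \<Omega>"
  shows "R inv5 \<and> R neg5"
proof -
  obtain ys where ys: "R ys" "map (\<lambda>i. ys ! i) [0, 5] = [5, 0]"
    by (rule multitrans_R[OF mt, of "[0, 5]" "[5, 0]"]) auto
  obtain p where p: "p \<in> set (perms [1, 2, 3, 4])" "ys = 5 # p @ [0]"
    by (rule R_middle[OF ys(1), of 5 0]) (use ys(2) in auto)
  have "test_swap p" using check_stabilizer(2) p(1) unfolding every_iff by blast
  then have "ys = inv5 \<or> ys = inv5a"
    using pres[OF ys(1)] unfolding test_swap_def p(2) by (simp only: if_True)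
  moreover have "R (wp [cyc5, ys] w)" if "\<forall>i\<in>set w. i < 2" for w
    by (rule R_wp) (use R_cyc5 ys(1) that in auto)
  ultimately show ?thesis
  proof (elim disjE)
    assume y: "ys = inv5" and w: "\<And>w. \<forall>i\<in>set w. i < 2 \<Longrightarrow> R (wp [cyc5, ys] w)"
    have "R (wp [cyc5, inv5] [0, 0, 1, 0, 0, 0, 1, 0, 0, 1])" unfolding y[symmetric] by (rule w) simp
    then show ?thesis using ys(1) y unfolding check_inv5 by simp
  next
    assume y: "ys = inv5a" and w: "\<And>w. \<forall>i\<in>set w. i < 2 \<Longrightarrow> R (wp [cyc5, ys] w)"
    have "R (wp [cyc5, inv5a] [0, 1, 0, 0, 0, 0, 1, 0])" "R (wp [cyc5, inv5a] [0, 1, 0, 0, 0, 0, 1, 0, 1])"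
      unfolding y[symmetric] by (rule w, simp)+
    then show ?thesis unfolding check_inv5 by simp
  qed
qed

end

lemma triple_alternatives:
  assumes "a < 6" "b < 6" "c < 6" "a \<noteq> b" "a \<noteq> c" "b \<noteq> c" "\<not> triple a b c"
  shows "{a, b, c} \<in> {{0, 1, 2}, {1, 2, 3}, {2, 3, 4}, {0, 3, 4}, {0, 1, 4}, {0, 2, 5}, {1, 3, 5}, {2, 4, 5}, {0, 3, 5}, {1, 4, 5}}"
proof -
  have "a = 0 \<or> a = 1 \<or> a = 2 \<or> a = 3 \<or> a = 4 \<or> a = 5" "b = 0 \<or> b = 1 \<or> b = 2 \<or> b = 3 \<or> b = 4 \<or> b = 5"
    "c = 0 \<or> c = 1 \<or> c = 2 \<or> c = 3 \<or> c = 4 \<or> c = 5" using assms(1-3) by auto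
  then show ?thesis using assms(4-)
    by (elim disjE; simp only: triple_def cyc5_def; simp add: insert_commute)
qed

text \<open>If G is not 3-homogeneous, the 3-subsets form two orbits exchanged by complementation.
  The orbit of {0, 1, 5} is forced by the 5-cycle and 2-transitivity to be the set of triples
  described by \<open>triple\<close>, and preserving it pins down G.\<close>

lemma (in lambda_group) degree_6_halves:
  assumes n: "n = 6" and k: "k = 3" and tr: "transitive G {1..n}"
  shows "lambda_transitive n k G \<or> perm_conj 6 G PSL_2_5"
proof (cases "homog 3 G {1..n}")
  case True
  then show ?thesis using lambda_transitive_if_homog n k by simp
next
  case nh: False
  have n2k: "n = 2 * k" using n k by simp
  have d: "5 dvd card G" by (rule prime_dvd_order) (use n k in auto)
  have p5: "prime (5::nat)" by simp
  obtain c where c: "c \<in> G" "c ^^ 5 = id" "card (supp c) = 5" by (rule Cauchy_cycle[OF p5 d]) (use n in auto)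
  have "multitrans (Suc 1) G {1..n}"
    by (rule Jordan_multitrans[OF perm_group_axioms tr p5 c]) (use n in auto)
  then have mt: "multitrans 2 G {1..n}" by (simp add: numeral_2_eq_2)
  obtain e where e: "list_rep_5_cycle G {1..n} e" by (rule five_cycle_rep[OF _ d]) (use n in simp)
  interpret L: list_rep_5_cycle G "{1..n}" e by (rule e)
  \<comment> \<open>The orbit of {0, 1, 5}, written in labels.\<close>
  define T where "T S \<longleftrightarrow> (\<exists>g\<in>G. g ` e ` {0, 1, 5} = e ` S)" for S
  have eS: "e ` S \<subseteq> {1..n}" "card (e ` S) = card S" if "S \<subseteq> {..<6}" for S
  proof -
    have i: "inj_on e {..<6}" and im: "e ` {..<6} = {1..n}" using L.e_bij unfolding bij_betw_def by blast+
    show "e ` S \<subseteq> {1..n}" unfolding im[symmetric] by (rule image_mono[OF that])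
    show "card (e ` S) = card S" by (rule card_image[OF inj_on_subset[OF i that]])
  qed
  have compl: "e ` ({..<6} - S) = {1..n} - e ` S" if "S \<subseteq> {..<6}" for S
  proof -
    have i: "inj_on e {..<6}" and im: "e ` {..<6} = {1..n}" using L.e_bij unfolding bij_betw_def by blast+
    show ?thesis unfolding im[symmetric] by (rule inj_on_image_set_diff[OF i Diff_subset that])
  qed
  \<comment> \<open>If the orbit contained both a set and its complement, some element would
    exchange the base triple with its complement, and unordered homogeneity would become
    3-homogeneity.\<close>
  have T_compl: "T ({..<6} - S) \<longleftrightarrow> \<not> T S" if S: "S \<subseteq> {..<6}" "card S = 3" for S
  proof
    assume nT: "\<not> T S"
    obtain g where g: "g \<in> G" "g ` e ` {0, 1, 5} = e ` S \<or> g ` e ` {0, 1, 5} = {1..n} - e ` S"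
    proof -
      have B: "{0, 1, 5} \<subseteq> {..<6::nat}" by auto
      have c: "card (e ` {0, 1, 5}) = k" "card (e ` S) = k" using eS(2)[OF B] eS(2)[OF S(1)] S(2) k by simp_all
      show ?thesis using halves_homogeneous[OF n2k eS(1)[OF B] c(1) eS(1)[OF S(1)] c(2)] that by (rule bexE)
    qed
    then show "T ({..<6} - S)" using nT unfolding T_def compl[OF S(1)] by blast
  next
    assume T1: "T ({..<6} - S)"
    show "\<not> T S"
    proof
      assume "T S"
      then obtain g where g: "g \<in> G" "g ` e ` {0, 1, 5} = e ` S" unfolding T_def by blast
      obtain h where h: "h \<in> G" "h ` e ` {0, 1, 5} = {1..n} - e ` S"
        using T1 unfolding T_def compl[OF S(1)] by blast
      let ?B = "e ` {0, 1, 5}"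
      have B: "?B \<subseteq> {1..n}" "card ?B = k" using eS[of "{0, 1, 5}"] k by auto
      let ?u = "inv' g \<circ> h"
      have uG: "?u \<in> G" by (rule comp[OF inv[OF g(1)] h(1)])
      have "bij g" using perm[OF g(1)] permutes_bij by blast
      have "?u ` ?B = inv' g ` ({1..n} - g ` ?B)" by (simp only: image_comp[symmetric] h(2) g(2))
      also have "\<dots> = inv' g ` {1..n} - inv' g ` g ` ?B"
        by (rule image_set_diff[OF inj[OF inv[OF g(1)]]])
      also have "\<dots> = {1..n} - ?B"
        by (simp only: im_Omega[OF inv[OF g(1)]] image_inv_f_f[OF inj[OF g(1)]])
      finally have u: "?u ` ?B = {1..n} - ?B" .
      have all: "\<exists>w\<in>G. w ` ?B = A" if A: "A \<subseteq> {1..n}" "card A = 3" for A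
      proof -
        obtain w where w: "w \<in> G" "w ` ?B = A \<or> w ` ?B = {1..n} - A"
          using halves_homogeneous[OF n2k B A(1)] A(2) k by blast
        show ?thesis
        proof (cases "w ` ?B = A")
          case False
          then have wB: "w ` ?B = {1..n} - A" using w(2) by blast
          have "(w \<circ> ?u) ` ?B = w ` ({1..n} - ?B)" unfolding image_comp[symmetric] u[unfolded image_comp[symmetric]] ..
          also have "\<dots> = A"
            by (simp only: image_set_diff[OF inj[OF w(1)]] im_Omega[OF w(1)] wB double_diff[OF A(1) order_refl])
          finally show ?thesis using comp[OF w(1) uG] by blast
        qed (use w(1) in blast)
      qed
      have "homog 3 G {1..n}" unfolding homog_def
      proof (intro allI impI)
        fix A C assume AC: "A \<subseteq> {1..n}" "C \<subseteq> {1..n}" "card A = 3" "card C = 3"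
        obtain w1 w2 where w: "w1 \<in> G" "w1 ` ?B = A" "w2 \<in> G" "w2 ` ?B = C" using all AC by metis
        have "(w2 \<circ> inv' w1) ` A = w2 ` inv' w1 ` w1 ` ?B" by (simp only: image_comp[symmetric] w(2))
        also have "\<dots> = C" by (simp only: image_inv_f_f[OF inj[OF w(1)]] w(4))
        finally show "\<exists>g\<in>G. g ` A = C" using comp[OF w(3) inv[OF w(1)]] by blast
      qed
      then show False using nh by simp
    qed
  qed
  have T_R: "T ((!) xs ` S)" if x: "L.R xs" and S: "S \<subseteq> {..<6}" "T S" for xs S
  proof -
    obtain g where g: "g \<in> G" "\<And>i. i < 6 \<Longrightarrow> g (e i) = e (xs ! i)" using L.R_elem[OF x] by blast
    obtain h where h: "h \<in> G" "h ` e ` {0, 1, 5} = e ` S" using S(2) unfolding T_def by blast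
    have "(g \<circ> h) ` e ` {0, 1, 5} = g ` e ` S" by (simp only: image_comp[symmetric] h(2))
    also have "\<dots> = e ` (!) xs ` S" using g(2) S(1) by (auto simp: image_image intro!: image_cong)
    finally show ?thesis unfolding T_def using comp[OF g(1) h(1)] by blast
  qed
  have l6: "{..<6} = {0, 1, 2, 3, 4, 5 :: nat}" by auto
  have T0: "T {0, 1, 5}" unfolding T_def by (rule bexI[OF _ one]) simp
  have T_cyc: "T ((!) cyc5 ` S)" if "S \<subseteq> {..<6}" "T S" for S by (rule T_R[OF L.R_cyc5 that])
  have T1: "T {1, 2, 5}" using T_cyc[OF _ T0] by (simp add: cyc5_def)
  have T2: "T {2, 3, 5}" using T_cyc[OF _ T1] by (simp add: cyc5_def)
  have T3: "T {3, 4, 5}" using T_cyc[OF _ T2] by (simp add: cyc5_def)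
  have T4: "T {0, 4, 5}" using T_cyc[OF _ T3] by (simp add: cyc5_def insert_commute)
  \<comment> \<open>Otherwise all triples through 5 lie in the orbit. An element exchanging 5 and 0
    carries {1, 2, 5} to a triple avoiding 5, whose complement contains 5: both would be in the
    orbit.\<close>
  have "\<not> T {0, 2, 5}"
  proof
    assume U0: "T {0, 2, 5}"
    have U1: "T {1, 3, 5}" using T_cyc[OF _ U0] by (simp add: cyc5_def)
    have U2: "T {2, 4, 5}" using T_cyc[OF _ U1] by (simp add: cyc5_def)
    have U3: "T {0, 3, 5}" using T_cyc[OF _ U2] by (simp add: cyc5_def insert_commute)
    have U4: "T {1, 4, 5}" using T_cyc[OF _ U3] by (simp add: cyc5_def insert_commute)
    have all5: "T {i, j, 5}" if "i < 5" "j < 5" "i \<noteq> j" for i j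
      using less_5_cases[OF that(1)] less_5_cases[OF that(2)] that(3) T0 T1 T2 T3 T4 U0 U1 U2 U3 U4
      by (elim disjE; simp add: insert_commute)
    obtain xs where xs: "L.R xs" "map (\<lambda>i. xs ! i) [5, 0] = [0, 5]"
      by (rule L.multitrans_R[OF mt, of "[5, 0]" "[0, 5]"]) auto
    have nd: "xs ! i \<noteq> xs ! j" if "i < 6" "j < 6" "i \<noteq> j" for i j
      using nth_eq_iff_index_eq[OF L.R_distinct[OF xs(1)]] L.R_length[OF xs(1)] that by simp
    have x1: "xs ! 1 < 6" "xs ! 2 < 6" "xs ! 1 \<noteq> 5" "xs ! 2 \<noteq> 5" "xs ! 1 \<noteq> 0" "xs ! 2 \<noteq> 0" "xs ! 1 \<noteq> xs ! 2"
      using L.R_nth[OF xs(1)] xs(2) nd[of 1 0] nd[of 2 0] nd[of 1 5] nd[of 2 5] nd[of 1 2] by simp_all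
    have "T ((!) xs ` {1, 2, 5})" by (rule T_R[OF xs(1) _ T1]) auto
    then have t: "T {xs ! 1, xs ! 2, 0}" using xs(2) by simp
    obtain i j where ij: "{..<6} - {xs ! 1, xs ! 2, 0} = {i, j, 5}" "i < 5" "j < 5" "i \<noteq> j"
    proof -
      have "card ({..<5} - {xs ! 1, xs ! 2, 0}) = 2" using x1 by (simp add: card_Diff_subset)
      then obtain i j where ij: "{..<5} - {xs ! 1, xs ! 2, 0} = {i, j}" "i \<noteq> j" by (meson card_2_iff)
      have "{..<6} - {xs ! 1, xs ! 2, 0} = insert 5 ({..<5} - {xs ! 1, xs ! 2, 0 :: nat})"
        using x1(3,4) by auto
      then show ?thesis using that[of i j] ij by auto
    qed
    have "T {i, j, 5}" by (rule all5[OF ij(2-4)])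
    then show False using T_compl[of "{xs ! 1, xs ! 2, 0}"] ij(1) t x1 by simp
  qed
  then have "T ({..<6} - {0, 2, 5})" using T_compl[of "{0, 2, 5}"] by simp
  moreover have "{..<6} - {0, 2, 5} = {1, 3, 4 :: nat}" by auto
  ultimately have V0: "T {1, 3, 4}" by simp
  have V1: "T {0, 2, 4}" using T_cyc[OF _ V0] by (simp add: cyc5_def insert_commute)
  have V2: "T {0, 1, 3}" using T_cyc[OF _ V1] by (simp add: cyc5_def insert_commute)
  have V3: "T {1, 2, 4}" using T_cyc[OF _ V2] by (simp add: cyc5_def insert_commute)
  have V4: "T {0, 2, 3}" using T_cyc[OF _ V3] by (simp add: cyc5_def insert_commute)
  have no: "\<not> T S" if "T S'" "S \<union> S' = {..<6}" "S \<inter> S' = {}" "card S = 3" for S S'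
  proof -
    have "S' = {..<6} - S" using that(2,3) by auto
    then show ?thesis using T_compl[of S] that by auto
  qed
  have tri: "triple a b c" if abc: "a < 6" "b < 6" "c < 6" "a \<noteq> b" "a \<noteq> c" "b \<noteq> c" "T {a, b, c}" for a b c
  proof (rule ccontr)
    assume "\<not> triple a b c"
    note alt = triple_alternatives[OF abc(1-6) this]
    have "\<not> T {0, 1, 2}" "\<not> T {1, 2, 3}" "\<not> T {2, 3, 4}" "\<not> T {0, 3, 4}" "\<not> T {0, 1, 4}"
      by (rule no[OF T3], (auto)[3], rule no[OF T4], (auto)[3], rule no[OF T0], (auto)[3], rule no[OF T1], (auto)[3],
        rule no[OF T2]) auto
    moreover have "\<not> T {0, 2, 5}" "\<not> T {1, 3, 5}" "\<not> T {2, 4, 5}" "\<not> T {0, 3, 5}" "\<not> T {1, 4, 5}"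
      by (rule no[OF V0], (auto)[3], rule no[OF V1], (auto)[3], rule no[OF V2], (auto)[3], rule no[OF V3], (auto)[3],
        rule no[OF V4]) auto
    ultimately show False using alt abc(7) by (elim insertE emptyE; simp)
  qed
  have pres: "preserving xs" if x: "L.R xs" for xs
  proof -
    have t: "triple (xs ! u) (xs ! v) (xs ! w)"
      if uvw: "u < 6" "v < 6" "w < 6" "u \<noteq> v" "u \<noteq> w" "v \<noteq> w" "T {u, v, w}" for u v w
    proof (rule tri)
      show "T {xs ! u, xs ! v, xs ! w}" using T_R[OF x _ uvw(7)] uvw by simp
    qed (use uvw L.R_nth[OF x] nth_eq_iff_index_eq[OF L.R_distinct[OF x]] L.R_length[OF x] in auto)
    have "triple (xs ! 5) (xs ! 0) (xs ! 1)" "triple (xs ! 5) (xs ! 1) (xs ! 2)" "triple (xs ! 5) (xs ! 2) (xs ! 3)"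
      "triple (xs ! 5) (xs ! 3) (xs ! 4)" "triple (xs ! 0) (xs ! 1) (xs ! 3)"
      by (rule t; use T0 T1 T2 T3 V2 in \<open>simp add: insert_commute\<close>)+
    then show ?thesis unfolding preserving_def by simp
  qed
  have gens: "L.R inv5" "L.R neg5" using L.PSL_if_preserving[OF pres mt] by auto
  have "perm_conj n G PSL_2_5"
  proof (rule perm_conj_by_lists)
    show "list_rep G {1..n} e (Suc 5)" using L.list_rep_axioms by simp
    show "\<exists>f. h = lift_pl 5 f \<and> list_rep.R G e (Suc 5) (map f [0..<Suc 5])" if hA: "h \<in> PSL_2_5" for h
    proof -
      obtain a b c d t where q: "h = lift_pl 5 (mobius f5_add f5_mul f5_inv 5 a b c d)"
        "a < 5" "b < 5" "c < 5" "d < 5" "t \<in> {1..4}" "(t * t) mod 5 = (a * d + 4 * (b * c)) mod 5"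
        using hA unfolding PSL_2_5_def by blast
      have "t = 1 \<or> t = 2 \<or> t = 3 \<or> t = 4" using q(6) by auto
      then have "(t * t) mod 5 = 1 \<or> (t * t) mod 5 = 4" by (elim disjE) simp_all
      then have "L.R (L5 a b c d)" by (intro L.PSL_members gens q(2-5)) (simp only: q(7))
      then show ?thesis using q(1) unfolding upt_Suc_5 L5_def by auto
    qed
    show "\<exists>f. lift_pl 5 f \<in> PSL_2_5 \<and> map f [0..<Suc 5] = xs" if "list_rep.R G e (Suc 5) xs" for xs
    proof -
      have x: "L.R xs" using that by simp
      have mem: "lift_pl 5 (mobius f5_add f5_mul f5_inv 5 a b c d) \<in> PSL_2_5"
        if "a < 5" "b < 5" "c < 5" "d < 5" "(a * d + 4 * (b * c)) mod 5 = 1 \<or> (a * d + 4 * (b * c)) mod 5 = 4" for a b c d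
      proof -
        have "\<exists>t\<in>{1..4}. (t * t) mod 5 = (a * d + 4 * (b * c)) mod 5"
          using that(5)
        proof
          assume "(a * d + 4 * (b * c)) mod 5 = 1"
          then show ?thesis by (intro bexI[of _ 1]) simp_all
        next
          assume "(a * d + 4 * (b * c)) mod 5 = 4"
          then show ?thesis by (intro bexI[of _ 2]) simp_all
        qed
        then show ?thesis using that(1-4) unfolding PSL_2_5_def by blast
      qed
      obtain s i where s: "s \<in> {1, 4}" "i < 5"
        and alt: "xs = L5 s i 0 1 \<or> (\<exists>k<5. xs = L5 (s * i mod 5) ((i * k + 4) mod 5) s k)"
        using L.PSL_form[OF pres gens x] by blast
      have s': "s = 1 \<or> s = 4" using s(1) by simp
      from alt show ?thesis
      proof (elim disjE exE conjE)
        assume xs: "xs = L5 s i 0 1"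
        have "lift_pl 5 (mobius f5_add f5_mul f5_inv 5 s i 0 1) \<in> PSL_2_5"
          by (rule mem) (use s' s(2) in auto)
        then show ?thesis using xs unfolding upt_Suc_5 L5_def by blast
      next
        fix k :: nat assume k: "k < 5" and xs: "xs = L5 (s * i mod 5) ((i * k + 4) mod 5) s k"
        have "lift_pl 5 (mobius f5_add f5_mul f5_inv 5 (s * i mod 5) ((i * k + 4) mod 5) s k) \<in> PSL_2_5"
        proof (rule mem)
          show "(s * i mod 5 * k + 4 * ((i * k + 4) mod 5 * s)) mod 5 = 1 \<or>
              (s * i mod 5 * k + 4 * ((i * k + 4) mod 5 * s)) mod 5 = 4"
            using s' less_5_cases[OF s(2)] less_5_cases[OF k] by (elim disjE; simp)
        qed (use s' k in auto)
        then show ?thesis using xs unfolding upt_Suc_5 L5_def by blast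
      qed
    qed
  qed simp
  then show ?thesis using n by simp
qed

section \<open>Degree 9: the groups PSL(2,8) and P\<Gamma>L(2,8)\<close>

lemma upt_9: "[0..<9] = [0, 1, 2, 3, 4, 5, 6, 7, 8 :: nat]" and upt_Suc_8: "[0..<Suc 8] = [0, 1, 2, 3, 4, 5, 6, 7, 8 :: nat]"
  by (simp_all add: upt_rec)

lemma less_8_set: "a < 8 \<Longrightarrow> a \<in> set [0, 1, 2, 3, 4, 5, 6, 7 :: nat]"
  and less_8_set': "a < 8 \<Longrightarrow> a \<noteq> 0 \<Longrightarrow> a \<in> set [1, 2, 3, 4, 5, 6, 7 :: nat]"
  and less_9_set: "a < 9 \<Longrightarrow> a \<in> set [0, 1, 2, 3, 4, 5, 6, 7, 8 :: nat]"
  by auto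

lemma table8_facts:
  assumes "a < 8" "b < 8"
  shows "f8_add a b = add8 a b" "f8_mul a b = mul8 a b" "add8 a b < 8" "mul8 a b < 8"
proof -
  have "table8a a" using check_tables less_8_set[OF assms(1)] unfolding every_iff by blast
  then have "table8 a b" using less_8_set[OF assms(2)] unfolding table8a_def every_iff by blast
  then show "f8_add a b = add8 a b" "f8_mul a b = mul8 a b" "add8 a b < 8" "mul8 a b < 8"
    unfolding table8_def by blast+
qed

lemma inv8_facts:
  assumes "a < 8" shows "f8_inv a = inv8 a" "inv8 a < 8"
  using check_tables less_8_set[OF assms] unfolding every_iff table8a_def by blast+

lemma scaling8_facts:
  assumes l: "l < 8" "l \<noteq> 0"
  shows "mul8 l 0 = 0" "mul8 l (inv8 l) = 1" "mul8 (inv8 l) l = 1" "inv8 l \<noteq> 0"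
    "\<And>u v. u < 8 \<Longrightarrow> v < 8 \<Longrightarrow> mul8 (mul8 l u) v = mul8 l (mul8 u v)"
    "\<And>u v. u < 8 \<Longrightarrow> v < 8 \<Longrightarrow> add8 (mul8 l u) (mul8 l v) = mul8 l (add8 u v)"
    "\<And>u v. u < 8 \<Longrightarrow> v < 8 \<Longrightarrow> mul8 (mul8 l u) (mul8 l v) = mul8 (mul8 l l) (mul8 u v)"
    "\<And>u v. u < 8 \<Longrightarrow> v < 8 \<Longrightarrow> mul8 (mul8 l u) (inv8 (mul8 l v)) = mul8 u (inv8 v)"
    "\<And>u. u < 8 \<Longrightarrow> u \<noteq> 0 \<Longrightarrow> mul8 l u \<noteq> 0"
proof -
  have b: "scaling8b l" using check_scaling8 less_8_set'[OF l] unfolding every_iff by blast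
  then show "mul8 l 0 = 0" "mul8 l (inv8 l) = 1" "mul8 (inv8 l) l = 1" "inv8 l \<noteq> 0"
    unfolding scaling8b_def by blast+
  have nz: "scaling8a l u" if "u < 8" "u \<noteq> 0" for u
    using b less_8_set'[OF that] unfolding scaling8b_def every_iff by blast
  then show "mul8 l u \<noteq> 0" if "u < 8" "u \<noteq> 0" for u
    using that unfolding scaling8a_def by blast
  have s: "scaling8 l u v" if u: "u < 8" and v: "v < 8" for u v
  proof (cases "u = 0")
    case True
    then show ?thesis using b less_8_set[OF v] unfolding scaling8b_def every_iff by blast
  next
    case False
    then show ?thesis using nz[OF u] less_8_set[OF v] unfolding scaling8a_def every_iff by blast
  qed
  show "mul8 (mul8 l u) v = mul8 l (mul8 u v)" "add8 (mul8 l u) (mul8 l v) = mul8 l (add8 u v)"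
    "mul8 (mul8 l u) (mul8 l v) = mul8 (mul8 l l) (mul8 u v)"
    "mul8 (mul8 l u) (inv8 (mul8 l v)) = mul8 u (inv8 v)" if "u < 8" "v < 8" for u v
    using s[OF that] unfolding scaling8_def by blast+
qed

lemma L8_scale:
  assumes l: "l < 8" "l \<noteq> 0" and abcd: "a < 8" "b < 8" "c < 8" "d < 8"
  shows "L8 (mul8 l a) (mul8 l b) (mul8 l c) (mul8 l d) = L8 a b c d"
    "add8 (mul8 (mul8 l a) (mul8 l d)) (mul8 (mul8 l b) (mul8 l c)) = 0 \<longleftrightarrow> add8 (mul8 a d) (mul8 b c) = 0"
proof -
  note S = scaling8_facts[OF l]
  have z: "mul8 l u = 0 \<longleftrightarrow> u = 0" if "u < 8" for u using S(1) S(9)[OF that] by blast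
  have "mobius add8 mul8 inv8 8 (mul8 l a) (mul8 l b) (mul8 l c) (mul8 l d) x = mobius add8 mul8 inv8 8 a b c d x"
    if x: "x < 8 \<or> x = 8" for x
  proof (cases "x = 8")
    case True
    then show ?thesis using abcd by (simp add: mobius_def z S(8))
  next
    case False
    then have x8: "x < 8" using x by simp
    have "add8 (mul8 c x) d < 8" "add8 (mul8 a x) b < 8" "mul8 a x < 8" "mul8 c x < 8"
      using table8_facts(3,4) abcd x8 by simp_all
    then show ?thesis using False abcd x8 by (simp add: mobius_def Let_def z S(5,6,8))
  qed
  then show "L8 (mul8 l a) (mul8 l b) (mul8 l c) (mul8 l d) = L8 a b c d" unfolding L8_def by simp
  have ll: "mul8 l l < 8" "mul8 l l \<noteq> 0" using table8_facts(4)[OF l(1) l(1)] S(9)[OF l] by blast+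
  have lt: "mul8 a d < 8" "mul8 b c < 8" "add8 (mul8 a d) (mul8 b c) < 8"
    using table8_facts(3,4) abcd by simp_all
  have "add8 (mul8 (mul8 l a) (mul8 l d)) (mul8 (mul8 l b) (mul8 l c)) = mul8 (mul8 l l) (add8 (mul8 a d) (mul8 b c))"
    using abcd scaling8_facts(6)[OF ll lt(1,2)] by (simp add: S(7))
  then show "add8 (mul8 (mul8 l a) (mul8 l d)) (mul8 (mul8 l b) (mul8 l c)) = 0 \<longleftrightarrow> add8 (mul8 a d) (mul8 b c) = 0"
    using scaling8_facts(1)[OF ll] scaling8_facts(9)[OF ll lt(3)] by metis
qed

lemma mobius_tables:
  assumes abcd: "a < 8" "b < 8" "c < 8" "d < 8" and x: "x < 9"
  shows "mobius f8_add f8_mul f8_inv 8 a b c d x = mobius add8 mul8 inv8 8 a b c d x"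
proof (cases "x = 8")
  case False
  then have x8: "x < 8" using x by simp
  have "add8 (mul8 c x) d < 8" "add8 (mul8 a x) b < 8" "mul8 a x < 8" "mul8 c x < 8"
    using table8_facts(3,4) abcd x8 by simp_all
  then show ?thesis using False abcd x8 by (simp add: mobius_def Let_def table8_facts(1,2) inv8_facts)
qed (use abcd in \<open>simp add: mobius_def table8_facts(2) inv8_facts\<close>)

lemma L8_mobius:
  assumes "a < 8" "b < 8" "c < 8" "d < 8"
  shows "map (mobius f8_add f8_mul f8_inv 8 a b c d) [0..<Suc 8] = L8 a b c d"
  unfolding L8_def upt_Suc_8 using mobius_tables[OF assms] by simp

lemma L8_nth: "i < 9 \<Longrightarrow> L8 a b c d ! i = mobius add8 mul8 inv8 8 a b c d i"
  unfolding L8_def upt_9[symmetric] by simp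

definition frobs9 :: "nat \<Rightarrow> nat list" where
  "frobs9 j = (if j = 0 then [0..<9] else if j = 1 then frob9 else cmp frob9 frob9)"

lemma frobs9_eq: "j < 3 \<Longrightarrow> frobs9 j = map (f8_frob ^^ j) [0..<Suc 8]"
proof -
  assume "j < 3"
  have F: "map f8_frob [0..<Suc 8] = frob9" using check_frob unfolding upt_Suc_8 frob9_def .
  have n: "f8_frob i = frob9 ! i" if "i < 9" for i
    unfolding F[symmetric] using that by (simp del: upt_Suc)
  have "set frob9 \<subseteq> {..<9}" by (simp add: frob9_def)
  then have "map f8_frob frob9 = cmp frob9 frob9" unfolding cmp_def using n by (intro map_cong) auto
  then have "map (f8_frob \<circ> f8_frob) [0..<Suc 8] = cmp frob9 frob9" using F by (simp only: map_map[symmetric])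
  moreover have "j = 0 \<or> j = 1 \<or> j = 2" using \<open>j < 3\<close> by auto
  ultimately show ?thesis using F by (auto simp: frobs9_def numeral_2_eq_2 simp del: upt_Suc)
qed

lemma L8_frobs9:
  assumes abcd: "a < 8" "b < 8" "c < 8" "d < 8" and j: "j < 3"
  shows "map (mobius f8_add f8_mul f8_inv 8 a b c d \<circ> (f8_frob ^^ j)) [0..<Suc 8] = cmp (L8 a b c d) (frobs9 j)"
proof -
  have "set (frobs9 j) \<subseteq> {..<9}" by (auto simp: frobs9_def frob9_def cmp_def)
  then have "map (mobius f8_add f8_mul f8_inv 8 a b c d) (frobs9 j) = cmp (L8 a b c d) (frobs9 j)"
    unfolding cmp_def using mobius_tables[OF abcd] L8_nth by (intro map_cong) auto
  then show ?thesis unfolding frobs9_eq[OF j] by (simp only: map_map)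
qed

lemma check_pow9: "map (\<lambda>j. pw j (pow9 ! 1)) [0, 1, 2, 3, 4, 5, 6] = pow9"
  by code_simp

lemma perms_Cons: "perms (x # xs) = concat (map (insertions x) (perms xs))"
  by (simp add: insertions_def[abs_def] del: upt_Suc)

text \<open>The labels are the projective line over GF(8), with 8 as infinity, and G contains
  multiplication by the generator 2. The support condition is what the absence of 3-cycles gives in
  degree 9.\<close>

locale list_rep_7_cycle = list_rep G \<Omega> e 9 for G :: "('a \<Rightarrow> 'a) set" and \<Omega> :: "'a set" and e +
  assumes R_pow9_1: "R (pow9 ! 1)" and mt: "multitrans 3 G \<Omega>"
    and no_small: "\<And>g. g \<in> G \<Longrightarrow> card (supp g) \<le> 5 \<Longrightarrow> card (supp g) = 0"
begin

lemma R_not_small: "R xs \<Longrightarrow> \<not> small xs"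
proof
  assume "R xs" "small xs"
  then obtain g where "g \<in> G" "card (supp g) = moved xs" using R_moved by blast
  then show False using no_small[of g] \<open>small xs\<close> unfolding small_def Let_def by (simp split: if_splits)
qed

lemma R_not_small_power: "R xs \<Longrightarrow> \<not> small_power xs"
  unfolding small_power_def using R_not_small R_comp by simp

lemma R_pow9: "j < 7 \<Longrightarrow> R (pow9 ! j)"
proof -
  assume "j < 7"
  have "[0, 1, 2, 3, 4, 5, 6] = [0..<7::nat]" by (simp add: upt_rec)
  then have "pow9 ! j = pw j (pow9 ! 1)"
    using \<open>j < 7\<close> by (subst check_pow9[symmetric]) (simp del: upt_Suc)
  then show ?thesis using R_pw[OF R_pow9_1] by simp
qed

lemma R_ew:
  assumes g: "R g" and w: "\<forall>i\<in>set w. i < 7" shows "R (ew g w)"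
  using w
proof (induction w)
  case Nil
  then show ?case using R_id unfolding upt_9 by simp
next
  case (Cons i w)
  then show ?case using R_comp[OF R_pow9 R_comp[OF g]] by simp
qed

text \<open>The images of 0, 1 and infinity are prescribed, so 720 candidates remain; all but six
  generate with the 7-cycle a forbidden small support.\<close>

lemma R_011:
  assumes x: "R x" and v: "x ! 0 = 8" "x ! 1 = 0" "x ! 8 = 1"
  shows "x \<in> set good9 \<or> x \<in> set good9a"
proof -
  have "length x = 9" by (rule R_length[OF x])
  then obtain x0 x1 x2 x3 x4 x5 x6 x7 x8 where l: "x = [x0, x1, x2, x3, x4, x5, x6, x7, x8]"
    by (auto simp: numeral_eq_Suc length_Suc_conv)
  let ?q = "[x2, x3, x4, x5, x6, x7]"
  have xq: "x = 8 # 0 # ?q @ [1]" using l v by simp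
  have d: "distinct x" by (rule R_distinct[OF x])
  have "set ?q = set x - {8, 0, 1}" using d unfolding xq by auto
  also have "\<dots> = {2, 3, 4, 5, 6, 7}" unfolding R_set[OF x] by auto
  finally have "?q \<in> set (perms [2, 3, 4, 5, 6, 7])" using d l by (intro perms_complete) auto
  then obtain p where p: "p \<in> set (perms [3, 4, 5, 6, 7])" "?q \<in> set (insertions 2 p)"
    unfolding perms_Cons[of 2] set_concat set_map by blast
  obtain r where r: "r \<in> set (perms [4, 5, 6, 7])" "p \<in> set (insertions 3 r)"
    using p(1) unfolding perms_Cons[of 3] set_concat set_map by blast
  have "test9b r" using check_degree_9 r(1) unfolding every_iff by blast
  then have "test9a p" using r(2) unfolding test9b_def every_iff by blast
  then have t: "test9 ?q" using p(2) unfolding test9a_def every_iff by blast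
  have "\<not> some_small x words9"
  proof
    assume "some_small x words9"
    then obtain w where w: "w \<in> set words9" "small_power (ew x w)" unfolding some_small_iff by blast
    have "\<forall>i\<in>set w. i < 7" using w(1) by (auto simp: words9_def)
    then show False using R_not_small_power[OF R_ew[OF x]] w(2) by blast
  qed
  then show ?thesis using t unfolding test9_def xq[symmetric] memb_iff by (simp split: if_splits)
qed

text \<open>Relabelling by \<open>invert9\<close> turns the sixth power of the 7-cycle into the
  standard generator, so the hypotheses persist while \<open>good9a\<close> is carried into
  \<open>good9\<close>.\<close>

lemma R_reindex:
  assumes x: "R x"
  shows "list_rep_7_cycle G \<Omega> (\<lambda>i. e (invert9 ! i))"
    "list_rep.R G (\<lambda>i. e (invert9 ! i)) 9 (cmp invert9 (cmp x invert9))"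
proof -
  have ii: "invert9 ! i < 9 \<and> invert9 ! (invert9 ! i) = i" if "i < 9" for i
    using less_9_set[OF that] by (auto simp: invert9_def)
  have "bij_betw (\<lambda>i. invert9 ! i) {..<9} {..<9}"
    by (rule bij_betw_byWitness[where f' = "\<lambda>i. invert9 ! i"]) (use ii in auto)
  then have "bij_betw (e \<circ> (\<lambda>i. invert9 ! i)) {..<9} \<Omega>" by (rule bij_betw_trans[OF _ e_bij])
  then interpret I: list_rep G \<Omega> "\<lambda>i. e (invert9 ! i)" 9 by unfold_locales (simp add: comp_def)
  have RI: "I.R (cmp invert9 (cmp y invert9))" if y: "R y" for y
  proof -
    obtain g where g: "g \<in> G" "\<And>i. i < 9 \<Longrightarrow> g (e i) = e (y ! i)" using R_elem[OF y] by blast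
    have len: "length invert9 = 9" "set invert9 \<subseteq> {..<9}" by (simp_all add: invert9_def)
    have "y ! (invert9 ! i) < 9" if "i < 9" for i using R_nth[OF y] ii[OF that] by blast
    then show ?thesis unfolding I.R_def using g ii len
      by (auto simp: cmp_def in_set_conv_nth intro!: bexI[OF _ g(1)])
  qed
  show "I.R (cmp invert9 (cmp x invert9))" by (rule RI[OF x])
  have "R (pow9 ! 6)" by (rule R_pow9) simp
  then have "I.R (pow9 ! 1)" using RI[of "pow9 ! 6"] unfolding check_words9 by blast
  then show "list_rep_7_cycle G \<Omega> (\<lambda>i. e (invert9 ! i))" using mt no_small by unfold_locales
qed

lemma R_g9_if_good: "x \<in> set good9 \<Longrightarrow> R x \<Longrightarrow> R g9"
proof -
  assume x: "x \<in> set good9" "R x"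
  have w: "R (wp [pow9 ! 1, x] w)" if "\<forall>i\<in>set w. i < 2" for w
    by (rule R_wp) (use R_pow9_1 x(2) that in auto)
  have "x = good9 ! 0 \<or> x = good9 ! 1 \<or> x = good9 ! 2" using x(1) by (simp add: good9_def)
  then show ?thesis
  proof (elim disjE)
    assume "x = good9 ! 0"
    then show ?thesis using x(2) unfolding check_words9(1) by simp
  next
    assume y: "x = good9 ! 1"
    have "R (wp [pow9 ! 1, good9 ! 1] [0, 0, 1, 0, 1, 0, 0, 1, 0, 1, 0, 1, 0, 1])" unfolding y[symmetric] by (rule w) simp
    then show ?thesis unfolding check_words9(4) .
  next
    assume y: "x = good9 ! 2"
    have "R (wp [pow9 ! 1, good9 ! 2] [0, 1, 0, 1, 0, 1, 0, 0, 1, 0, 1, 0, 0, 1])" unfolding y[symmetric] by (rule w) simp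
    then show ?thesis unfolding check_words9(5) .
  qed
qed

text \<open>3-transitivity supplies an element with 0, 1, infinity \<mapsto> infinity, 0, 1. If it
  belongs to the wrong family, the labelling is changed once and for all.\<close>

lemma g9_rep: "\<exists>e'. list_rep_7_cycle G \<Omega> e' \<and> list_rep.R G e' 9 g9"
proof -
  obtain x where x: "R x" "map (\<lambda>i. x ! i) [0, 1, 8] = [8, 0, 1]"
    by (rule multitrans_R[OF mt, of "[0, 1, 8]" "[8, 0, 1]"]) auto
  then have "x \<in> set good9 \<or> x \<in> set good9a" by (intro R_011) auto
  then show ?thesis
  proof
    assume "x \<in> set good9"
    then show ?thesis using R_g9_if_good x(1) list_rep_7_cycle_axioms by blast
  next
    assume "x \<in> set good9a"
    then have "x = good9a ! 0 \<or> x = good9a ! 1 \<or> x = good9a ! 2" by (simp add: good9a_def)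
    then have "cmp invert9 (cmp x invert9) \<in> set good9"
      using check_words9(10-12) unfolding memb_iff by (elim disjE; simp only:)
    then show ?thesis using list_rep_7_cycle.R_g9_if_good[OF R_reindex(1)] R_reindex x(1) by blast
  qed
qed

context
  assumes R_g9: "R g9"
begin

lemma R_L8_generators: "R (L8 1 1 0 1)" "R (L8 0 1 1 0)"
proof -
  have w: "R (wp [pow9 ! 1, g9] w)" if "\<forall>i\<in>set w. i < 2" for w
    by (rule R_wp) (use R_pow9_1 R_g9 that in auto)
  show "R (L8 1 1 0 1)" unfolding check_words9(6)[symmetric] by (rule w) simp
  show "R (L8 0 1 1 0)" unfolding check_words9(7)[symmetric] by (rule w) simp
qed

lemma log8_less: "log8 a < 7" if "a < 8"
  using less_8_set[OF that] by (auto simp: log8_def)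

lemma R_L8_scale: "a < 8 \<Longrightarrow> a \<noteq> 0 \<Longrightarrow> R (L8 a 0 0 1)"
  using check_scale8(1) less_8_set' R_pow9[OF log8_less] unfolding every_iff scale8_def by metis

lemma R_L8_translate: "a < 8 \<Longrightarrow> R (L8 1 a 0 1)"
proof (cases "a = 0")
  case True
  then show ?thesis using R_id unfolding upt_9 check_scale8(2)[symmetric] by simp
next
  case False
  assume a: "a < 8"
  have "L8 1 a 0 1 = cmp (pow9 ! log8 a) (cmp (L8 1 1 0 1) (pow9 ! log8 (inv8 a)))"
    using check_scale8(1) less_8_set'[OF a False] unfolding every_iff scale8_def by blast
  then show ?thesis
    using R_comp[OF R_pow9[OF log8_less[OF a]] R_comp[OF R_L8_generators(1) R_pow9[OF log8_less[OF inv8_facts(2)[OF a]]]]]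
    by simp
qed

lemma R_L8_normalized:
  assumes ab: "a < 8" "b < 8" and cd: "(c = 0 \<and> d = 1) \<or> (c = 1 \<and> d < 8)"
    and t: "add8 (mul8 a d) (mul8 b c) \<noteq> 0"
  shows "R (L8 a b c d)"
proof -
  have "member8b a" using check_members8 less_8_set[OF ab(1)] unfolding every_iff by blast
  then have m: "member8a a b" using less_8_set[OF ab(2)] unfolding member8b_def every_iff by blast
  have i1: "inv8 1 = 1" by (simp add: inv8_def)
  show ?thesis using cd
  proof (elim disjE conjE)
    assume c: "c = 0" "d = 1"
    have "mul8 b 0 = 0" using less_8_set[OF ab(2)] by (auto simp: mul8_def)
    moreover have "add8 0 0 = 0" "mul8 0 1 = 0" by (simp_all add: add8_def mul8_def)
    ultimately have a0: "a \<noteq> 0" using t c by metis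
    have a1: "mul8 a 1 < 8" "mul8 a 1 \<noteq> 0" "mul8 b 1 < 8"
      using table8_facts(4) ab scaling8_facts(9)[OF ab(1) a0, of 1] by simp_all
    have "L8 a b 0 1 = cmp (L8 1 (mul8 b 1) 0 1) (L8 (mul8 a 1) 0 0 1)"
      using m t unfolding member8a_def member8_def Let_def c i1 by simp
    then show ?thesis using R_comp[OF R_L8_translate[OF a1(3)] R_L8_scale[OF a1(1,2)]] c by simp
  next
    assume c: "c = 1" and d: "d < 8"
    define t' where "t' = add8 (mul8 a d) (mul8 b 1)"
    have t': "t' < 8" "t' \<noteq> 0" using t table8_facts(3,4) ab d unfolding t'_def c by simp_all
    have "mul8 1 1 = 1" by (simp add: mul8_def)
    then have u: "mul8 t' (mul8 1 1) < 8" "mul8 t' (mul8 1 1) \<noteq> 0"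
      using table8_facts(4)[OF t'(1), of 1] scaling8_facts(9)[OF t', of 1] by simp_all
    have v: "mul8 a 1 < 8" "mul8 d 1 < 8" using table8_facts(4) ab d by simp_all
    have "member8 a b 1 d" using m less_8_set[OF d] unfolding member8a_def every_iff by blast
    then have "L8 a b 1 d = cmp (L8 1 (mul8 a 1) 0 1) (cmp (L8 (mul8 t' (mul8 1 1)) 0 0 1) (cmp (L8 0 1 1 0) (L8 1 (mul8 d 1) 0 1)))"
      using t'(2) unfolding member8_def Let_def i1 t'_def[symmetric] by simp
    then show ?thesis
      using R_comp[OF R_L8_translate[OF v(1)] R_comp[OF R_L8_scale[OF u] R_comp[OF R_L8_generators(2) R_L8_translate[OF v(2)]]]] c
      by simp
  qed
qed

text \<open>Dividing the coefficients by c, or by d if c = 0, leaves the map unchanged and reaches a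
  checked bottom row.\<close>

lemma R_L8:
  assumes abcd: "a < 8" "b < 8" "c < 8" "d < 8" and t: "add8 (mul8 a d) (mul8 b c) \<noteq> 0"
  shows "R (L8 a b c d)"
proof (cases "c = 0")
  case False
  let ?l = "inv8 c"
  have l: "?l < 8" "?l \<noteq> 0" "mul8 ?l c = 1"
    using inv8_facts(2)[OF abcd(3)] scaling8_facts(3,4)[OF abcd(3) False] by blast+
  have "R (L8 (mul8 ?l a) (mul8 ?l b) (mul8 ?l c) (mul8 ?l d))"
    by (rule R_L8_normalized) (use table8_facts(4)[OF l(1)] abcd l(3) L8_scale(2)[OF l(1,2) abcd] t in auto)
  then show ?thesis unfolding L8_scale(1)[OF l(1,2) abcd] .
next
  case True
  have "mul8 b 0 = 0" "mul8 a 0 = 0" using less_8_set[OF abcd(1)] less_8_set[OF abcd(2)] by (auto simp: mul8_def)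
  moreover have "add8 0 0 = 0" by (simp add: add8_def)
  ultimately have d0: "d \<noteq> 0" using t True by metis
  let ?l = "inv8 d"
  have l: "?l < 8" "?l \<noteq> 0" "mul8 ?l d = 1"
    using inv8_facts(2)[OF abcd(4)] scaling8_facts(3,4)[OF abcd(4) d0] by blast+
  have "mul8 ?l c = 0" using scaling8_facts(1)[OF l(1,2)] True by simp
  have "R (L8 (mul8 ?l a) (mul8 ?l b) (mul8 ?l c) (mul8 ?l d))"
    by (rule R_L8_normalized) (use table8_facts(4)[OF l(1)] abcd l(3) \<open>mul8 ?l c = 0\<close> L8_scale(2)[OF l(1,2) abcd] t in auto)
  then show ?thesis unfolding L8_scale(1)[OF l(1,2) abcd] .
qed

text \<open>Composing with \<open>g9\<close> gives an element covered by \<open>R_011\<close>. The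
  family \<open>good9a\<close> is excluded in the presence of \<open>g9\<close>, and the members of
  \<open>good9\<close> are \<open>g9\<close> composed with powers of the Frobenius map.\<close>

lemma R_fixing_011:
  assumes s: "R s" "s ! 0 = 0" "s ! 1 = 1" "s ! 8 = 8"
  shows "\<exists>j<3. s = frobs9 j"
proof -
  let ?z = "cmp g9 s"
  have Rz: "R ?z" by (rule R_comp[OF R_g9 s(1)])
  have "?z ! 0 = 8" "?z ! 1 = 0" "?z ! 8 = 1" using s R_length[OF s(1)] by (simp_all add: cmp_nth g9_def)
  then have alt: "?z \<in> set good9 \<or> ?z \<in> set good9a" by (rule R_011[OF Rz])
  have w: "\<not> small (wp [pow9 ! 1, g9, ?z] w)" if "\<forall>i\<in>set w. i < 3" for w
    by (rule R_not_small, rule R_wp) (use R_pow9_1 R_g9 Rz that in auto)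
  have "?z \<notin> set good9a"
  proof
    assume "?z \<in> set good9a"
    then have "?z = good9a ! 0 \<or> ?z = good9a ! 1 \<or> ?z = good9a ! 2" by (simp add: good9a_def)
    then show False
    proof (elim disjE)
      assume z: "?z = good9a ! 0"
      have "\<not> small (wp [pow9 ! 1, g9, ?z] [1, 2])" by (rule w) simp
      then show False using check_separate9(1) unfolding z by blast
    next
      assume z: "?z = good9a ! 1"
      have "\<not> small (wp [pow9 ! 1, g9, ?z] [1, 1, 2])" by (rule w) simp
      then show False using check_separate9(2) unfolding z by blast
    next
      assume z: "?z = good9a ! 2"
      have "\<not> small (wp [pow9 ! 1, g9, ?z] [1, 1, 2])" by (rule w) simp
      then show False using check_separate9(3) unfolding z by blast
    qed
  qed
  then have "?z = good9 ! 0 \<or> ?z = good9 ! 1 \<or> ?z = good9 ! 2" using alt by (simp add: good9_def)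
  moreover have g9_id: "cmp g9 [0..<9] = g9" unfolding cmp_def by (rule nth_equalityI) (simp_all add: g9_def)
  ultimately have "\<exists>j<3. ?z = cmp g9 (frobs9 j)"
    unfolding check_words9(1-3) frobs9_def
  proof (elim disjE)
    assume "?z = g9"
    then show "\<exists>j<3::nat. ?z = cmp g9 (if j = 0 then [0..<9] else if j = 1 then frob9 else cmp frob9 frob9)"
      using g9_id by (intro exI[of _ 0]) simp
  next
    assume "?z = cmp g9 frob9"
    then show "\<exists>j<3::nat. ?z = cmp g9 (if j = 0 then [0..<9] else if j = 1 then frob9 else cmp frob9 frob9)"
      by (intro exI[of _ 1]) simp
  next
    assume "?z = cmp g9 (cmp frob9 frob9)"
    then show "\<exists>j<3::nat. ?z = cmp g9 (if j = 0 then [0..<9] else if j = 1 then frob9 else cmp frob9 frob9)"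
      by (intro exI[of _ 2]) simp
  qed
  then obtain j where j: "j < 3" "?z = cmp g9 (frobs9 j)" by blast
  obtain h where h: "R h" "cmp h g9 = [0..<9]" using R_inverse[OF R_g9] by blast
  have cancel: "cmp h (cmp g9 y) = y" if y: "set y \<subseteq> {..<9}" for y
  proof -
    have "cmp h (cmp g9 y) = cmp (cmp h g9) y"
      by (rule cmp_assoc[symmetric]) (use y R_length[OF R_g9] in simp)
    then show ?thesis using cmp_upt[OF y] h(2) by simp
  qed
  have "set (frobs9 j) \<subseteq> {..<9}" by (auto simp: frobs9_def frob9_def cmp_def)
  then have c2: "cmp h (cmp g9 (frobs9 j)) = frobs9 j" by (rule cancel)
  have "cmp h (cmp g9 s) = s" by (rule cancel) (use R_set[OF s(1)] in simp)
  then have c1: "cmp h (cmp g9 (frobs9 j)) = s" unfolding j(2) .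
  have "s = frobs9 j" by (rule trans[OF c1[symmetric] c2])
  then show ?thesis using j(1) by blast
qed

text \<open>Some Moebius map agrees with x at 0, 1 and infinity and lies in G; the quotient fixes
  these three points and is a Frobenius power.\<close>

lemma PGammaL_form:
  assumes x: "R x"
  obtains a b c d j where "a < 8" "b < 8" "c < 8" "d < 8" "add8 (mul8 a d) (mul8 b c) \<noteq> 0" "j < 3"
    "R (frobs9 j)" "x = cmp (L8 a b c d) (frobs9 j)"
proof -
  let ?p = "x ! 0" and ?q = "x ! 1" and ?r = "x ! 8"
  have ne: "\<not> (?p = ?q \<or> ?p = ?r \<or> ?q = ?r)"
    using nth_eq_iff_index_eq[OF R_distinct[OF x]] R_length[OF x] by simp
  have lt: "?p < 9" "?q < 9" "?r < 9" using R_nth[OF x] by simp_all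
  have "interpolates8b ?p" using check_interpolation8 less_9_set[OF lt(1)] unfolding every_iff by blast
  then have "interpolates8a ?p ?q" using less_9_set[OF lt(2)] unfolding interpolates8b_def every_iff by blast
  then have i: "interpolates8 ?p ?q ?r" using less_9_set[OF lt(3)] unfolding interpolates8a_def every_iff by blast
  obtain a b c d where co: "coeffs8 ?p ?q ?r = (a, b, c, d)" by (metis surj_pair)
  have q: "a < 8" "b < 8" "c < 8" "d < 8" "add8 (mul8 a d) (mul8 b c) \<noteq> 0"
    and y: "L8 a b c d ! 0 = ?p" "L8 a b c d ! 1 = ?q" "L8 a b c d ! 8 = ?r"
    using i unfolding interpolates8_def Let_def if_not_P[OF ne] co prod.case by blast+
  let ?y = "L8 a b c d"
  have Ry: "R ?y" by (rule R_L8[OF q])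
  obtain z where z: "R z" "cmp z ?y = [0..<9]" "cmp ?y z = [0..<9]" by (rule R_inverse[OF Ry])
  let ?s = "cmp z x"
  have Rs: "R ?s" by (rule R_comp[OF z(1) x])
  have zy: "z ! (?y ! i) = i" if "i < 9" for i
    using arg_cong[OF z(2), of "\<lambda>l. l ! i"] that R_length[OF Ry] by (simp add: cmp_nth del: upt_Suc)
  have "?s ! 0 = 0" "?s ! 1 = 1" "?s ! 8 = 8"
    using zy[of 0] zy[of 1] zy[of 8] y R_length[OF x] by (simp_all add: cmp_nth)
  then obtain j where j: "j < 3" "?s = frobs9 j" using R_fixing_011[OF Rs] by blast
  have "cmp ?y ?s = cmp (cmp ?y z) x"
    by (rule cmp_assoc[symmetric]) (use R_set[OF x] R_length[OF z(1)] in simp)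
  also have "\<dots> = x" unfolding z(3) by (rule cmp_upt) (use R_set[OF x] in simp)
  finally have "x = cmp ?y (frobs9 j)" unfolding j(2) ..
  moreover have "R (frobs9 j)" using Rs unfolding j(2) .
  ultimately show ?thesis by (intro that[OF q j(1)])
qed

text \<open>The Frobenius map has order 3, so any nontrivial power of it generates the others. Hence
  there is no group strictly between PSL(2,8) and P\<Gamma>L(2,8).\<close>

lemma R_frobs9:
  assumes "R (frobs9 j)" "0 < j" "j < 3" "i < 3" shows "R (frobs9 i)"
proof -
  have "j = 1 \<or> j = 2" using assms by auto
  then have "R frob9"
    using assms(1) R_comp[of "cmp frob9 frob9" "cmp frob9 frob9"] unfolding check_words9(8)
    by (elim disjE) (simp_all add: frobs9_def)
  then show ?thesis using R_id R_comp unfolding frobs9_def by simp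
qed

end

end

context lambda_group_fix begin

lemma fixed_degree_9:
  assumes n: "n = 10" and k: "k = 5"
  shows "fixes_and_alt_or_sym \<or> perm_conj 10 G PSL_2_8 \<or> perm_conj 10 G PGammaL_2_8"
proof -
  let ?\<Omega> = "{1..n} - {a}"
  have c9: "card ?\<Omega> = 9" using cardP n by simp
  have d: "7 dvd card G" by (rule prime_dvd_order) (use n k in auto)
  have p7: "prime (7::nat)" by simp
  obtain c where c: "c \<in> G" "c ^^ 7 = id" "card (supp c) = 7" by (rule P.Cauchy_cycle[OF p7 d]) (use c9 in auto)
  have "multitrans (Suc 2) G ?\<Omega>"
    by (rule Jordan_multitrans[OF P.perm_group_axioms transP p7 c]) (use c9 in auto)
  then have mt: "multitrans 3 G ?\<Omega>" by (simp add: numeral_3_eq_3)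
  show ?thesis
  proof (cases "\<exists>t\<in>G. card (supp t) = 3")
    case True
    then show ?thesis using conclude P.multitrans_has_3_cycles[OF mt] by blast
  next
    case no3: False
    have "homog 4 G ?\<Omega>" using fix_homog n k by simp
    moreover from this have "homog (9 - 4) G ?\<Omega>" using P.homog_compl[of 4] c9 by simp
    moreover have "homog 1 G ?\<Omega>" "homog 2 G ?\<Omega>" "homog 3 G ?\<Omega>"
      by (intro P.multitrans_homog P.multitrans_mono[OF mt]; use c9 in simp)+
    \<comment> \<open>Sizes 1 to 3 come from 3-transitivity, 4 from the halves and 5 by
      complementation.\<close>
    ultimately have homog: "homog m G ?\<Omega>" if "1 \<le> m" "m \<le> 5" for m
    proof -
      have "m = 1 \<or> m = 2 \<or> m = 3 \<or> m = 4 \<or> m = 5" using that by auto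
      then show ?thesis using \<open>homog 1 G ?\<Omega>\<close> \<open>homog 2 G ?\<Omega>\<close> \<open>homog 3 G ?\<Omega>\<close> \<open>homog 4 G ?\<Omega>\<close> \<open>homog (9 - 4) G ?\<Omega>\<close>
        by (elim disjE) simp_all
    qed
    have no_small: "card (supp g) = 0" if g: "g \<in> G" "card (supp g) \<le> 5" for g
    proof (rule ccontr)
      assume "card (supp g) \<noteq> 0"
      then have m: "1 \<le> card (supp g)" by simp
      have "\<exists>t\<in>G. card (supp t) = 3"
        by (rule P.small_support_3_cycle[OF homog[OF m g(2)] g(1) refl m]) (use g(2) c9 in simp)
      then show False using no3 by blast
    qed
    have "supp c \<noteq> {}" using c(3) by auto
    then obtain x0 where x0: "x0 \<in> supp c" by blast
    have sub: "supp c \<subseteq> ?\<Omega>" by (rule P.supp_subset[OF c(1)])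
    have "card (?\<Omega> - supp c) = 2" using c9 c(3) sub P.finite_supp[OF c(1)] by (simp add: card_Diff_subset)
    then obtain u v where uv: "?\<Omega> - supp c = {u, v}" "u \<noteq> v" by (meson card_2_iff)
    \<comment> \<open>The moved point with label i is reached from x0 by the power
      \<open>log8 i\<close> of c, so that c becomes multiplication by 2. Its two fixed points become
      0 and infinity.\<close>
    define e where "e i = (if i = 0 then u else if i = 8 then v else (c ^^ log8 i) x0)" for i :: nat
    have bij: "bij_betw e {..<9} ?\<Omega>"
    proof -
      have "{..<7} = {0, 1, 2, 3, 4, 5, 6 :: nat}" by auto
      then have "bij_betw log8 {1, 2, 3, 4, 5, 6, 7} {..<7}" by (auto simp: bij_betw_def log8_def)
      then have "bij_betw ((\<lambda>i. (c ^^ i) x0) \<circ> log8) {1, 2, 3, 4, 5, 6, 7} (supp c)"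
        by (rule bij_betw_trans[OF _ P.cycle_enumeration[OF p7 c x0]])
      then have "bij_betw e {1, 2, 3, 4, 5, 6, 7} (supp c)"
        by (rule bij_betw_cong[THEN iffD1, rotated]) (auto simp: e_def)
      moreover have "bij_betw e {0, 8} {u, v}" using uv(2) by (auto simp: bij_betw_def e_def)
      ultimately have "bij_betw e ({1, 2, 3, 4, 5, 6, 7} \<union> {0, 8}) (supp c \<union> {u, v})"
        by (rule bij_betw_combine) (use uv in auto)
      moreover have "{1, 2, 3, 4, 5, 6, 7} \<union> {0, 8} = {..<9::nat}" by auto
      moreover have "supp c \<union> {u, v} = ?\<Omega>" using uv(1) sub by blast
      ultimately show ?thesis by simp
    qed
    interpret E: list_rep G ?\<Omega> e 9 by unfold_locales (rule bij)
    have "E.R (pow9 ! 1)" unfolding E.R_def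
    proof (intro conjI bexI[OF _ c(1)] allI impI)
      fix i :: nat assume "i < 9"
      then have i: "i = 0 \<or> i = 1 \<or> i = 2 \<or> i = 3 \<or> i = 4 \<or> i = 5 \<or> i = 6 \<or> i = 7 \<or> i = 8" by auto
      have "c ((c ^^ 6) x0) = x0" using fun_cong[OF c(2), of x0] by (simp add: numeral_eq_Suc)
      moreover have "u \<notin> supp c" "v \<notin> supp c" using uv(1) by blast+
      then have "c u = u" "c v = v" unfolding supp_def by blast+
      ultimately show "c (e i) = e (pow9 ! 1 ! i)" using i by (elim disjE) (simp_all add: e_def pow9_def log8_def numeral_eq_Suc)
    qed (simp_all add: pow9_def)
    then have "list_rep_7_cycle G ?\<Omega> e" using mt no_small by unfold_locales
    then obtain e' where e': "list_rep_7_cycle G ?\<Omega> e'" "list_rep.R G e' 9 g9"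
      using list_rep_7_cycle.g9_rep by blast
    interpret L: list_rep_7_cycle G ?\<Omega> e' by (rule e'(1))
    have rep: "list_rep G ?\<Omega> e' (Suc 8)" using L.list_rep_axioms by simp
    have \<Omega>: "?\<Omega> = {1..n} \<or> (\<exists>a\<in>{1..n}. ?\<Omega> = {1..n} - {a})" using a by blast
    have det: "f8_add (f8_mul p s) (f8_mul q r) = add8 (mul8 p s) (mul8 q r)"
      if "p < 8" "q < 8" "r < 8" "s < 8" for p q r s using that table8_facts by simp
    show ?thesis
    proof (cases "\<exists>j. 0 < j \<and> j < 3 \<and> L.R (frobs9 j)")
      case True
      then obtain j0 where j0: "L.R (frobs9 j0)" "0 < j0" "j0 < 3" by blast
      have "perm_conj n G PGammaL_2_8"
      proof (rule perm_conj_by_lists[OF rep \<Omega>])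
        show "\<exists>f. h = lift_pl 8 f \<and> list_rep.R G e' (Suc 8) (map f [0..<Suc 8])" if hP: "h \<in> PGammaL_2_8" for h
        proof -
          obtain p q r s j where h: "h = lift_pl 8 (mobius f8_add f8_mul f8_inv 8 p q r s \<circ> (f8_frob ^^ j))"
            and b: "p < 8" "q < 8" "r < 8" "s < 8" "f8_add (f8_mul p s) (f8_mul q r) \<noteq> 0" "j < 3"
            using hP unfolding PGammaL_2_8_def by blast
          have "L.R (cmp (L8 p q r s) (frobs9 j))"
            by (rule L.R_comp[OF L.R_L8[OF e'(2) b(1-4)] L.R_frobs9[OF e'(2) j0 b(6)]]) (use b(5) det[OF b(1-4)] in simp)
          then have "list_rep.R G e' (Suc 8) (map (mobius f8_add f8_mul f8_inv 8 p q r s \<circ> (f8_frob ^^ j)) [0..<Suc 8])"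
            unfolding L8_frobs9[OF b(1-4,6)] by simp
          then show ?thesis using h by blast
        qed
        show "\<exists>f. lift_pl 8 f \<in> PGammaL_2_8 \<and> map f [0..<Suc 8] = xs" if "list_rep.R G e' (Suc 8) xs" for xs
        proof -
          have x: "L.R xs" using that by simp
          obtain p q r s j where b: "p < 8" "q < 8" "r < 8" "s < 8" "add8 (mul8 p s) (mul8 q r) \<noteq> 0" "j < 3"
            and xs: "L.R (frobs9 j)" "xs = cmp (L8 p q r s) (frobs9 j)"
            by (rule L.PGammaL_form[OF e'(2) x])
          have det': "f8_add (f8_mul p s) (f8_mul q r) \<noteq> 0" unfolding det[OF b(1-4)] by (rule b(5))
          have m: "lift_pl 8 (mobius f8_add f8_mul f8_inv 8 p q r s \<circ> (f8_frob ^^ j)) \<in> PGammaL_2_8"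
            unfolding PGammaL_2_8_def mem_Collect_eq
            by (intro exI conjI, rule refl, rule b(1), rule b(2), rule b(3), rule b(4), rule det', rule b(6))
          have "map (mobius f8_add f8_mul f8_inv 8 p q r s \<circ> (f8_frob ^^ j)) [0..<Suc 8] = xs"
            unfolding xs(2) by (rule L8_frobs9[OF b(1-4,6)])
          with m show ?thesis by (intro exI conjI)
        qed
      qed
      then show ?thesis using n by simp
    next
      case False
      have "perm_conj n G PSL_2_8"
      proof (rule perm_conj_by_lists[OF rep \<Omega>])
        show "\<exists>f. h = lift_pl 8 f \<and> list_rep.R G e' (Suc 8) (map f [0..<Suc 8])" if hP: "h \<in> PSL_2_8" for h
        proof -
          obtain p q r s where h: "h = lift_pl 8 (mobius f8_add f8_mul f8_inv 8 p q r s)"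
            and b: "p < 8" "q < 8" "r < 8" "s < 8" "f8_add (f8_mul p s) (f8_mul q r) \<noteq> 0"
            using hP unfolding PSL_2_8_def by blast
          have "L.R (L8 p q r s)"
            by (rule L.R_L8[OF e'(2) b(1-4)]) (use b(5) det[OF b(1-4)] in simp)
          then have "list_rep.R G e' (Suc 8) (map (mobius f8_add f8_mul f8_inv 8 p q r s) [0..<Suc 8])"
            unfolding L8_mobius[OF b(1-4)] by simp
          then show ?thesis using h by blast
        qed
        show "\<exists>f. lift_pl 8 f \<in> PSL_2_8 \<and> map f [0..<Suc 8] = xs" if "list_rep.R G e' (Suc 8) xs" for xs
        proof -
          have x: "L.R xs" using that by simp
          obtain p q r s j where b: "p < 8" "q < 8" "r < 8" "s < 8" "add8 (mul8 p s) (mul8 q r) \<noteq> 0" "j < 3"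
            and xs: "L.R (frobs9 j)" "xs = cmp (L8 p q r s) (frobs9 j)"
            by (rule L.PGammaL_form[OF e'(2) x])
          have j0: "j = 0"
          proof (rule ccontr)
            assume "j \<noteq> 0"
            then have "0 < j \<and> j < 3 \<and> L.R (frobs9 j)" using b(6) xs(1) by simp
            then show False using False by blast
          qed
          have det': "f8_add (f8_mul p s) (f8_mul q r) \<noteq> 0" unfolding det[OF b(1-4)] by (rule b(5))
          have m: "lift_pl 8 (mobius f8_add f8_mul f8_inv 8 p q r s) \<in> PSL_2_8"
            unfolding PSL_2_8_def mem_Collect_eq
            by (intro exI conjI, rule refl, rule b(1), rule b(2), rule b(3), rule b(4), rule det')
          have "map (mobius f8_add f8_mul f8_inv 8 p q r s \<circ> (f8_frob ^^ j)) [0..<Suc 8] = xs"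
            unfolding xs(2) by (rule L8_frobs9[OF b(1-4,6)])
          then have "map (mobius f8_add f8_mul f8_inv 8 p q r s) [0..<Suc 8] = xs"
            unfolding j0 by (simp only: funpow.simps comp_id)
          with m show ?thesis by (intro exI conjI)
        qed
      qed
      then show ?thesis using n by simp
    qed
  qed
qed

end

section \<open>Assembling the cases\<close>

lemma middle_prime:
  fixes n :: nat
  assumes "n \<ge> 16"
  shows "\<exists>p. prime p \<and> n < 2 * p \<and> p + 4 \<le> n"
proof -
  have "n div 2 \<ge> 8" using assms by linarith
  then obtain p where p: "prime p" "n div 2 < p" "p + 4 \<le> 2 * (n div 2)" using prime_between by blast
  then have "n < 2 * p" "p + 4 \<le> n" by linarith+
  then show ?thesis using p(1) by blast
qed

context lambda_group begin

lemma transitive_large: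
  assumes tr: "transitive G {1..n}" and p: "prime p" "n < 2 * p" "p + 3 \<le> n"
  shows "lambda_transitive n k G"
proof -
  have "p dvd card G" by (rule prime_dvd_order) (use p n_ge in auto)
  then show ?thesis
    by (intro lambda_transitive_if_3_cycles Jordan_has_3_cycles[OF tr p(1)]) (use p in auto)
qed

lemma transitive_degree_4:
  assumes tr: "transitive G {1..n}" and n: "n = 4" and k: "k = 2"
  shows "lambda_transitive n k G"
proof -
  have d: "3 dvd card G" by (rule prime_dvd_order) (use n k in auto)
  have p3: "prime (3::nat)" by simp
  obtain c where c: "c \<in> G" "c ^^ 3 = id" "card (supp c) = 3" by (rule Cauchy_cycle[OF p3 d]) (use n in auto)
  have "multitrans (Suc 1) G {1..n}"
    by (rule Jordan_multitrans[OF perm_group_axioms tr p3 c]) (use n in auto)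
  then have "homog 2 G {1..n}" using multitrans_homog by (simp add: numeral_2_eq_2)
  then show ?thesis using lambda_transitive_if_homog n k by simp
qed

lemma transitive_degree_6_pairs:
  assumes tr: "transitive G {1..n}" and n: "n = 6" and k: "k = 2"
  shows "lambda_transitive n k G"
proof -
  have d: "5 dvd card G" by (rule prime_dvd_order) (use n k in auto)
  have p5: "prime (5::nat)" by simp
  obtain c where c: "c \<in> G" "c ^^ 5 = id" "card (supp c) = 5" by (rule Cauchy_cycle[OF p5 d]) (use n in auto)
  have "multitrans (Suc 1) G {1..n}"
    by (rule Jordan_multitrans[OF perm_group_axioms tr p5 c]) (use n in auto)
  then have mt: "multitrans 2 G {1..n}" by (simp add: numeral_2_eq_2)
  obtain t where "t \<in> G" "card (supp t) = 3" using degree_6_pairs_3_cycle[OF n k] by blast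
  then show ?thesis using lambda_transitive_if_3_cycles degree_6_has_3_cycles[OF _ mt] n by simp
qed

lemma small_cases:
  "(n = 4 \<and> k = 2) \<or> (n = 6 \<and> k = 2) \<or> (n = 6 \<and> k = 3) \<or> n \<ge> 8"
proof (rule ccontr)
  assume c: "\<not> ?thesis"
  then have "n < 8" by simp
  then have "k = 2 \<or> k = 3" using n_ge k2 by auto
  moreover have "n = 4 \<or> n = 5 \<or> n = 6 \<or> n = 7" using \<open>n < 8\<close> n_ge k2 by auto
  ultimately show False using c dvd by (elim disjE) auto
qed

lemma transitive_case:
  assumes tr: "transitive G {1..n}"
  shows "lambda_transitive n k G \<or> (n = 6 \<and> k = 3 \<and> perm_conj 6 G PSL_2_5)"
proof -
  have "lambda_transitive n k G" if n8: "n \<ge> 8"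
  proof -
    have "\<exists>p. prime p \<and> n < 2 * p \<and> p + 3 \<le> n"
    proof (cases "n \<ge> 16")
      case True
      then obtain p where "prime p" "n < 2 * p" "p + 4 \<le> n" using middle_prime by blast
      then show ?thesis by (intro exI[of _ p]) simp
    next
      case False
      \<comment> \<open>The prime 5 serves n = 8, 9, the prime 7 serves 10 to 13 and the prime 11
        serves 14, 15.\<close>
      have "prime (5::nat)" "prime (7::nat)" "prime (11::nat)" by simp_all
      then show ?thesis
        by (intro exI[of _ "if n < 10 then 5 else if n < 14 then 7 else 11"]) (use n8 False in \<open>simp split: if_split\<close>)
    qed
    then show ?thesis using transitive_large[OF tr] by blast
  qed
  then show ?thesis
    using small_cases transitive_degree_4[OF tr] transitive_degree_6_pairs[OF tr] degree_6_halves[OF _ _ tr] by blast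
qed

end

text \<open>For n = 10 and n = 14 the prime n / 2 is admissible unless k = n / 2, which is why these
  two degrees split. For n = 8 no prime p has n \<le> 2 p and p + 4 \<le> n.\<close>

lemma (in lambda_group_fix) fixed_case:
  "fixes_and_alt_or_sym \<or> (n = 6 \<and> k = 3 \<and> perm_conj 6 G AGL_1_5_fix)
    \<or> (n = 10 \<and> k = 5 \<and> (perm_conj 10 G PSL_2_8 \<or> perm_conj 10 G PGammaL_2_8))"
proof -
  have p: "prime (5::nat)" "prime (7::nat)" "prime (11::nat)" by simp_all
  have "n = 8 \<or> n = 9 \<or> n = 10 \<or> (11 \<le> n \<and> n \<le> 13) \<or> n = 14 \<or> n = 15 \<or> n \<ge> 16" if "n \<ge> 8"
    using that by arith
  then consider "n = 4" "k = 2" | "n = 6" "k = 2" | "n = 6" "k = 3" | "n = 8" | "n = 9" | "n = 10" "k = 5" | "n = 10" "k \<noteq> 5"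
    | "11 \<le> n" "n \<le> 13" | "n = 14" "k = 7" | "n = 14" "k \<noteq> 7" | "n = 15" | "n \<ge> 16"
    using small_cases by blast
  then show ?thesis
  proof cases
    case 4
    then show ?thesis using fixed_degree_7[OF 4] n_ge by simp
  next
    case 5
    then show ?thesis using fixed_large[OF p(1)] n_ge by simp
  next
    case 7
    then show ?thesis using fixed_large[OF p(1)] n_ge by simp
  next
    case 8
    then show ?thesis using fixed_large[OF p(2)] n_ge by simp
  next
    case 10
    then show ?thesis using fixed_large[OF p(2)] n_ge by simp
  next
    case 11
    then show ?thesis using fixed_large[OF p(3)] n_ge by simp
  next
    case 12
    then obtain p where "prime p" "n < 2 * p" "p + 4 \<le> n" using middle_prime by blast
    then show ?thesis using fixed_large[of p] n_ge by simp
  qed (use fixed_degree_3 fixed_degree_5_pairs fixed_degree_5_halves fixed_degree_9 fixed_degree_13 in blast)+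
qed

theorem theorem4p1:
  fixes n k :: nat and G :: "(nat \<Rightarrow> nat) set"
  assumes "n \<ge> 1" and "k dvd n" and "k \<ge> 2"
    and "subgroup G (sym_group n)"
    and "lambda_homogeneous n k G"
  shows "lambda_transitive n k G
    \<or> (n = 6 \<and> k = 3 \<and> (perm_conj 6 G PSL_2_5 \<or> perm_conj 6 G AGL_1_5_fix))
    \<or> (n = 10 \<and> k = 5 \<and> (perm_conj 10 G PSL_2_8 \<or> perm_conj 10 G PGammaL_2_8))
    \<or> (\<exists>a \<in> {1..n}. (\<forall>g \<in> G. g a = a) \<and>
         (G = {p. p permutes ({1..n} - {a})} \<or>
          G = {p. p permutes ({1..n} - {a}) \<and> evenperm p}))"
proof -
  interpret P: perm_group G "{1..n}" by (rule subgroup_perm_group[OF assms(4)])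
  show ?thesis
  proof (cases "n div k \<ge> 2")
    \<comment> \<open>Here k = n: there is only one part, the whole set, and the identity
      serves.\<close>
    case False
    have "n div k \<noteq> 0" using assms(1-3) by (auto simp: dvd_div_eq_0_iff)
    then have m: "n div k = 1" using False by simp
    have A0: "A 0 = {1..n}" if "ordered_partition_type n k A" for A
      using that unfolding ordered_partition_type_def m by auto
    have "lambda_transitive n k G" unfolding lambda_transitive_def m
    proof (intro allI impI bexI[OF _ P.one])
      fix A B and i :: nat
      assume "ordered_partition_type n k A" "ordered_partition_type n k B" "i < 1"
      then show "id ` A i = B i" using A0[of A] A0[of B] by simp
    qed
    then show ?thesis ..
  next
    case True
    then interpret L: lambda_group G n k using assms by unfold_locales
    from L.transitive_or_fixed_point show ?thesis
    proof
      assume "transitive G {1..n}"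
      then show ?thesis using L.transitive_case by blast
    next
      assume "\<exists>a\<in>{1..n}. (\<forall>g\<in>G. g a = a) \<and> transitive G ({1..n} - {a})"
      then obtain a where a: "a \<in> {1..n}" "\<And>g. g \<in> G \<Longrightarrow> g a = a" "transitive G ({1..n} - {a})" by blast
      interpret F: lambda_group_fix G n k a by unfold_locales (use a in auto)
      show ?thesis using F.fixed_case unfolding L.fixes_and_alt_or_sym_def by blast
    qed
  qed
qed

end
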